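(* Let $N\geqslant 2$, let $\Omega\subset\mathbb{R}^N$ be a smooth bounded domain, let $s\in(0,1)$, and let $l,p,m,\mathfrak{m}_1,\mathfrak{m}_2$ be real constants with $1<\mathfrak{m}_1<l\leqslant p\leqslant m<\mathfrak{m}_2<p_s^\star:=\frac{Np}{N-sp}$, $m<\frac{N}{s}$ and $(\mathfrak{m}_2-1)(m-l)<(\mathfrak{m}_2-l)(m-\mathfrak{m}_1)$. Let $\mathcal{A}:\mathbb{R}\to\mathbb{R}$ be odd and of class $C^2$, such that $\mathscr{A}(t):=\int_0^{|t|}\mathcal{A}(\tau)\,d\tau$ is strictly convex on $\mathbb{R}$; such that there are constants $c_{\mathcal{A}},C_{\mathcal{A}}>0$ with $\mathcal{A}(t)t\geqslant c_{\mathcal{A}}|t|^p$ and $|\mathcal{A}(t)|\leqslant C_{\mathcal{A}}|t|^{p-1}$ for all $t\in\mathbb{R}$; and such that for all $t\in\mathbb{R}$: (i) $l\mathscr{A}(t)\leqslant\mathcal{A}(t)t\leqslant p\mathscr{A}(t)$, (ii) $(l-1)\mathcal{A}(t)t\leqslant t^2\mathcal{A}'(t)\leqslant(m-1)\mathcal{A}(t)t$, (iii) $(l-2)\mathcal{A}'(t)\leqslant\mathcal{A}''(t)t\leqslant(m-2)\mathcal{A}'(t)$. Let $K:\mathbb{R}^N\times\mathbb{R}^N\to\mathbb{R}^+$ be measurable with constants $0<b_0\leqslant b_1$ such that $b_0\leqslant K(x,y)|x-y|^{N+sp}\leqslant b_1$ for all $x\neq y$. Let $\mathfrak{a},\mathfrak{b}:\overline\Omega\to\mathbb{R}$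 be (possibly sign-changing) functions in $L^\infty(\Omega)$ with $\mathfrak{a}^+\not\equiv0$ and $\mathfrak{b}^+\not\equiv0$. Then there exists $\tilde\lambda>0$ such that for all $0<\lambda<\tilde\lambda$ the problem $$\mathscr{L}_{\mathcal{A}K}u=\lambda\mathfrak{a}(x)|u|^{\mathfrak{m}_1-2}u+\mathfrak{b}(x)|u|^{\mathfrak{m}_2-2}u\ \text{ in }\Omega,\qquad u=0\ \text{ in }\mathbb{R}^N\setminus\Omega,$$ admits at least one ground state solution $u\in\mathcal{N}^+_{\lambda,1}$, and it satisfies $\mathcal{J}_{\lambda,1}(u)<0$.
   Context: $f^+=\max\{f,0\}$. $W^{s,p}_0(\Omega):=\{u\in W^{s,p}(\mathbb{R}^N): u=0\text{ a.e. in }\mathbb{R}^N\setminus\Omega\}$, with norm $\|u\|=\big(\int_{\mathbb{R}^N\times\mathbb{R}^N}\frac{|u(x)-u(y)|^p}{|x-y|^{N+sp}}dx\,dy\big)^{1/p}$. The operator is $\mathscr{L}_{\mathcal{A}K}u(x)=P.V.\int_{\mathbb{R}^N}\mathcal{A}(u(x)-u(y))K(x,y)\,dy$. A weak solution of the problem is $u\in W^{s,p}_0(\Omega)$ such that for every $v\in W^{s,p}_0(\Omega)$ $$\int_{\mathbb{R}^N\times\mathbb{R}^N}\mathcal{A}(u(x)-u(y))(v(x)-v(y))K(x,y)\,dx\,dy=\int_\Omega\big[\lambda\mathfrak{a}|u|^{\mathfrak{m}_1-2}uv+\mathfrak{b}|u|^{\mathfrak{m}_2-2}uv\big]dx.$$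 The energy functional on $W^{s,p}_0(\Omega)$ is $$\mathcal{J}_{\lambda,1}(u)=\int_{\mathbb{R}^N\times\mathbb{R}^N}\mathscr{A}(u(x)-u(y))K(x,y)\,dx\,dy-\frac{\lambda}{\mathfrak{m}_1}\int_\Omega\mathfrak{a}|u|^{\mathfrak{m}_1}dx-\frac1{\mathfrak{m}_2}\int_\Omega\mathfrak{b}|u|^{\mathfrak{m}_2}dx.$$ The Nehari manifold is $\mathcal{N}_{\lambda,1}=\{u\in W^{s,p}_0(\Omega)\setminus\{0\}:\langle\mathcal{J}'_{\lambda,1}(u),u\rangle=0\}$. For $u\neq0$ the fibering map is $\wp_u(t)=\mathcal{J}_{\lambda,1}(tu)$, $t>0$, with $$\wp_u''(1)=\int_{\mathbb{R}^N\times\mathbb{R}^N}\mathcal{A}'(u(x)-u(y))(u(x)-u(y))^2K(x,y)\,dx\,dy-\lambda(\mathfrak{m}_1-1)\int_\Omega\mathfrak{a}|u|^{\mathfrak{m}_1}dx-(\mathfrak{m}_2-1)\int_\Omega\mathfrak{b}|u|^{\mathfrak{m}_2}dx.$$ $\mathcal{N}^+_{\lambda,1}=\{u\in\mathcal{N}_{\lambda,1}:\wp_u''(1)>0\}$. A ground state solution in $\mathcal{N}^+_{\lambda,1}$ is a weak solution $u\in\mathcal{N}^+_{\lambda,1}$ with $\mathcal{J}_{\lambda,1}(u)=\inf_{\mathcal{N}^+_{\lambda,1}}\mathcal{J}_{\lambda,1}$. *)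

theory Defs
  imports "HOL-Analysis.Analysis"
begin

primrec C_k :: "nat \<Rightarrow> ('a::real_normed_vector \<Rightarrow> real) \<Rightarrow> bool" where
  "C_k 0 f \<longleftrightarrow> continuous_on UNIV f"
| "C_k (Suc k) f \<longleftrightarrow>
     (\<forall>x. f differentiable (at x)) \<and> (\<forall>v. C_k k (\<lambda>x. frechet_derivative f (at x) v))"

definition smooth :: "('a::real_normed_vector \<Rightarrow> real) \<Rightarrow> bool" where
  "smooth f \<longleftrightarrow> (\<forall>k. C_k k f)"

text \<open>Near every boundary point, after a choice of a direction \<open>e\<close>, the set is the strict
  epigraph of a smooth function on the hyperplane orthogonal to \<open>e\<close>; the function is given as a
  smooth function on the whole space that is only evaluated at projections to that hyperplane.\<close>

definition smooth_boundary :: "'a::euclidean_space set \<Rightarrow> bool" where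
  "smooth_boundary \<Omega> \<longleftrightarrow>
     (\<forall>x0\<in>frontier \<Omega>. \<exists>r>0. \<exists>e \<gamma>. norm e = 1 \<and> smooth \<gamma> \<and>
        \<Omega> \<inter> ball x0 r = {x \<in> ball x0 r. \<gamma> (x - (x \<bullet> e) *\<^sub>R e) < x \<bullet> e})"

definition smooth_bounded_domain :: "'a::euclidean_space set \<Rightarrow> bool" where
  "smooth_bounded_domain \<Omega> \<longleftrightarrow>
     open \<Omega> \<and> connected \<Omega> \<and> \<Omega> \<noteq> {} \<and> bounded \<Omega> \<and> smooth_boundary \<Omega>"

text \<open>Members of Lebesgue and Sobolev spaces are represented by Lebesgue measurable functions;
  two functions that agree almost everywhere stand for the same element.\<close>

definition L_infty :: "'a::euclidean_space set \<Rightarrow> ('a \<Rightarrow> real) \<Rightarrow> bool" where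
  "L_infty \<Omega> f \<longleftrightarrow> set_borel_measurable lebesgue \<Omega> f \<and>
     (\<exists>C. AE x in lebesgue. x \<in> \<Omega> \<longrightarrow> \<bar>f x\<bar> \<le> C)"

definition gagliardo_integrand ::
    "real \<Rightarrow> real \<Rightarrow> (real^'n \<Rightarrow> real) \<Rightarrow> (real^'n) \<times> (real^'n) \<Rightarrow> real" where
  "gagliardo_integrand s p u = (\<lambda>(x, y).
     \<bar>u x - u y\<bar> powr p / norm (x - y) powr (real CARD('n) + s * p))"

definition frac_sobolev :: "real \<Rightarrow> real \<Rightarrow> (real^'n \<Rightarrow> real) set" where
  "frac_sobolev s p = {u. u \<in> borel_measurable lebesgue \<and>
     integrable lebesgue (\<lambda>x. \<bar>u x\<bar> powr p) \<and>
     integrable lebesgue (gagliardo_integrand s p u)}"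

definition frac_sobolev0 :: "real \<Rightarrow> real \<Rightarrow> (real^'n) set \<Rightarrow> (real^'n \<Rightarrow> real) set" where
  "frac_sobolev0 s p \<Omega> =
     {u \<in> frac_sobolev s p. AE x in lebesgue. x \<notin> \<Omega> \<longrightarrow> u x = 0}"

definition gagliardo_norm :: "real \<Rightarrow> real \<Rightarrow> (real^'n \<Rightarrow> real) \<Rightarrow> real" where
  "gagliardo_norm s p u = (LINT z|lebesgue. gagliardo_integrand s p u z) powr (1 / p)"

text \<open>\<open>L\<close> is the Frechet derivative at \<open>u\<close> of the functional \<open>J\<close> on the space \<open>frac_sobolev0 s p \<Omega>\<close>
  normed by \<open>gagliardo_norm s p\<close>: it is linear, bounded, and \<open>J (u + h) = J u + L h + o(norm of h)\<close>.\<close>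

definition has_frechet_derivative_W0 ::
    "real \<Rightarrow> real \<Rightarrow> (real^'n) set \<Rightarrow> ((real^'n \<Rightarrow> real) \<Rightarrow> real)
      \<Rightarrow> (real^'n \<Rightarrow> real) \<Rightarrow> ((real^'n \<Rightarrow> real) \<Rightarrow> real) \<Rightarrow> bool" where
  "has_frechet_derivative_W0 s p \<Omega> J u L \<longleftrightarrow>
     (\<forall>v\<in>frac_sobolev0 s p \<Omega>. \<forall>w\<in>frac_sobolev0 s p \<Omega>. L (\<lambda>x. v x + w x) = L v + L w) \<and>
     (\<forall>v\<in>frac_sobolev0 s p \<Omega>. \<forall>c. L (\<lambda>x. c * v x) = c * L v) \<and>
     (\<exists>C. \<forall>v\<in>frac_sobolev0 s p \<Omega>. \<bar>L v\<bar> \<le> C * gagliardo_norm s p v) \<and>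
     (\<forall>\<epsilon>>0. \<exists>\<delta>>0. \<forall>h\<in>frac_sobolev0 s p \<Omega>. gagliardo_norm s p h < \<delta> \<longrightarrow>
        \<bar>J (\<lambda>x. u x + h x) - J u - L h\<bar> \<le> \<epsilon> * gagliardo_norm s p h)"

definition strictly_convex :: "(real \<Rightarrow> real) \<Rightarrow> bool" where
  "strictly_convex f \<longleftrightarrow>
     (\<forall>x y t. x \<noteq> y \<longrightarrow> 0 < t \<longrightarrow> t < 1 \<longrightarrow>
        f ((1 - t) * x + t * y) < (1 - t) * f x + t * f y)"

definition even_primitive :: "(real \<Rightarrow> real) \<Rightarrow> real \<Rightarrow> real" where
  "even_primitive A t = integral {0..\<bar>t\<bar>} A"

definition weak_solution ::
    "real \<Rightarrow> real \<Rightarrow> (real^'n) set \<Rightarrow> (real \<Rightarrow> real) \<Rightarrow> (real^'n \<Rightarrow> real^'n \<Rightarrow> real)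
      \<Rightarrow> (real^'n \<Rightarrow> real) \<Rightarrow> (real^'n \<Rightarrow> real) \<Rightarrow> real \<Rightarrow> real \<Rightarrow> real
      \<Rightarrow> (real^'n \<Rightarrow> real) \<Rightarrow> bool" where
  "weak_solution s p \<Omega> A K a b m1 m2 lam u \<longleftrightarrow> u \<in> frac_sobolev0 s p \<Omega> \<and>
     (\<forall>v\<in>frac_sobolev0 s p \<Omega>.
        (LINT (x, y)|lebesgue. A (u x - u y) * (v x - v y) * K x y) =
        (LINT x:\<Omega>|lebesgue. lam * a x * \<bar>u x\<bar> powr (m1 - 2) * u x * v x
                            + b x * \<bar>u x\<bar> powr (m2 - 2) * u x * v x))"

definition energy ::
    "(real^'n) set \<Rightarrow> (real \<Rightarrow> real) \<Rightarrow> (real^'n \<Rightarrow> real^'n \<Rightarrow> real)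
      \<Rightarrow> (real^'n \<Rightarrow> real) \<Rightarrow> (real^'n \<Rightarrow> real) \<Rightarrow> real \<Rightarrow> real \<Rightarrow> real
      \<Rightarrow> (real^'n \<Rightarrow> real) \<Rightarrow> real" where
  "energy \<Omega> A K a b m1 m2 lam u =
     (LINT (x, y)|lebesgue. even_primitive A (u x - u y) * K x y)
     - lam / m1 * (LINT x:\<Omega>|lebesgue. a x * \<bar>u x\<bar> powr m1)
     - 1 / m2 * (LINT x:\<Omega>|lebesgue. b x * \<bar>u x\<bar> powr m2)"

definition nehari ::
    "real \<Rightarrow> real \<Rightarrow> (real^'n) set \<Rightarrow> ((real^'n \<Rightarrow> real) \<Rightarrow> real) \<Rightarrow> (real^'n \<Rightarrow> real) set" where
  "nehari s p \<Omega> J = {u \<in> frac_sobolev0 s p \<Omega>.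
     \<not> (AE x in lebesgue. u x = 0) \<and>
     (\<exists>L. has_frechet_derivative_W0 s p \<Omega> J u L \<and> L u = 0)}"

definition fibering :: "((real^'n \<Rightarrow> real) \<Rightarrow> real) \<Rightarrow> (real^'n \<Rightarrow> real) \<Rightarrow> real \<Rightarrow> real" where
  "fibering J u t = J (\<lambda>x. t * u x)"

text \<open>The number \<open>d\<close> below is the second derivative of the fibering map at 1.\<close>

definition nehari_plus ::
    "real \<Rightarrow> real \<Rightarrow> (real^'n) set \<Rightarrow> ((real^'n \<Rightarrow> real) \<Rightarrow> real) \<Rightarrow> (real^'n \<Rightarrow> real) set" where
  "nehari_plus s p \<Omega> J = {u \<in> nehari s p \<Omega> J.
     \<exists>q d. (\<forall>t>0. (fibering J u has_real_derivative q t) (at t)) \<and>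
           (q has_real_derivative d) (at 1) \<and> d > 0}"

text \<open>The infimum is taken in the extended reals, so it is meaningful even without an a priori
  lower bound for the energy.\<close>

definition ground_state_plus ::
    "real \<Rightarrow> real \<Rightarrow> (real^'n) set \<Rightarrow> (real \<Rightarrow> real) \<Rightarrow> (real^'n \<Rightarrow> real^'n \<Rightarrow> real)
      \<Rightarrow> (real^'n \<Rightarrow> real) \<Rightarrow> (real^'n \<Rightarrow> real) \<Rightarrow> real \<Rightarrow> real \<Rightarrow> real
      \<Rightarrow> (real^'n \<Rightarrow> real) \<Rightarrow> bool" where
  "ground_state_plus s p \<Omega> A K a b m1 m2 lam u \<longleftrightarrow>
     weak_solution s p \<Omega> A K a b m1 m2 lam u \<and>
     u \<in> nehari_plus s p \<Omega> (energy \<Omega> A K a b m1 m2 lam) \<and>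
     ereal (energy \<Omega> A K a b m1 m2 lam u) =
       (INF v\<in>nehari_plus s p \<Omega> (energy \<Omega> A K a b m1 m2 lam).
          ereal (energy \<Omega> A K a b m1 m2 lam v))"

end

theory Submission
  imports Defs "HOL-Complex_Analysis.Great_Picard"
begin

text \<open>
  The energy is minimised over a small ball of the fractional Sobolev space instead of over the
  Nehari manifold. Since the space embeds compactly into subcritical Lebesgue spaces, Fatou's lemma
  along an almost everywhere convergent minimising sequence yields a minimiser on the ball. For small
  \<open>lam\<close> the energy is positive on the boundary sphere but negative somewhere inside, because
  \<open>m1 < p\<close>; so the minimiser is interior and hence a critical point. On the Nehari
  manifold the sign of the second fibering derivative forces \<open>nehari_plus\<close> into the ball, and,
  conversely, every nontrivial critical point in the ball has positive second fibering derivative;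
  therefore the minimiser is a ground state.

  The \<open>C\<^sup>2\<close> regularity of \<open>A\<close> together with its growth forces \<open>p \<ge> 2\<close>,
  so the principal part has a quadratic Taylor remainder. The Sobolev inequality is proved by
  comparing the measures of dyadic level sets, and compactness by controlling the oscillation on
  small cubes through the Gagliardo seminorm.
\<close>

section \<open>Superlinear integral functionals\<close>

text \<open>The principal part is not homogeneous, so critical points of fibering maps are not
  explicit; two linear combinations replace them. On the Nehari set \<open>dual\<Phi> u u\<close>
  equals \<open>lam * fa u + fb u\<close>. Eliminating \<open>fb\<close> from a positive second
  fibering derivative gives \<open>(m2 - m) * dual\<Phi> u u < (m2 - m1) * (lam * fa u)\<close>, and
  since \<open>fa\<close> grows with the smaller power \<open>m1 < p\<close>, the seminorm is small
  together with \<open>lam\<close>. Eliminating \<open>lam * fa\<close> instead leaves at least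
  \<open>(l - m1) * dual\<Phi> u u - (m2 - m1) * fb u\<close>, which is positive for small seminorm
  because \<open>p < m2\<close>, uniformly in \<open>lam\<close>. Hence the radius of the ball is
  fixed before \<open>lam\<close>.

  Fatou's lemma suits the nonnegative principal integrand; the sign-changing lower order terms must
  converge, and a slightly higher moment makes them uniformly integrable. Seminorms enter through a
  scale \<open>t\<close> with \<open>gagliardo s p u \<le> t powr p\<close>: this covers zero
  seminorm and lets scaling replace Hoelder's inequality.\<close>

lemma powr_sub_mult_le:
  fixes x y q :: real
  assumes "x \<ge> 0" "y \<ge> 0" "q > 1"
  shows "x powr (q - 1) * y \<le> x powr q + y powr q"
proof (cases "x \<le> y")
  case True
  have "x powr (q - 1) * y \<le> y powr (q - 1) * y"
    using True assms by (intro mult_right_mono powr_mono2) auto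
  also have "\<dots> = y powr q"
    using assms by (cases "y = 0") (auto simp: powr_diff)
  finally show ?thesis using powr_ge_zero[of x q] by linarith
next
  case False
  have "x powr (q - 1) * y \<le> x powr (q - 1) * x"
    using False assms by (intro mult_left_mono) auto
  also have "\<dots> = x powr q"
    using False assms by (auto simp: powr_diff)
  finally show ?thesis using powr_ge_zero[of y q] by linarith
qed

lemma powr_add_le:
  fixes x y q :: real
  assumes "x \<ge> 0" "y \<ge> 0" "q \<ge> 0"
  shows "(x + y) powr q \<le> 2 powr q * (x powr q + y powr q)"
proof -
  have "(x + y) powr q \<le> (2 * max x y) powr q"
    using assms by (intro powr_mono2) auto
  also have "\<dots> = 2 powr q * max x y powr q"
    using assms by (simp add: powr_mult)
  also have "max x y powr q \<le> x powr q + y powr q"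
    by (simp add: max_def)
  finally show ?thesis by simp
qed

lemma abs_powr_add_le:
  fixes x y q :: real
  assumes "q \<ge> 0"
  shows "\<bar>x + y\<bar> powr q \<le> 2 powr q * (\<bar>x\<bar> powr q + \<bar>y\<bar> powr q)"
proof -
  have "\<bar>x + y\<bar> powr q \<le> (\<bar>x\<bar> + \<bar>y\<bar>) powr q"
    using assms by (intro powr_mono2) auto
  also have "\<dots> \<le> 2 powr q * (\<bar>x\<bar> powr q + \<bar>y\<bar> powr q)"
    using assms by (intro powr_add_le) auto
  finally show ?thesis .
qed

text \<open>A model for a nonlinearity \<open>A\<close> of order \<open>q - 1\<close> with primitive
  \<open>P\<close>. On a range of size \<open>M\<close> the Hoelder constant scales like
  \<open>M powr (q - r)\<close>, so both sides of the condition are homogeneous of degree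
  \<open>q - 1\<close>. The value \<open>r = 2\<close> fits the primitive of the operator and
  \<open>r = min q 2\<close> a pure power, so that all terms of the energy are differentiated by one
  argument.\<close>

locale power_growth =
  fixes q r C :: real and P A :: "real \<Rightarrow> real"
  assumes r: "1 < r" "r \<le> q" and C: "0 \<le> C"
    and P0: "P 0 = 0" and A0: "A 0 = 0"
    and P_deriv: "\<And>t. (P has_real_derivative A t) (at t)"
    and A_hoelder: "\<And>M x y. M > 0 \<Longrightarrow> \<bar>x\<bar> \<le> M \<Longrightarrow> \<bar>y\<bar> \<le> M \<Longrightarrow>
      \<bar>A x - A y\<bar> \<le> C * M powr (q - r) * \<bar>x - y\<bar> powr (r - 1)"
begin

lemma A_bound: "\<bar>A x\<bar> \<le> C * \<bar>x\<bar> powr (q - 1)"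
proof (cases "x = 0")
  case False
  then have "\<bar>A x - A 0\<bar> \<le> C * \<bar>x\<bar> powr (q - r) * \<bar>x - 0\<bar> powr (r - 1)"
    by (intro A_hoelder) auto
  also have "\<dots> = C * \<bar>x\<bar> powr (q - 1)"
    using False by (simp flip: powr_add)
  finally show ?thesis by (simp add: A0)
qed (simp add: A0)

lemma P_mvt: "\<exists>\<theta>. \<bar>\<theta>\<bar> \<le> \<bar>b\<bar> \<and> P (a + b) - P a = A (a + \<theta>) * b"
proof (cases b "0::real" rule: linorder_cases)
  case equal
  then show ?thesis by auto
next
  case greater
  then obtain z where "a < z" "z < a + b" "P (a + b) - P a = (a + b - a) * A z"
    using MVT2[of a "a + b" P A] P_deriv by auto
  then show ?thesis by (intro exI[of _ "z - a"]) auto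
next
  case less
  then obtain z where "a + b < z" "z < a" "P a - P (a + b) = (a - (a + b)) * A z"
    using MVT2[of "a + b" a P A] P_deriv by auto
  then show ?thesis by (intro exI[of _ "z - a"]) (auto simp: algebra_simps)
qed

lemma P_bound: "\<bar>P x\<bar> \<le> C * \<bar>x\<bar> powr q"
proof (cases "x = 0")
  case False
  obtain \<theta> where \<theta>: "\<bar>\<theta>\<bar> \<le> \<bar>x\<bar>" "P x = A \<theta> * x"
    using P_mvt[of x 0] P0 by auto
  have "\<bar>P x\<bar> \<le> C * \<bar>\<theta>\<bar> powr (q - 1) * \<bar>x\<bar>"
    using A_bound[of \<theta>] by (simp add: \<theta>(2) abs_mult mult_right_mono)
  also have "\<dots> \<le> C * \<bar>x\<bar> powr (q - 1) * \<bar>x\<bar>"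
    using C r \<theta>(1) by (intro mult_right_mono mult_left_mono powr_mono2) auto
  also have "\<dots> = C * \<bar>x\<bar> powr q"
    using False by (simp add: powr_diff)
  finally show ?thesis .
qed (simp add: P0)

text \<open>Rescaling \<open>b\<close> by \<open>\<eta>\<close> puts all the smallness into the factor \<open>\<eta> powr r\<close>, so that
  after integration no Hoelder inequality is needed.\<close>

lemma P_remainder:
  assumes "0 < \<eta>" "\<eta> \<le> 1"
  shows "\<bar>P (a + b) - P a - A a * b\<bar> \<le>
    C * 2 powr q * \<eta> powr r * (\<bar>a\<bar> powr q + \<bar>b\<bar> powr q / \<eta> powr q)"
proof (cases "b = 0")
  case True
  then show ?thesis using C by (auto intro!: mult_nonneg_nonneg)
next
  case False
  define M where "M = \<bar>a\<bar> + \<bar>b\<bar> / \<eta>"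
  have b: "\<bar>b\<bar> \<le> \<bar>b\<bar> / \<eta>"
    using assms by (simp add: field_simps mult_left_le_one_le mult_left_le)
  have M: "M > 0" using False assms by (simp add: M_def add_nonneg_pos)
  obtain \<theta> where \<theta>: "\<bar>\<theta>\<bar> \<le> \<bar>b\<bar>" "P (a + b) - P a = A (a + \<theta>) * b"
    using P_mvt by blast
  have "\<bar>A (a + \<theta>) - A a\<bar> \<le> C * M powr (q - r) * \<bar>a + \<theta> - a\<bar> powr (r - 1)"
    using M \<theta>(1) b by (intro A_hoelder) (auto simp: M_def)
  also have "\<dots> \<le> C * M powr (q - r) * \<bar>b\<bar> powr (r - 1)"
    using C \<theta>(1) r by (intro mult_left_mono powr_mono2) auto
  finally have *: "\<bar>A (a + \<theta>) - A a\<bar> \<le> C * M powr (q - r) * \<bar>b\<bar> powr (r - 1)" .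
  have "\<bar>P (a + b) - P a - A a * b\<bar> = \<bar>A (a + \<theta>) - A a\<bar> * \<bar>b\<bar>"
    unfolding \<theta>(2) by (simp add: left_diff_distrib flip: abs_mult)
  also have "\<dots> \<le> C * M powr (q - r) * \<bar>b\<bar> powr (r - 1) * \<bar>b\<bar>"
    using * by (intro mult_right_mono) auto
  also have "\<dots> = C * M powr (q - r) * (\<eta> powr r * (\<bar>b\<bar> / \<eta>) powr r)"
    using False assms by (simp add: powr_diff powr_divide)
  also have "\<dots> \<le> C * M powr (q - r) * (\<eta> powr r * M powr r)"
    using C r False assms by (intro mult_left_mono powr_mono2) (auto simp: M_def)
  also have "\<dots> = C * \<eta> powr r * M powr q"
    using M by (simp add: powr_diff)
  also have "\<dots> \<le> C * \<eta> powr r * (2 powr q * (\<bar>a\<bar> powr q + (\<bar>b\<bar> / \<eta>) powr q))"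
    unfolding M_def using C r assms by (intro mult_left_mono powr_add_le) auto
  finally show ?thesis using assms by (simp add: powr_divide mult_ac)
qed

lemma measurable_P[measurable]: "P \<in> borel_measurable borel"
  using P_deriv DERIV_isCont by (intro borel_measurable_continuous_onI continuous_at_imp_continuous_on) blast

lemma isCont_A: "isCont A x"
proof -
  have "((\<lambda>y. A y - A x) \<longlongrightarrow> 0) (at x)"
  proof (rule Lim_null_comparison)
    show "\<forall>\<^sub>F y in at x. norm (A y - A x) \<le> C * (\<bar>x\<bar> + 1) powr (q - r) * \<bar>y - x\<bar> powr (r - 1)"
      unfolding eventually_at
      by (intro exI[of _ 1]) (auto simp: dist_real_def intro!: A_hoelder)
    have "((\<lambda>y. C * (\<bar>x\<bar> + 1) powr (q - r) * \<bar>y - x\<bar> powr (r - 1)) \<longlongrightarrow>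
        C * (\<bar>x\<bar> + 1) powr (q - r) * \<bar>x - x\<bar> powr (r - 1)) (at x)"
      using r by (intro tendsto_intros) auto
    then show "((\<lambda>y. C * (\<bar>x\<bar> + 1) powr (q - r) * \<bar>y - x\<bar> powr (r - 1)) \<longlongrightarrow> 0) (at x)"
      by simp
  qed
  then show ?thesis unfolding isCont_def by (simp add: LIM_zero_iff)
qed

lemma measurable_A[measurable]: "A \<in> borel_measurable borel"
  using isCont_A by (intro borel_measurable_continuous_onI continuous_at_imp_continuous_on) blast

end

lemma DERIV_of_small_remainder:
  fixes f :: "real \<Rightarrow> real"
  assumes "1 < r" and rem: "\<And>e. e \<noteq> 0 \<Longrightarrow> \<bar>e\<bar> \<le> 1 \<Longrightarrow> \<bar>f (t + e) - f t - e * d\<bar> \<le> B * \<bar>e\<bar> powr r"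
  shows "(f has_real_derivative d) (at t)"
proof -
  have "((\<lambda>h. (f (t + h) - f t) / h - d) \<longlongrightarrow> 0) (at 0)"
  proof (rule Lim_null_comparison)
    show "\<forall>\<^sub>F h in at 0. norm ((f (t + h) - f t) / h - d) \<le> B * \<bar>h\<bar> powr (r - 1)"
      unfolding eventually_at
    proof (intro exI[of _ 1] conjI ballI impI)
      fix h :: real assume "h \<noteq> 0 \<and> dist h 0 < 1"
      then have h: "h \<noteq> 0" "\<bar>h\<bar> \<le> 1" by auto
      have "norm ((f (t + h) - f t) / h - d) = \<bar>f (t + h) - f t - h * d\<bar> / \<bar>h\<bar>"
        using h by (simp add: field_simps flip: abs_divide)
      also have "\<dots> \<le> B * \<bar>h\<bar> powr r / \<bar>h\<bar>"
        using rem[OF h] by (intro divide_right_mono) auto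
      also have "\<dots> = B * \<bar>h\<bar> powr (r - 1)"
        using h by (simp add: powr_diff)
      finally show "norm ((f (t + h) - f t) / h - d) \<le> B * \<bar>h\<bar> powr (r - 1)" .
    qed auto
    have "((\<lambda>h. B * \<bar>h\<bar> powr (r - 1)) \<longlongrightarrow> B * \<bar>0\<bar> powr (r - 1)) (at 0)"
      using assms(1) by (intro tendsto_intros) auto
    then show "((\<lambda>h. B * \<bar>h\<bar> powr (r - 1)) \<longlongrightarrow> 0) (at 0)" by simp
  qed
  then show ?thesis unfolding DERIV_def by (simp add: LIM_zero_iff)
qed

section \<open>Functionals on weighted Lebesgue spaces\<close>

text \<open>The \<open>q\<close>-th power of a weighted norm. Weight one gives the Lebesgue spaces
  on points, and the singular kernel as weight gives the Gagliardo seminorm on pairs.\<close>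

definition weighted_modular :: "real \<Rightarrow> 'a measure \<Rightarrow> ('a \<Rightarrow> real) \<Rightarrow> ('a \<Rightarrow> real) \<Rightarrow> real" where
  "weighted_modular q M w U = (LINT z|M. \<bar>U z\<bar> powr q * w z)"

definition weighted_Lp :: "real \<Rightarrow> 'a measure \<Rightarrow> ('a \<Rightarrow> real) \<Rightarrow> ('a \<Rightarrow> real) set" where
  "weighted_Lp q M w = {U \<in> borel_measurable M. integrable M (\<lambda>z. \<bar>U z\<bar> powr q * w z)}"

text \<open>The coefficient \<open>k\<close> may change sign and is only dominated by the
  nonnegative weight \<open>w\<close>; in this way \<open>K\<close>, \<open>a\<close> and
  \<open>b\<close> can all play the part of \<open>k\<close>.\<close>

locale weighted_power_growth = power_growth +
  fixes M :: "'a measure" and k w :: "'a \<Rightarrow> real" and c :: real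
  assumes k_meas[measurable]: "k \<in> borel_measurable M"
    and w_nonneg: "\<And>z. 0 \<le> w z" and w_meas[measurable]: "w \<in> borel_measurable M"
    and c: "0 \<le> c" and k_le: "AE z in M. \<bar>k z\<bar> \<le> c * w z"
begin

abbreviation "modular \<equiv> weighted_modular q M w"
abbreviation "mod_space \<equiv> weighted_Lp q M w"

lemma mod_spaceD:
  assumes "U \<in> mod_space"
  shows "U \<in> borel_measurable M" "integrable M (\<lambda>z. \<bar>U z\<bar> powr q * w z)"
  using assms by (auto simp: weighted_Lp_def)

lemma mod_space_scale:
  assumes "U \<in> mod_space"
  shows "(\<lambda>z. t * U z) \<in> mod_space" "modular (\<lambda>z. t * U z) = \<bar>t\<bar> powr q * modular U"
proof -
  have eq: "(\<lambda>z. \<bar>t * U z\<bar> powr q * w z) = (\<lambda>z. \<bar>t\<bar> powr q * (\<bar>U z\<bar> powr q * w z))"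
    by (auto simp: abs_mult powr_mult)
  show "(\<lambda>z. t * U z) \<in> mod_space"
    unfolding weighted_Lp_def mem_Collect_eq eq using mod_spaceD[OF assms] by auto
  show "modular (\<lambda>z. t * U z) = \<bar>t\<bar> powr q * modular U"
    unfolding weighted_modular_def eq by simp
qed

lemma integrable_P:
  assumes U: "U \<in> mod_space"
  shows "integrable M (\<lambda>z. P (U z) * k z)"
proof (rule Bochner_Integration.integrable_bound)
  note [measurable] = mod_spaceD(1)[OF U]
  show "integrable M (\<lambda>z. C * c * (\<bar>U z\<bar> powr q * w z))"
    using mod_spaceD[OF U] by auto
  show "(\<lambda>z. P (U z) * k z) \<in> borel_measurable M" by measurable
  show "AE z in M. norm (P (U z) * k z) \<le> norm (C * c * (\<bar>U z\<bar> powr q * w z))"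
    using k_le
  proof eventually_elim
    case (elim z)
    have "\<bar>P (U z)\<bar> * \<bar>k z\<bar> \<le> (C * \<bar>U z\<bar> powr q) * (c * w z)"
      using elim C by (intro mult_mono P_bound) auto
    also have "\<dots> \<le> \<bar>C * c * (\<bar>U z\<bar> powr q * w z)\<bar>"
      by (intro order_trans[OF _ abs_ge_self]) simp
    finally show ?case by (simp add: abs_mult)
  qed
qed

text \<open>The pointwise Young inequality gives a bound that is additive in the modulars rather
  than a product of norms. Homogeneity in \<open>V\<close> is recovered later by rescaling to the
  unit ball.\<close>

lemma AV_bound:
  assumes U: "U \<in> mod_space" and V: "V \<in> mod_space"
  shows "integrable M (\<lambda>z. A (U z) * V z * k z)"
    "\<bar>LINT z|M. A (U z) * V z * k z\<bar> \<le> C * c * (modular U + modular V)"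
proof -
  note [measurable] = mod_spaceD(1)[OF U] mod_spaceD(1)[OF V]
  let ?g = "\<lambda>z. C * c * (\<bar>U z\<bar> powr q * w z + \<bar>V z\<bar> powr q * w z)"
  have g: "integrable M ?g"
    using mod_spaceD[OF U] mod_spaceD[OF V] by auto
  have le: "AE z in M. norm (A (U z) * V z * k z) \<le> ?g z"
    using k_le
  proof eventually_elim
    case (elim z)
    have "\<bar>A (U z)\<bar> * \<bar>V z\<bar> \<le> C * \<bar>U z\<bar> powr (q - 1) * \<bar>V z\<bar>"
      by (intro mult_right_mono A_bound) auto
    also have "\<dots> \<le> C * (\<bar>U z\<bar> powr q + \<bar>V z\<bar> powr q)"
      using C r powr_sub_mult_le[of "\<bar>U z\<bar>" "\<bar>V z\<bar>" q] by (simp add: mult.assoc mult_left_mono)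
    finally have le1: "\<bar>A (U z)\<bar> * \<bar>V z\<bar> \<le> C * (\<bar>U z\<bar> powr q + \<bar>V z\<bar> powr q)" .
    have "(\<bar>A (U z)\<bar> * \<bar>V z\<bar>) * \<bar>k z\<bar> \<le> (C * (\<bar>U z\<bar> powr q + \<bar>V z\<bar> powr q)) * (c * w z)"
      by (rule mult_mono[OF le1]) (use elim C in \<open>auto intro!: mult_nonneg_nonneg\<close>)
    then show ?case by (simp add: abs_mult algebra_simps)
  qed
  show i: "integrable M (\<lambda>z. A (U z) * V z * k z)"
  proof (rule Bochner_Integration.integrable_bound[OF g])
    show "AE z in M. norm (A (U z) * V z * k z) \<le> norm (?g z)"
      using le by eventually_elim auto
  qed measurable
  have "\<bar>LINT z|M. A (U z) * V z * k z\<bar> \<le> (LINT z|M. norm (A (U z) * V z * k z))"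
    using integral_norm_bound[of M "\<lambda>z. A (U z) * V z * k z"] by simp
  also have "\<dots> \<le> (LINT z|M. ?g z)"
    using i g le by (intro integral_mono_AE) auto
  also have "\<dots> = C * c * (modular U + modular V)"
    using mod_spaceD[OF U] mod_spaceD[OF V] by (simp add: weighted_modular_def)
  finally show "\<bar>LINT z|M. A (U z) * V z * k z\<bar> \<le> C * c * (modular U + modular V)" .
qed

lemma mod_space_add:
  assumes U: "U \<in> mod_space" and V: "V \<in> mod_space" 
  shows "(\<lambda>z. U z + V z) \<in> mod_space"
    "modular (\<lambda>z. U z + V z) \<le> 2 powr q * (modular U + modular V)"
proof -
  note [measurable] = mod_spaceD(1)[OF U] mod_spaceD(1)[OF V]
  let ?g = "\<lambda>z. 2 powr q * (\<bar>U z\<bar> powr q * w z + \<bar>V z\<bar> powr q * w z)"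
  have g: "integrable M ?g"
    using mod_spaceD[OF U] mod_spaceD[OF V] by auto
  have le: "\<bar>U z + V z\<bar> powr q * w z \<le> ?g z" for z
    using mult_right_mono[OF abs_powr_add_le w_nonneg[of z], of q "U z" "V z"] r
    by (simp add: algebra_simps)
  have i: "integrable M (\<lambda>z. \<bar>U z + V z\<bar> powr q * w z)"
    by (rule Bochner_Integration.integrable_bound[OF g]) (use le w_nonneg in \<open>auto intro!: AE_I2 order_trans[OF _ abs_ge_self]\<close>)
  then show "(\<lambda>z. U z + V z) \<in> mod_space"
    by (simp add: weighted_Lp_def)
  have "modular (\<lambda>z. U z + V z) \<le> (LINT z|M. ?g z)"
    unfolding weighted_modular_def using i g le by (intro integral_mono) auto
  then show "modular (\<lambda>z. U z + V z) \<le> 2 powr q * (modular U + modular V)"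
    using mod_spaceD[OF U] mod_spaceD[OF V] by (simp add: weighted_modular_def)
qed

text \<open>The scale \<eta> stays free. Derivatives along a line take it as the step size, the
  Frechet derivative takes it as the seminorm of the increment; in both cases the modular of the
  increment divided by \<open>\<eta> powr q\<close> is bounded, and \<open>\<eta> powr r\<close>
  with \<open>1 < r\<close> is the gain.\<close>

lemma remainder:
  assumes U: "U \<in> mod_space" and H: "H \<in> mod_space"
    and \<eta>: "0 < \<eta>" "\<eta> \<le> 1"
  shows "\<bar>(LINT z|M. P (U z + H z) * k z) - (LINT z|M. P (U z) * k z) - (LINT z|M. A (U z) * H z * k z)\<bar>
    \<le> C * c * 2 powr q * \<eta> powr r * (modular U + modular H / \<eta> powr q)"
proof -
  note UH = mod_space_add(1)[OF U H]
  note [measurable] = mod_spaceD(1)[OF U] mod_spaceD(1)[OF H]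
  let ?f = "\<lambda>z. P (U z + H z) * k z - P (U z) * k z - A (U z) * H z * k z"
  let ?g = "\<lambda>z. C * c * 2 powr q * \<eta> powr r * (\<bar>U z\<bar> powr q * w z + \<bar>H z\<bar> powr q * w z / \<eta> powr q)"
  have f: "integrable M ?f"
    using integrable_P[OF UH] integrable_P[OF U] AV_bound(1)[OF U H] by auto
  have g: "integrable M ?g"
    using mod_spaceD[OF U] mod_spaceD[OF H] by auto
  have le: "AE z in M. norm (?f z) \<le> ?g z"
    using k_le
  proof eventually_elim
    case (elim z)
    have "\<bar>P (U z + H z) - P (U z) - A (U z) * H z\<bar> * \<bar>k z\<bar>
      \<le> (C * 2 powr q * \<eta> powr r * (\<bar>U z\<bar> powr q + \<bar>H z\<bar> powr q / \<eta> powr q)) * (c * w z)"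
      using elim C by (intro mult_mono P_remainder \<eta>) (auto intro!: mult_nonneg_nonneg)
    then show ?case by (simp add: algebra_simps flip: abs_mult)
  qed
  have "\<bar>LINT z|M. ?f z\<bar> \<le> (LINT z|M. norm (?f z))"
    using integral_norm_bound[of M ?f] by simp
  also have "\<dots> \<le> (LINT z|M. ?g z)"
    using f g le by (intro integral_mono_AE) auto
  also have "\<dots> = C * c * 2 powr q * \<eta> powr r * (modular U + modular H / \<eta> powr q)"
    using mod_spaceD[OF U] mod_spaceD[OF H] by (simp add: weighted_modular_def)
  finally show ?thesis
    using integrable_P[OF UH] integrable_P[OF U] AV_bound(1)[OF U H] by simp
qed

lemma line_deriv:
  assumes U: "U \<in> mod_space" and H: "H \<in> mod_space"
  shows "((\<lambda>t. LINT z|M. P (U z + t * H z) * k z) has_real_derivative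
    (LINT z|M. A (U z + t * H z) * H z * k z)) (at t)"
proof (rule DERIV_of_small_remainder[OF r(1)])
  fix e :: real assume e: "e \<noteq> 0" "\<bar>e\<bar> \<le> 1"
  have U': "(\<lambda>z. U z + t * H z) \<in> mod_space"
    using U H by (intro mod_space_add mod_space_scale)
  have [simp]: "U z + t * H z + e * H z = U z + (t + e) * H z" for z by (simp add: distrib_right)
  \<comment> \<open>With \<eta> equal to the step size, the modular of \<open>e * H\<close> cancels
    the division by \<open>\<eta> powr q\<close>.\<close>
  have "\<bar>(LINT z|M. P (U z + t * H z + e * H z) * k z) - (LINT z|M. P (U z + t * H z) * k z)
      - (LINT z|M. A (U z + t * H z) * (e * H z) * k z)\<bar>
    \<le> C * c * 2 powr q * \<bar>e\<bar> powr r *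
        (modular (\<lambda>z. U z + t * H z) + modular (\<lambda>z. e * H z) / \<bar>e\<bar> powr q)"
    using e U' H by (intro remainder) (auto intro!: mod_space_scale)
  also have "modular (\<lambda>z. e * H z) / \<bar>e\<bar> powr q = modular H"
    using e by (simp add: mod_space_scale(2)[OF H])
  finally show "\<bar>(LINT z|M. P (U z + (t + e) * H z) * k z) - (LINT z|M. P (U z + t * H z) * k z)
      - e * (LINT z|M. A (U z + t * H z) * H z * k z)\<bar>
    \<le> (C * c * 2 powr q * (modular (\<lambda>z. U z + t * H z) + modular H)) * \<bar>e\<bar> powr r"
    by (simp add: mult_ac)
qed

lemma mod_space_zero: "(\<lambda>_. 0) \<in> mod_space"
  by (simp add: weighted_Lp_def)

lemma fibering_deriv:
  assumes U: "U \<in> mod_space"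
  shows "((\<lambda>t. LINT z|M. P (t * U z) * k z) has_real_derivative
    (LINT z|M. A (t * U z) * U z * k z)) (at t)"
  using line_deriv[OF mod_space_zero U, of t] by simp

end

section \<open>Differentiation under the integral sign\<close>

text \<open>Dominated convergence for the difference quotients at \<open>t0\<close>. The exceptional
  null set of the Lipschitz bound may depend on \<open>t\<close>; this is harmless along a
  sequence.\<close>

lemma DERIV_integral_dominated:
  fixes f :: "real \<Rightarrow> 'a \<Rightarrow> real"
  assumes d: "d > 0" and f: "\<And>t. \<bar>t - t0\<bar> < d \<Longrightarrow> integrable M (f t)"
    and g: "integrable M g"
    and lip: "\<And>t. \<bar>t - t0\<bar> < d \<Longrightarrow> AE z in M. \<bar>f t z - f t0 z\<bar> \<le> \<bar>t - t0\<bar> * g z"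
    and deriv: "AE z in M. ((\<lambda>t. f t z) has_real_derivative f' z) (at t0)"
    and f'[measurable]: "f' \<in> borel_measurable M"
  shows "integrable M f'" "((\<lambda>t. LINT z|M. f t z) has_real_derivative (LINT z|M. f' z)) (at t0)"
proof -
  have main: "integrable M f' \<and> (\<lambda>n. LINT z|M. (f (t0 + X n) z - f t0 z) / X n) \<longlonglongrightarrow> (LINT z|M. f' z)"
    if X: "\<And>n. X n \<noteq> 0" "X \<longlonglongrightarrow> 0" for X
  proof -
    have "\<forall>\<^sub>F n in sequentially. \<bar>X n\<bar> < d"
      using X(2) d by (auto simp: tendsto_iff dist_real_def)
    then obtain n0 where n0: "\<And>n. n \<ge> n0 \<Longrightarrow> \<bar>X n\<bar> < d"
      by (auto simp: eventually_sequentially)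
    \<comment> \<open>Dropping the first \<open>n0\<close> terms keeps every argument in the
      interval where integrability and the Lipschitz bound are assumed.\<close>
    define Y where "Y n = X (n + n0)" for n
    have Y: "Y n \<noteq> 0" "\<bar>Y n\<bar> < d" for n
      using X n0 by (auto simp: Y_def)
    have Y0: "Y \<longlonglongrightarrow> 0"
      unfolding Y_def using X(2) by (rule LIMSEQ_ignore_initial_segment)
    have int: "integrable M (\<lambda>z. (f (t0 + Y n) z - f t0 z) / Y n)" for n
      using f[of "t0 + Y n"] f[of t0] Y[of n] d by auto
    have lim: "AE z in M. (\<lambda>n. (f (t0 + Y n) z - f t0 z) / Y n) \<longlonglongrightarrow> f' z"
      using deriv
    proof eventually_elim
      case (elim z)
      then have "((\<lambda>h. (f (t0 + h) z - f t0 z) / h) \<longlongrightarrow> f' z) (at 0)"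
        by (simp add: DERIV_def)
      then show ?case
        by (rule filterlim_compose) (use Y0 Y in \<open>auto simp: filterlim_at\<close>)
    qed
    have bound: "AE z in M. norm ((f (t0 + Y n) z - f t0 z) / Y n) \<le> g z" for n
      using lip[of "t0 + Y n"] Y[of n]
      by (auto elim!: eventually_mono simp: field_simps)
    have m: "(\<lambda>z. (f (t0 + Y n) z - f t0 z) / Y n) \<in> borel_measurable M" for n
      using int by auto
    have 1: "integrable M f'"
      by (rule integrable_dominated_convergence[where w = g and
        s = "\<lambda>n z. (f (t0 + Y n) z - f t0 z) / Y n"]) (fact f' m g lim bound)+
    have "(\<lambda>n. LINT z|M. (f (t0 + Y n) z - f t0 z) / Y n) \<longlonglongrightarrow> (LINT z|M. f' z)"
      by (rule integral_dominated_convergence[where w = g]) (fact f' m g lim bound)+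
    then have 2: "(\<lambda>n. LINT z|M. (f (t0 + X (n + n0)) z - f t0 z) / X (n + n0)) \<longlonglongrightarrow> (LINT z|M. f' z)"
      unfolding Y_def .
    show ?thesis
      using 1 LIMSEQ_offset[where k = n0 and f = "\<lambda>n. LINT z|M. (f (t0 + X n) z - f t0 z) / X n", OF 2]
      by blast
  qed
  have X0: "(\<lambda>n. inverse (real (Suc n))) \<longlonglongrightarrow> 0"
    by (rule LIMSEQ_inverse_real_of_nat)
  have nz: "inverse (real (Suc n)) \<noteq> 0" for n
    by simp
  show "integrable M f'"
    using main[where X = "\<lambda>n. inverse (real (Suc n))", OF nz X0] by blast
  have "((\<lambda>h. ((LINT z|M. f (t0 + h) z) - (LINT z|M. f t0 z)) / h) \<longlongrightarrow> (LINT z|M. f' z)) (at 0)"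
    unfolding tendsto_at_iff_sequentially
  proof (intro allI impI)
    fix X :: "nat \<Rightarrow> real"
    assume X: "\<forall>i. X i \<in> UNIV - {0}" "X \<longlonglongrightarrow> 0"
    have nz: "X n \<noteq> 0" for n using X(1) by simp
    have "\<forall>\<^sub>F n in sequentially. \<bar>X n\<bar> < d"
      using X(2) d by (auto simp: tendsto_iff dist_real_def)
    then have ev: "\<forall>\<^sub>F n in sequentially. (LINT z|M. (f (t0 + X n) z - f t0 z) / X n)
        = ((LINT z|M. f (t0 + X n) z) - (LINT z|M. f t0 z)) / X n"
    proof eventually_elim
      case (elim n)
      then show ?case using f[of "t0 + X n"] f[of t0] d by simp
    qed
    have "(\<lambda>n. LINT z|M. (f (t0 + X n) z - f t0 z) / X n) \<longlonglongrightarrow> (LINT z|M. f' z)"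
      using main[of X, OF nz X(2)] by blast
    then show "((\<lambda>h. ((LINT z|M. f (t0 + h) z) - (LINT z|M. f t0 z)) / h) \<circ> X) \<longlonglongrightarrow> (LINT z|M. f' z)"
      unfolding comp_def using ev by (rule Lim_transform_eventually)
  qed
  then show "((\<lambda>t. LINT z|M. f t z) has_real_derivative (LINT z|M. f' z)) (at t0)"
    by (simp only: DERIV_def)
qed

section \<open>Powers of the absolute value\<close>

text \<open>For \<open>q \<le> 2\<close> the function \<open>t powr (q - 1)\<close> is subadditive,
  hence Hoelder continuous; for \<open>q > 2\<close> the mean value theorem gives a Lipschitz
  constant of order \<open>M powr (q - 2)\<close>.\<close>

lemma powr_hoelder_nonneg:
  fixes q :: real
  assumes q: "1 < q" and xy: "0 \<le> y" "y \<le> x" "x \<le> M" "0 < M"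
  shows "x powr (q - 1) - y powr (q - 1) \<le> q * M powr (q - min q 2) * (x - y) powr (min q 2 - 1)"
proof (cases "x = y")
  case False
  then have x: "0 < x" "y < x" using xy by auto
  show ?thesis
  proof (cases "q \<le> 2")
    case True
    \<comment> \<open>Both quotients lie in the unit interval and add up to one; an exponent of at
      most one does not decrease them.\<close>
    have "y / x \<le> (y / x) powr (q - 1)" "(x - y) / x \<le> ((x - y) / x) powr (q - 1)"
      using powr_mono'[of "q - 1" 1 "y / x"] powr_mono'[of "q - 1" 1 "(x - y) / x"] x xy True
      by (auto simp: field_simps)
    then have "1 \<le> (y / x) powr (q - 1) + ((x - y) / x) powr (q - 1)"
      using x by (simp add: diff_divide_distrib)
    then have "x powr (q - 1) - y powr (q - 1) \<le> (x - y) powr (q - 1)"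
      using x xy by (simp add: powr_divide field_simps)
    also have "\<dots> \<le> q * (x - y) powr (q - 1)"
      using q by (simp add: mult_right_mono[of 1 q, simplified])
    finally show ?thesis using True xy by (simp add: min_def)
  next
    case False
    have "\<exists>l z. y < z \<and> z < x \<and> ((\<lambda>t. t powr (q - 1)) has_real_derivative l) (at z) \<and>
        x powr (q - 1) - y powr (q - 1) = (x - y) * l"
    proof (rule MVT)
      show "continuous_on {y..x} (\<lambda>t. t powr (q - 1))"
        using q xy by (intro continuous_intros continuous_on_powr') auto
      show "(\<lambda>t. t powr (q - 1)) differentiable at z" if "y < z" "z < x" for z
        using has_real_derivative_powr[of z "q - 1"] that xy by (auto simp: real_differentiable_def)
    qed (use x in auto)
    then obtain l z where z: "y < z" "z < x" "((\<lambda>t. t powr (q - 1)) has_real_derivative l) (at z)"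
        "x powr (q - 1) - y powr (q - 1) = (x - y) * l" by auto
    have "l = (q - 1) * z powr (q - 1 - 1)"
      using DERIV_unique[OF z(3) has_real_derivative_powr] z(1) xy by auto
    also have "q - 1 - 1 = q - 2" by simp
    also have "(q - 1) * z powr (q - 2) \<le> q * M powr (q - 2)"
      by (rule mult_mono) (use q False z xy in \<open>auto intro: powr_mono2\<close>)
    finally have "(x - y) * l \<le> (x - y) * (q * M powr (q - 2))"
      using x by (intro mult_left_mono) auto
    then show ?thesis using z(4) False x by (simp add: min_def mult_ac)
  qed
qed (use assms in auto)

lemma abs_powr_deriv:
  fixes q t :: real
  assumes q: "1 < q"
  shows "((\<lambda>t. \<bar>t\<bar> powr q) has_real_derivative q * (\<bar>t\<bar> powr (q - 2) * t)) (at t)"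
proof (cases t "0::real" rule: linorder_cases)
  case greater
  have "((\<lambda>t. t powr q) has_real_derivative q * t powr (q - 1)) (at t)"
    using greater by (rule has_real_derivative_powr)
  moreover have "t powr (q - 1) = \<bar>t\<bar> powr (q - 2) * t"
    using greater by (simp add: powr_diff power2_eq_square)
  ultimately have "((\<lambda>t. t powr q) has_real_derivative q * (\<bar>t\<bar> powr (q - 2) * t)) (at t)"
    by simp
  then show ?thesis
    by (rule has_field_derivative_transform_within_open[where S = "{0<..}"]) (use greater in auto)
next
  case less
  have "((\<lambda>t. (- t) powr q) has_real_derivative q * (- t) powr (q - 1) * (- 1)) (at t)"
    using less by (auto intro!: derivative_eq_intros)
  moreover have "q * (- t) powr (q - 1) * (- 1) = q * (\<bar>t\<bar> powr (q - 2) * t)"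
    using less by (simp add: powr_diff power2_eq_square)
  ultimately have "((\<lambda>t. (- t) powr q) has_real_derivative q * (\<bar>t\<bar> powr (q - 2) * t)) (at t)"
    by simp
  then show ?thesis
    by (rule has_field_derivative_transform_within_open[where S = "{..<0}"]) (use less in auto)
next
  case equal
  \<comment> \<open>At zero the function is its own remainder, of order
    \<open>q > 1\<close>.\<close>
  have "((\<lambda>t. \<bar>t\<bar> powr q) has_real_derivative 0) (at 0)"
    by (rule DERIV_of_small_remainder[OF q, where B = 1]) auto
  then show ?thesis using equal by simp
qed

text \<open>With \<open>r = min q 2\<close> the cases of Hoelder continuous (\<open>q < 2\<close>) and locally
  Lipschitz (\<open>q \<ge> 2\<close>) derivative are treated together.\<close>

lemma power_growth_abs_powr:
  fixes q :: real
  assumes q: "1 < q"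
  shows "power_growth q (min q 2) (2 * q * q) (\<lambda>t. \<bar>t\<bar> powr q) (\<lambda>t. q * (\<bar>t\<bar> powr (q - 2) * t))"
proof
  show "((\<lambda>t. \<bar>t\<bar> powr q) has_real_derivative q * (\<bar>t\<bar> powr (q - 2) * t)) (at t)" for t
    using q by (rule abs_powr_deriv)
  fix M x y :: real assume M: "M > 0" "\<bar>x\<bar> \<le> M" "\<bar>y\<bar> \<le> M"
  define B where "B t = q * M powr (q - min q 2) * t powr (min q 2 - 1)" for t
  have Bmono: "B s \<le> B t" if "0 \<le> s" "s \<le> t" for s t
    unfolding B_def using that q by (intro mult_left_mono powr_mono2) auto
  have B0: "0 \<le> B t" for t
    unfolding B_def using q by auto
  define \<phi> where "\<phi> t = \<bar>t\<bar> powr (q - 2) * t" for t :: real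
  have \<phi>: "\<phi> t = (if t \<ge> 0 then t powr (q - 1) else - ((- t) powr (q - 1)))" for t
    by (auto simp: \<phi>_def powr_diff power2_eq_square)
  have key: "\<bar>\<phi> x - \<phi> y\<bar> \<le> 2 * B (x - y)" if "y \<le> x" "\<bar>x\<bar> \<le> M" "\<bar>y\<bar> \<le> M" for x y
  proof -
    consider "0 \<le> y" | "x < 0" | "y < 0" "0 \<le> x" using that by linarith
    then show ?thesis
    proof cases
      case 1
      have "x powr (q - 1) - y powr (q - 1) \<le> B (x - y)"
        unfolding B_def using that 1 q M by (intro powr_hoelder_nonneg) auto
      moreover have "y powr (q - 1) \<le> x powr (q - 1)"
        using that 1 q by (intro powr_mono2) auto
      ultimately show ?thesis using that 1 B0[of "x - y"] by (simp add: \<phi>)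
    next
      case 2
      have "(- y) powr (q - 1) - (- x) powr (q - 1) \<le> B (- y - - x)"
        unfolding B_def using that 2 q M by (intro powr_hoelder_nonneg) auto
      moreover have "(- x) powr (q - 1) \<le> (- y) powr (q - 1)"
        using that 2 q by (intro powr_mono2) auto
      ultimately show ?thesis using that 2 B0[of "x - y"] by (simp add: \<phi>)
    next
      \<comment> \<open>For opposite signs both arguments are compared with zero, and the two
        contributions cause the factor two in \<open>key\<close>.\<close>
      case 3
      have "x powr (q - 1) - 0 powr (q - 1) \<le> B (x - 0)"
        unfolding B_def using that 3 q M by (intro powr_hoelder_nonneg) auto
      moreover have "(- y) powr (q - 1) - 0 powr (q - 1) \<le> B (- y - 0)"
        unfolding B_def using that 3 q M by (intro powr_hoelder_nonneg) auto
      ultimately show ?thesis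
        using 3 q Bmono[of x "x - y"] Bmono[of "- y" "x - y"] by (simp add: \<phi>)
    qed
  qed
  have "\<bar>\<phi> x - \<phi> y\<bar> \<le> 2 * B \<bar>x - y\<bar>"
    using key[of y x] key[of x y] M by (cases "y \<le> x") (auto simp: abs_minus_commute)
  then have "q * \<bar>\<phi> x - \<phi> y\<bar> \<le> q * (2 * B \<bar>x - y\<bar>)"
    using q by simp
  also have "q * \<bar>\<phi> x - \<phi> y\<bar> = \<bar>q * \<phi> x - q * \<phi> y\<bar>"
    using q by (simp add: abs_mult flip: right_diff_distrib)
  finally show "\<bar>q * (\<bar>x\<bar> powr (q - 2) * x) - q * (\<bar>y\<bar> powr (q - 2) * y)\<bar>
      \<le> 2 * q * q * M powr (q - min q 2) * \<bar>x - y\<bar> powr (min q 2 - 1)"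
    by (simp add: \<phi>_def B_def mult_ac)
next
  show "1 < min q 2" using q by simp
  show "min q 2 \<le> q" by simp
  show "0 \<le> 2 * q * q" by simp
  show "\<bar>0::real\<bar> powr q = 0" by simp
  show "q * (\<bar>0\<bar> powr (q - 2) * 0) = 0" by simp
qed

section \<open>The subcritical fractional Sobolev inequality\<close>

text \<open>\<open>lebesgue\<close> on pairs is the completion of a product, not the product of two
  completions. So the exceptional set is first enclosed in a Borel null set, which the product of
  the \<open>lborel\<close> measures can handle, and the result is completed again.\<close>

lemma AE_lebesgue_pair:
  fixes Q :: "'a::euclidean_space \<Rightarrow> bool"
  assumes "AE x in lebesgue. Q x"
  shows "AE z in (lebesgue :: ('a \<times> 'a) measure). Q (fst z) \<and> Q (snd z)"
proof -
  have "AE x in lborel. Q x"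
    using assms by (simp add: AE_completion_iff)
  then obtain N where N: "{x \<in> space lborel. \<not> Q x} \<subseteq> N" "emeasure lborel N = 0" "N \<in> sets lborel"
    by (rule AE_E)
  then have N0: "AE x in lborel. x \<notin> N"
    by (intro AE_not_in) (auto simp: null_sets_def)
  have [measurable]: "N \<in> sets borel" using N(3) by simp
  have "AE z in (lborel \<Otimes>\<^sub>M lborel). fst z \<notin> N \<and> snd z \<notin> N"
  proof (rule lborel_pair.AE_pair_measure)
    show "{z \<in> space (lborel \<Otimes>\<^sub>M lborel). fst z \<notin> N \<and> snd z \<notin> N} \<in> sets (lborel \<Otimes>\<^sub>M lborel)"
      by measurable
    show "AE x in lborel. AE y in lborel. fst (x, y) \<notin> N \<and> snd (x, y) \<notin> N"
      using N0 by auto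
  qed
  then have "AE z in (lborel :: ('a \<times> 'a) measure). Q (fst z) \<and> Q (snd z)"
    unfolding lborel_prod by (rule eventually_mono) (use N(1) in auto)
  then show ?thesis by (rule AE_completion)
qed

text \<open>Tonelli's theorem and product measurability call for Borel functions. The representative
  is cut off so that it vanishes at every point outside \<open>S\<close>, not merely at almost every
  one.\<close>

lemma borel_representative:
  fixes u :: "'a::euclidean_space \<Rightarrow> real"
  assumes u: "u \<in> borel_measurable lebesgue" and S: "S \<in> sets borel"
    and off: "AE x in lebesgue. x \<notin> S \<longrightarrow> u x = 0"
  obtains u' where "u' \<in> borel_measurable borel" "\<And>x. x \<notin> S \<Longrightarrow> u' x = 0"
    "AE x in lebesgue. u x = u' x"
proof -
  obtain v where v: "v \<in> borel_measurable lborel" "AE x in lborel. u x = v x"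
    using completion_ex_borel_measurable_real[OF u] by auto
  show ?thesis
  proof (rule that[of "\<lambda>x. indicator S x * v x"])
    show "(\<lambda>x. indicator S x * v x) \<in> borel_measurable borel"
      using v(1) S by auto
    have "AE x in lebesgue. u x = v x" using v(2) by (rule AE_completion)
    then show "AE x in lebesgue. u x = indicator S x * v x"
      using off by eventually_elim (auto simp: indicator_def)
  qed (simp add: indicator_def)
qed

lemma borel_measurable_pair_diff:
  fixes u :: "'a::euclidean_space \<Rightarrow> real"
  assumes u: "u \<in> borel_measurable lebesgue"
  shows "(\<lambda>z. u (fst z) - u (snd z)) \<in> borel_measurable lebesgue"
proof -
  obtain v where [measurable]: "v \<in> borel_measurable borel" and v: "AE x in lebesgue. u x = v x"
    by (rule borel_representative[OF u, of UNIV]) auto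
  show ?thesis
  proof (rule borel_measurable_AE)
    have "(\<lambda>z. v (fst z) - v (snd z)) \<in> borel_measurable borel"
      unfolding borel_prod[symmetric] by measurable
    then show "(\<lambda>z. v (fst z) - v (snd z)) \<in> borel_measurable lebesgue"
      by (intro measurable_completion) simp
    show "AE z in lebesgue. v (fst z) - v (snd z) = u (fst z) - u (snd z)"
      using AE_lebesgue_pair[OF v] by eventually_elim simp
  qed
qed

lemma gagliardo_measurable:
  assumes [measurable]: "u \<in> borel_measurable borel"
  shows "gagliardo_integrand s p u \<in> borel_measurable borel"
proof -
  have "gagliardo_integrand s p u =
      (\<lambda>z. \<bar>u (fst z) - u (snd z)\<bar> powr p / norm (fst z - snd z) powr (real CARD('a) + s * p))"
    by (auto simp: gagliardo_integrand_def fun_eq_iff)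
  also have "\<dots> \<in> borel_measurable (borel \<Otimes>\<^sub>M borel)" by measurable
  finally show ?thesis by (simp add: borel_prod)
qed

lemma gagliardo_nonneg: "0 \<le> gagliardo_integrand s p u z"
  by (cases z) (simp add: gagliardo_integrand_def)

section \<open>Gagliardo energy and decay of level sets\<close>

text \<open>The \<open>p\<close>-th power of \<open>gagliardo_norm\<close>: an integral without a
  root, so that Fatou's lemma and the modular estimates apply to it directly.\<close>

definition gagliardo :: "real \<Rightarrow> real \<Rightarrow> (real^'n \<Rightarrow> real) \<Rightarrow> real" where
  "gagliardo s p u = (LINT z|lebesgue. gagliardo_integrand s p u z)"

lemma gagliardo_ge_0: "0 \<le> gagliardo s p u"
  unfolding gagliardo_def by (intro integral_nonneg_AE AE_I2 gagliardo_nonneg)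

lemma gagliardo_cong:
  fixes u v :: "real^'n \<Rightarrow> real"
  assumes "AE x in lebesgue. u x = v x"
  shows "AE z in lebesgue. gagliardo_integrand s p u z = gagliardo_integrand s p v z"
  using AE_lebesgue_pair[OF assms]
  by eventually_elim (auto simp: gagliardo_integrand_def split: prod.splits)

text \<open>Each point with \<open>\<bar>u\<bar> > 2 * t\<close> sees, in the ball of radius \<open>r\<close> around it, a set of
  points with \<open>\<bar>u\<bar> \<le> t\<close> whose measure is at least the difference in the last factor.\<close>

lemma level_set_interaction:
  fixes u :: "real^'n \<Rightarrow> real"
  assumes u[measurable]: "u \<in> borel_measurable borel" and sp: "0 < s" "0 < p"
    and t: "0 < t" and r: "0 < r" and T: "0 \<le> T"
    and G: "(\<integral>\<^sup>+z. gagliardo_integrand s p u z \<partial>lborel) \<le> ennreal T"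
    and fin: "emeasure lborel {x. t < \<bar>u x\<bar>} < \<infinity>"
  shows "t powr p / r powr (real CARD('n) + s * p) * measure lborel {x. 2 * t < \<bar>u x\<bar>}
      * (measure lborel (ball (0::real^'n) r) - measure lborel {x. t < \<bar>u x\<bar>}) \<le> T"
proof -
  define D where "D t = {x. t < \<bar>u x\<bar>}" for t
  have [measurable]: "D t \<in> sets borel" for t
    unfolding D_def by measurable
  define c where "c = t powr p / r powr (real CARD('n) + s * p)"
  have c: "0 < c" using t r by (simp add: c_def)
  define B where "B = measure lborel (ball (0::real^'n) r) - measure lborel (D t)"
  have fin2: "emeasure lborel (D (2 * t)) < \<infinity>"
  proof -
    have "emeasure lborel (D (2 * t)) \<le> emeasure lborel (D t)"
      using t by (intro emeasure_mono) (auto simp: D_def)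
    with fin show ?thesis by (simp add: D_def)
  qed
  show ?thesis
  proof (cases "0 \<le> B")
    case False
    then have "c * measure lborel (D (2 * t)) * B \<le> 0"
      using c by (intro mult_nonneg_nonpos) auto
    with T show ?thesis by (simp add: c_def B_def D_def)
  next
    case True
    \<comment> \<open>On these pairs the Gagliardo integrand is at least \<open>c\<close>, since the
      values differ by more than \<open>t\<close> and the points by less than
      \<open>r\<close>.\<close>
    define S where "S = {z. fst z \<in> D (2 * t) \<and> dist (fst z) (snd z) < r \<and> snd z \<notin> D t}"
    have S[measurable]: "S \<in> sets (lborel \<Otimes>\<^sub>M lborel)"
    proof -
      have "S = {z \<in> space (borel \<Otimes>\<^sub>M borel). fst z \<in> D (2 * t) \<and> dist (fst z) (snd z) < r \<and> snd z \<notin> D t}"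
        by (auto simp: S_def space_pair_measure)
      also have "\<dots> \<in> sets (borel \<Otimes>\<^sub>M borel)" by measurable
      also have "sets (borel \<Otimes>\<^sub>M borel) = sets (lborel \<Otimes>\<^sub>M lborel)"
        by (intro sets_pair_measure_cong) auto
      finally show ?thesis .
    qed
    have "ennreal c * (emeasure lborel (D (2 * t)) * ennreal B)
        = (\<integral>\<^sup>+x. ennreal c * ennreal B * indicator (D (2 * t)) x \<partial>lborel)"
      by (subst nn_integral_cmult_indicator) (auto simp: mult_ac)
    also have "\<dots> \<le> (\<integral>\<^sup>+x. ennreal c * emeasure lborel (Pair x -` S) \<partial>lborel)"
    proof (rule nn_integral_mono)
      fix x :: "real^'n"
      show "ennreal c * ennreal B * indicator (D (2 * t)) x \<le> ennreal c * emeasure lborel (Pair x -` S)"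
      proof (cases "x \<in> D (2 * t)")
        case x: True
        have eq: "Pair x -` S = ball x r - D t"
          using x by (auto simp: S_def)
        have fb: "ball x r \<in> fmeasurable lborel"
          using emeasure_bounded_finite[of "ball x r"] by (auto simp: fmeasurable_def)
        have fD: "D t \<in> fmeasurable lborel"
          using fin by (auto simp: fmeasurable_def D_def)
        have "measure lborel (ball (0::real^'n) r) \<le> measure lborel (ball x r - D t) + measure lborel (D t)"
        proof -
          have "measure lborel (ball (0::real^'n) r) = measure lborel (ball x r)"
            using r by (simp add: content_ball)
          also have "\<dots> \<le> measure lborel ((ball x r - D t) \<union> D t)"
            using fb fD by (intro measure_mono_fmeasurable fmeasurable.Un fmeasurable_Diff) auto
          also have "\<dots> \<le> measure lborel (ball x r - D t) + measure lborel (D t)"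
            by (rule measure_Un_le) auto
          finally show ?thesis .
        qed
        then have "ennreal B \<le> ennreal (measure lborel (ball x r - D t))"
          by (intro ennreal_leI) (simp add: B_def)
        also have "\<dots> = emeasure lborel (ball x r - D t)"
          using fmeasurableD2[OF fmeasurable_Diff[OF fb, of "D t"]]
          by (intro emeasure_eq_ennreal_measure[symmetric]) auto
        finally show ?thesis using x by (simp add: eq mult_left_mono)
      qed simp
    qed
    also have "\<dots> = ennreal c * emeasure (lborel \<Otimes>\<^sub>M lborel) S"
      using lborel.measurable_emeasure_Pair[OF S] by (simp add: nn_integral_cmult lborel.emeasure_pair_measure_alt[OF S])
    also have "\<dots> = (\<integral>\<^sup>+z. ennreal c * indicator S z \<partial>lborel)"
      unfolding lborel_prod[symmetric] by (rule nn_integral_cmult_indicator[OF S, symmetric])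
    also have "\<dots> \<le> (\<integral>\<^sup>+z. gagliardo_integrand s p u z \<partial>lborel)"
    proof (rule nn_integral_mono)
      fix z :: "(real^'n) \<times> (real^'n)"
      obtain x y where z: "z = (x, y)" by (cases z)
      show "ennreal c * indicator S z \<le> ennreal (gagliardo_integrand s p u z)"
      proof (cases "z \<in> S")
        case True
        then have xy: "2 * t < \<bar>u x\<bar>" "\<bar>u y\<bar> \<le> t" "norm (x - y) \<le> r" "x \<noteq> y"
          using t by (auto simp: S_def D_def z dist_norm)
        have "c \<le> \<bar>u x - u y\<bar> powr p / norm (x - y) powr (real CARD('n) + s * p)"
          unfolding c_def using xy t sp by (intro frac_le powr_mono2) auto
        then show ?thesis using True by (simp add: gagliardo_integrand_def z ennreal_leI)
      qed simp
    qed
    also note G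
    finally have "ennreal (c * (measure lborel (D (2 * t)) * B)) \<le> ennreal T"
      using fin2 c True by (simp add: emeasure_eq_ennreal_measure ennreal_mult)
    then have "c * (measure lborel (D (2 * t)) * B) \<le> T"
      using T by (subst (asm) ennreal_le_iff) auto
    then show ?thesis by (simp add: c_def B_def D_def mult_ac)
  qed
qed

text \<open>The radius in \<open>level_set_interaction\<close> is free. A ball of twice the measure
  of \<open>{x. t < \<bar>u x\<bar>}\<close> turns the last factor into that measure itself, and
  dividing by it leaves its power \<open>s * p / N\<close>, with \<open>N\<close> the
  dimension.\<close>

lemma level_set_step:
  fixes u :: "real^'n \<Rightarrow> real"
  assumes u[measurable]: "u \<in> borel_measurable borel" and sp: "0 < s" "0 < p"
    and t: "0 < t" and T: "0 \<le> T"
    and G: "(\<integral>\<^sup>+z. gagliardo_integrand s p u z \<partial>lborel) \<le> ennreal T"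
    and fin: "emeasure lborel {x. t < \<bar>u x\<bar>} < \<infinity>"
  shows "measure lborel {x. 2 * t < \<bar>u x\<bar>}
    \<le> (2 / unit_ball_vol (real CARD('n))) powr (1 + s * p / real CARD('n)) * (T / t powr p)
      * measure lborel {x. t < \<bar>u x\<bar>} powr (s * p / real CARD('n))"
proof -
  define N where "N = real CARD('n)"
  define \<beta> where "\<beta> = unit_ball_vol N"
  define \<mu> where "\<mu> = measure lborel {x. t < \<bar>u x\<bar>}"
  define \<nu> where "\<nu> = measure lborel {x. 2 * t < \<bar>u x\<bar>}"
  have N: "N > 0" by (simp add: N_def)
  have \<beta>: "\<beta> > 0" using N by (simp add: \<beta>_def)
  have \<nu>\<mu>: "\<nu> \<le> \<mu>" unfolding \<nu>_def \<mu>_def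
    using t fin by (intro measure_mono_fmeasurable) (auto simp: fmeasurable_def)
  show ?thesis
  proof (cases "\<mu> = 0")
    case True
    then have "\<nu> = 0" using \<nu>\<mu> measure_nonneg[of lborel "{x. 2 * t < \<bar>u x\<bar>}"] by (simp add: \<nu>_def)
    then show ?thesis unfolding \<nu>_def using T by (auto intro!: mult_nonneg_nonneg)
  next
    case False
    then have \<mu>: "\<mu> > 0" by (simp add: \<mu>_def zero_less_measure_iff)
    define r where "r = (2 * \<mu> / \<beta>) powr (1 / N)"
    have r: "r > 0" using \<mu> \<beta> by (simp add: r_def)
    have rN: "r powr N = 2 * \<mu> / \<beta>"
      using \<mu> \<beta> N by (simp add: r_def powr_powr)
    have "measure lborel (ball (0::real^'n) r) = \<beta> * r ^ CARD('n)"
      using r by (simp add: content_ball \<beta>_def N_def)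
    also have "r ^ CARD('n) = r powr N"
      using r by (simp add: N_def powr_realpow)
    finally have ball: "measure lborel (ball (0::real^'n) r) = 2 * \<mu>"
      using rN \<beta> by simp
    have "t powr p / r powr (N + s * p) * \<nu> * (2 * \<mu> - \<mu>) \<le> T"
      using level_set_interaction[OF u sp t r T G fin]
      unfolding ball \<mu>_def[symmetric] \<nu>_def[symmetric] N_def[symmetric] .
    then have "\<nu> * \<mu> \<le> T / t powr p * r powr (N + s * p)"
      using t r by (simp add: field_simps)
    also have "r powr (N + s * p) = (2 * \<mu> / \<beta>) powr (1 + s * p / N)"
      using N by (simp add: r_def powr_powr add_divide_distrib)
    also have "\<dots> = (2 / \<beta>) powr (1 + s * p / N) * \<mu> powr (s * p / N) * \<mu>"
      using \<mu> \<beta> by (simp add: powr_divide powr_mult powr_add)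
    finally have "\<nu> * \<mu> \<le> (T / t powr p * ((2 / \<beta>) powr (1 + s * p / N) * \<mu> powr (s * p / N))) * \<mu>"
      by (simp only: mult.assoc)
    then have "\<nu> \<le> T / t powr p * ((2 / \<beta>) powr (1 + s * p / N) * \<mu> powr (s * p / N))"
      using \<mu> by (rule mult_right_le_imp_le)
    then show ?thesis by (simp add: \<nu>_def \<mu>_def N_def \<beta>_def mult_ac)
  qed
qed

lemma superlevel_subset:
  fixes u :: "'a \<Rightarrow> real"
  assumes "\<And>x. x \<notin> S \<Longrightarrow> u x = 0" "0 \<le> c"
  shows "{x. c < \<bar>u x\<bar>} \<subseteq> S"
proof
  fix x assume "x \<in> {x. c < \<bar>u x\<bar>}"
  then have "u x \<noteq> 0" using assms(2) by auto
  then show "x \<in> S" using assms(1) by blast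
qed

text \<open>One step bounds the next measure by a power \<theta> = \<open>s * p / N\<close> of the
  previous one. Decay of order \<open>ps\<close> reproduces itself because
  \<open>p + ps * \<theta> = ps\<close>, and
  \<open>K * 2 powr ps \<le> B powr (1 - s * p / N)\<close> is exactly what absorbs the constants in
  the induction step.\<close>

lemma level_set_decay:
  fixes u :: "real^'n \<Rightarrow> real" and s p :: real
  defines "N \<equiv> real CARD('n)"
  defines "ps \<equiv> N * p / (N - s * p)"
  defines "K \<equiv> (2 / unit_ball_vol N) powr (1 + s * p / N)"
  assumes u[measurable]: "u \<in> borel_measurable borel" and sp: "0 < s" "0 < p" "s * p < N"
    and S: "S \<in> sets borel" "emeasure lborel S < \<infinity>" "\<And>x. x \<notin> S \<Longrightarrow> u x = 0"
    and t: "0 < t"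
    and G: "(\<integral>\<^sup>+z. gagliardo_integrand s p u z \<partial>lborel) \<le> ennreal (t powr p)"
    and B: "measure lborel S \<le> B" "K * 2 powr ps \<le> B powr (1 - s * p / N)" "0 < B"
  shows "measure lborel {x. 2 ^ k * t < \<bar>u x\<bar>} \<le> B * (2 ^ k) powr (- ps)"
proof (induction k)
  case 0
  have "measure lborel {x. t < \<bar>u x\<bar>} \<le> measure lborel S"
    using S t by (intro measure_mono_fmeasurable superlevel_subset) (auto simp: fmeasurable_def)
  then show ?case using B by simp
next
  case (Suc k)
  have N: "N > 0" by (simp add: N_def)
  define \<theta> where "\<theta> = s * p / N"
  have \<theta>: "0 < \<theta>" "\<theta> < 1" using sp N by (auto simp: \<theta>_def)
  have ps: "p + ps * \<theta> = ps"
    using sp N by (simp add: ps_def \<theta>_def field_simps)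
  define a where "a = (2::real) ^ k"
  have a: "a > 0" by (simp add: a_def)
  have "emeasure lborel {x. a * t < \<bar>u x\<bar>} \<le> emeasure lborel S"
    using S t a by (intro emeasure_mono superlevel_subset) auto
  then have fin: "emeasure lborel {x. a * t < \<bar>u x\<bar>} < \<infinity>"
    using S(2) by simp
  have K: "0 \<le> K" by (simp add: K_def)
  have "measure lborel {x. 2 * (a * t) < \<bar>u x\<bar>}
      \<le> K * (t powr p / (a * t) powr p) * measure lborel {x. a * t < \<bar>u x\<bar>} powr \<theta>"
    unfolding K_def N_def \<theta>_def using a t sp fin by (intro level_set_step G) auto
  also have "t powr p / (a * t) powr p = a powr (- p)"
    using a t by (simp add: powr_mult powr_minus field_simps)
  also have "K * a powr (- p) * measure lborel {x. a * t < \<bar>u x\<bar>} powr \<theta>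
      \<le> K * a powr (- p) * (B * a powr (- ps)) powr \<theta>"
    using Suc K \<theta> by (intro mult_left_mono powr_mono2) (auto simp: a_def)
  also have "\<dots> = K * B powr \<theta> * a powr (- ps)"
  proof -
    have "a powr (- p) * (a powr (- ps)) powr \<theta> = a powr (- ps)"
    proof -
      have "- p + - ps * \<theta> = - ps" using ps by linarith
      then show ?thesis by (simp only: powr_powr powr_add[symmetric])
    qed
    then show ?thesis using B a by (simp add: powr_mult mult_ac)
  qed
  also have "\<dots> \<le> (B powr (1 - \<theta>) / 2 powr ps) * B powr \<theta> * a powr (- ps)"
    using B(2) by (intro mult_right_mono) (auto simp: \<theta>_def field_simps)
  also have "\<dots> = B * (2 * a) powr (- ps)"
    using B a by (simp add: powr_mult powr_minus powr_diff field_simps)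
  finally show ?case by (simp add: a_def mult_ac)
qed

text \<open>A layer cake sum over dyadic levels. Points with \<open>\<bar>u x\<bar> \<le> t\<close>
  contribute the measure of \<open>S\<close>, and the levels above \<open>t\<close> form a geometric
  series of ratio \<open>2 powr (q - ps)\<close>, which is below one.\<close>

lemma level_set_moment:
  fixes u :: "real^'n \<Rightarrow> real"
  assumes u[measurable]: "u \<in> borel_measurable borel"
    and S: "S \<in> sets borel" "emeasure lborel S < \<infinity>" "\<And>x. x \<notin> S \<Longrightarrow> u x = 0"
    and q: "0 < q" "q < ps" and t: "0 < t" and B: "0 \<le> B"
    and dec: "\<And>k. measure lborel {x. 2 ^ k * t < \<bar>u x\<bar>} \<le> B * (2 ^ k) powr (- ps)"
  shows "(\<integral>\<^sup>+x. ennreal (\<bar>u x\<bar> powr q) \<partial>lborel)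
    \<le> ennreal ((measure lborel S + B * 2 powr q / (1 - 2 powr (q - ps))) * t powr q)"
proof -
  define D where "D k = {x. 2 ^ k * t < \<bar>u x\<bar>}" for k :: nat
  have [measurable]: "D k \<in> sets borel" for k unfolding D_def by measurable
  have finD: "emeasure lborel (D k) = ennreal (measure lborel (D k))" for k
  proof (rule emeasure_eq_ennreal_measure)
    have "emeasure lborel (D k) \<le> emeasure lborel S"
      using S t unfolding D_def by (intro emeasure_mono superlevel_subset) auto
    then show "emeasure lborel (D k) \<noteq> top" using S(2) by auto
  qed
  define g where "g = (2::real) powr (q - ps)"
  have g: "0 < g" "g < 1" using q by (auto simp: g_def powr_less_one)
  have pw: "ennreal (\<bar>u x\<bar> powr q) \<le> ennreal (t powr q) * indicator S x +
      (\<Sum>k. ennreal ((2 ^ Suc k * t) powr q) * indicator (D k) x)" for x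
  proof (cases "\<bar>u x\<bar> \<le> t")
    case True
    then have "ennreal (\<bar>u x\<bar> powr q) \<le> ennreal (t powr q) * indicator S x"
      using q S(3)[of x] by (cases "x \<in> S") (auto intro!: ennreal_leI powr_mono2)
    then show ?thesis by (rule order_trans) simp
  next
    case False
    \<comment> \<open>Minimality of \<open>k\<close> puts \<open>x\<close> above the previous level,
      hence into \<open>D k\<close>; for \<open>k = 0\<close> this is the negated case
      assumption.\<close>
    define k where "k = (LEAST k. \<bar>u x\<bar> \<le> 2 ^ Suc k * t)"
    obtain n where "\<bar>u x\<bar> / t < 2 ^ n"
      using real_arch_pow[of 2] by auto
    then have "\<bar>u x\<bar> \<le> 2 ^ Suc n * t" using t by (simp add: field_simps)
    then have k: "\<bar>u x\<bar> \<le> 2 ^ Suc k * t"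
      unfolding k_def by (rule LeastI)
    have xD: "x \<in> D k"
    proof (cases k)
      case 0
      then show ?thesis using False by (simp add: D_def)
    next
      case (Suc j)
      then have "\<not> \<bar>u x\<bar> \<le> 2 ^ Suc j * t"
        using not_less_Least[of j "\<lambda>k. \<bar>u x\<bar> \<le> 2 ^ Suc k * t"] by (simp add: k_def)
      then show ?thesis by (simp add: D_def Suc)
    qed
    have "ennreal (\<bar>u x\<bar> powr q) \<le> ennreal ((2 ^ Suc k * t) powr q) * indicator (D k) x"
      using xD k q by (auto intro!: ennreal_leI powr_mono2)
    also have "\<dots> \<le> (\<Sum>k. ennreal ((2 ^ Suc k * t) powr q) * indicator (D k) x)"
    proof -
      have "f k \<le> suminf f" for f :: "nat \<Rightarrow> ennreal"
        using sum_le_suminf[of f "{k}"] by simp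
      then show ?thesis .
    qed
    finally show ?thesis by (rule order_trans) simp
  qed
  have "(\<integral>\<^sup>+x. ennreal (\<bar>u x\<bar> powr q) \<partial>lborel) \<le>
      (\<integral>\<^sup>+x. (ennreal (t powr q) * indicator S x +
      (\<Sum>k. ennreal ((2 ^ Suc k * t) powr q) * indicator (D k) x)) \<partial>lborel)"
    by (rule nn_integral_mono) (rule pw)
  also have "\<dots> = ennreal (t powr q) * emeasure lborel S +
      (\<Sum>k. ennreal ((2 ^ Suc k * t) powr q) * emeasure lborel (D k))"
    using S by (simp add: nn_integral_add nn_integral_suminf nn_integral_cmult_indicator)
  also have "\<dots> \<le> ennreal (t powr q * measure lborel S) +
      (\<Sum>k. ennreal (B * 2 powr q * t powr q * g ^ k))"
  proof (intro add_mono suminf_le allI)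
    show "ennreal (t powr q) * emeasure lborel S \<le> ennreal (t powr q * measure lborel S)"
      using S by (simp add: emeasure_eq_ennreal_measure ennreal_mult)
    fix k
    have "(2 ^ Suc k * t) powr q * measure lborel (D k) \<le> (2 ^ Suc k * t) powr q * (B * (2 ^ k) powr (- ps))"
      using dec[of k] by (intro mult_left_mono) (auto simp: D_def)
    also have "\<dots> = B * 2 powr q * t powr q * ((2 ^ k) powr q * (2 ^ k) powr (- ps))"
      using t by (simp add: powr_mult mult_ac)
    also have "(2 ^ k) powr q * (2 ^ k) powr (- ps) = g ^ k"
    proof -
      have "(2 ^ k) powr q * (2 ^ k) powr (- ps) = (2 powr real k) powr (q - ps)"
        by (simp add: powr_realpow flip: powr_add)
      also have "\<dots> = g powr real k" unfolding g_def by (simp add: powr_powr mult.commute)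
      finally show ?thesis using g by (simp add: powr_realpow)
    qed
    finally show "ennreal ((2 ^ Suc k * t) powr q) * emeasure lborel (D k)
        \<le> ennreal (B * 2 powr q * t powr q * g ^ k)"
      by (simp add: finD ennreal_mult[symmetric] ennreal_leI)
  qed auto
  also have "(\<Sum>k. ennreal (B * 2 powr q * t powr q * g ^ k)) = ennreal (B * 2 powr q * t powr q * (1 / (1 - g)))"
  proof (rule suminf_ennreal_eq)
    show "(\<lambda>k. B * 2 powr q * t powr q * g ^ k) sums (B * 2 powr q * t powr q * (1 / (1 - g)))"
      using g by (intro sums_mult geometric_sums) auto
    show "0 \<le> B * 2 powr q * t powr q * g ^ k" for k using B g by auto
  qed
  also have "ennreal (t powr q * measure lborel S) + ennreal (B * 2 powr q * t powr q * (1 / (1 - g)))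
      = ennreal ((measure lborel S + B * 2 powr q / (1 - g)) * t powr q)"
    using B g by (subst ennreal_plus[symmetric]) (auto simp: algebra_simps)
  finally show ?thesis by (simp add: g_def)
qed

lemma frac_sobolev0_representative:
  fixes u :: "real^'n \<Rightarrow> real"
  assumes u: "u \<in> frac_sobolev0 s p \<Omega>" and \<Omega>: "\<Omega> \<in> sets borel"
  obtains u' where "u' \<in> borel_measurable borel" "\<And>x. x \<notin> \<Omega> \<Longrightarrow> u' x = 0"
    "AE x in lebesgue. u x = u' x"
    "(\<integral>\<^sup>+z. gagliardo_integrand s p u' z \<partial>lborel) = ennreal (gagliardo s p u)"
proof -
  have m: "u \<in> borel_measurable lebesgue" and g: "integrable lebesgue (gagliardo_integrand s p u)"
    and off: "AE x in lebesgue. x \<notin> \<Omega> \<longrightarrow> u x = 0"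
    using u by (auto simp: frac_sobolev0_def frac_sobolev_def)
  obtain v where v: "v \<in> borel_measurable borel" "\<And>x. x \<notin> \<Omega> \<Longrightarrow> v x = 0"
    "AE x in lebesgue. u x = v x"
    using borel_representative[OF m \<Omega> off] by blast
  have "(\<integral>\<^sup>+z. gagliardo_integrand s p v z \<partial>lborel) = (\<integral>\<^sup>+z. gagliardo_integrand s p v z \<partial>lebesgue)"
    by (simp add: nn_integral_completion)
  also have "\<dots> = (\<integral>\<^sup>+z. gagliardo_integrand s p u z \<partial>lebesgue)"
    using gagliardo_cong[OF v(3), of s p] by (intro nn_integral_cong_AE) (auto elim: eventually_mono)
  also have "\<dots> = ennreal (gagliardo s p u)"
    unfolding gagliardo_def using g by (intro nn_integral_eq_integral AE_I2 gagliardo_nonneg)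
  finally show ?thesis using that v by blast
qed

text \<open>The scale \<open>t\<close> takes the place of the seminorm. It is also the lowest level
  of the dyadic decomposition, which is why the constant does not depend on it. A function of zero
  seminorm is covered with every \<open>t\<close>.\<close>

theorem fractional_sobolev_subcritical:
  fixes \<Omega> :: "(real^'n) set"
  assumes \<Omega>: "open \<Omega>" "bounded \<Omega>" and sp: "0 < s" "0 < p" "s * p < real CARD('n)"
    and q: "0 < q" "q < real CARD('n) * p / (real CARD('n) - s * p)"
  obtains C where "0 \<le> C"
    "\<And>u t. u \<in> frac_sobolev0 s p \<Omega> \<Longrightarrow> 0 < t \<Longrightarrow> gagliardo s p u \<le> t powr p \<Longrightarrow>
      integrable lebesgue (\<lambda>x. \<bar>u x\<bar> powr q) \<and> (LINT x|lebesgue. \<bar>u x\<bar> powr q) \<le> C * t powr q"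
proof -
  define N where "N = real CARD('n)"
  define ps where "ps = N * p / (N - s * p)"
  define K where "K = (2 / unit_ball_vol N) powr (1 + s * p / N)"
  \<comment> \<open>The three summands serve the start of the induction, the positivity of
    \<open>B\<close>, and the inequality that absorbs the constants of the recursion.\<close>
  define B where "B = measure lborel \<Omega> + 1 + (K * 2 powr ps) powr (1 / (1 - s * p / N))"
  have N: "N > 0" by (simp add: N_def)
  have K: "K \<ge> 0" by (simp add: K_def)
  have S: "\<Omega> \<in> sets borel" "emeasure lborel \<Omega> < \<infinity>"
    using \<Omega> emeasure_bounded_finite[of \<Omega>] by (auto simp: less_top)
  have \<theta>: "s * p / N < 1" using sp N by (simp add: N_def)
  have B0: "0 < B" "measure lborel \<Omega> \<le> B"
    unfolding B_def
    using measure_nonneg[of lborel \<Omega>] powr_ge_zero[of "K * 2 powr ps" "1 / (1 - s * p / N)"]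
    by linarith+
  have "K * 2 powr ps = ((K * 2 powr ps) powr (1 / (1 - s * p / N))) powr (1 - s * p / N)"
  proof -
    have inv: "1 / x * x = 1" if "x \<noteq> 0" for x :: real using that by simp
    have "1 / (1 - s * p / N) * (1 - s * p / N) = 1"
      by (rule inv) (use \<theta> in linarith)
    then show ?thesis using K by (simp only: powr_powr) simp
  qed
  also have "\<dots> \<le> B powr (1 - s * p / N)"
    using \<theta> by (intro powr_mono2) (auto simp: B_def)
  finally have B1: "K * 2 powr ps \<le> B powr (1 - s * p / N)" .
  define C where "C = measure lborel \<Omega> + B * 2 powr q / (1 - 2 powr (q - ps))"
  have q': "q < ps" using q by (simp add: ps_def N_def)
  have g: "(2::real) powr (q - ps) < 1"
    using powr_less_mono[of "q - ps" 0 2] q' by simp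
  have "0 \<le> B * 2 powr q / (1 - 2 powr (q - ps))"
    using g B0(1) by simp
  then have C: "0 \<le> C" unfolding C_def using measure_nonneg[of lborel \<Omega>] by linarith
  show ?thesis
  proof (rule that[OF C])
    fix u :: "real^'n \<Rightarrow> real" and t :: real
    assume u: "u \<in> frac_sobolev0 s p \<Omega>" and t: "0 < t" and G: "gagliardo s p u \<le> t powr p"
    have mu[measurable]: "u \<in> borel_measurable lebesgue"
      using u by (auto simp: frac_sobolev0_def frac_sobolev_def)
    obtain v where v: "v \<in> borel_measurable borel" "\<And>x. x \<notin> \<Omega> \<Longrightarrow> v x = 0"
      "AE x in lebesgue. u x = v x"
      "(\<integral>\<^sup>+z. gagliardo_integrand s p v z \<partial>lborel) = ennreal (gagliardo s p u)"
      using frac_sobolev0_representative[OF u S(1)] by blast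
    have G': "(\<integral>\<^sup>+z. gagliardo_integrand s p v z \<partial>lborel) \<le> ennreal (t powr p)"
      unfolding v(4) using G by (rule ennreal_leI)
    have dec: "measure lborel {x. 2 ^ k * t < \<bar>v x\<bar>} \<le> B * (2 ^ k) powr (- ps)" for k
      using level_set_decay[OF v(1) sp S v(2) t G', of B k] B0 B1
      unfolding N_def K_def ps_def by blast
    have "(\<integral>\<^sup>+x. ennreal (\<bar>u x\<bar> powr q) \<partial>lebesgue) = (\<integral>\<^sup>+x. ennreal (\<bar>v x\<bar> powr q) \<partial>lebesgue)"
      using v(3) by (intro nn_integral_cong_AE) (auto elim: eventually_mono)
    also have "\<dots> = (\<integral>\<^sup>+x. ennreal (\<bar>v x\<bar> powr q) \<partial>lborel)"
      by (rule nn_integral_completion)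
    also have "\<dots> \<le> ennreal (C * t powr q)"
      unfolding C_def using level_set_moment[OF v(1) S v(2) q(1) q' t _ dec] B0 by auto
    finally have le: "(\<integral>\<^sup>+x. ennreal (\<bar>u x\<bar> powr q) \<partial>lebesgue) \<le> ennreal (C * t powr q)" .
    have int: "integrable lebesgue (\<lambda>x. \<bar>u x\<bar> powr q)"
      using le by (intro integrableI_bounded) (auto intro: le_less_trans)
    then have "ennreal (LINT x|lebesgue. \<bar>u x\<bar> powr q) \<le> ennreal (C * t powr q)"
      using le by (subst nn_integral_eq_integral[symmetric]) auto
    then show "integrable lebesgue (\<lambda>x. \<bar>u x\<bar> powr q) \<and> (LINT x|lebesgue. \<bar>u x\<bar> powr q) \<le> C * t powr q"
      using int C by (auto simp: ennreal_le_iff)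
  qed
qed

section \<open>Averages over cells\<close>

text \<open>For \<open>k > 0\<close> these are half-open cubes of side \<open>1 / k\<close> in a
  grid; integer parts make them a partition of the space.\<close>

definition cell :: "nat \<Rightarrow> ('n \<Rightarrow> int) \<Rightarrow> (real^'n) set" where
  "cell k z = {x. \<forall>i. \<lfloor>real k * x $ i\<rfloor> = z i}"

lemma cell_index: "x \<in> cell k (\<lambda>i. \<lfloor>real k * x $ i\<rfloor>)"
  by (simp add: cell_def)

lemma cell_unique: "x \<in> cell k z \<Longrightarrow> x \<in> cell k z' \<Longrightarrow> z = z'"
  by (auto simp: cell_def fun_eq_iff)

lemma cell_borel[measurable]: "cell k z \<in> sets borel"
proof -
  have "cell k z = (\<Inter>i. {x. real_of_int (z i) \<le> real k * x $ i} \<inter> {x. real k * x $ i < real_of_int (z i) + 1})"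
    by (auto simp: cell_def floor_eq_iff)
  also have "\<dots> \<in> sets borel"
    by (intro sets.finite_INT sets.Int borel_closed borel_open closed_Collect_le
        open_Collect_less continuous_intros) auto
  finally show ?thesis .
qed

text \<open>The cell lies between an open and a closed box with the same corners and hence the same
  volume.\<close>

lemma measure_cell:
  fixes z :: "'n::finite \<Rightarrow> int"
  assumes k: "0 < k"
  shows "emeasure lborel (cell k z :: (real^'n) set) = ennreal ((1 / real k) ^ CARD('n))"
proof -
  define l u where "l = (\<chi> i. real_of_int (z i) / real k)" and "u = (\<chi> i. (real_of_int (z i) + 1) / real k)"
  have lu: "l \<bullet> b \<le> u \<bullet> b" if "b \<in> Basis" for b :: "real^'n"
    using that k by (auto simp: l_def u_def Basis_vec_def inner_axis divide_right_mono)
  have "(\<Prod>b\<in>Basis. (u - l) \<bullet> b) = (1 / real k) ^ CARD('n)"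
  proof -
    have "(u - l) \<bullet> b = 1 / real k" if "b \<in> Basis" for b :: "real^'n"
      using that k by (auto simp: l_def u_def Basis_vec_def inner_axis field_simps)
    then show ?thesis by simp
  qed
  note vol = this
  have "emeasure lborel (box l u) \<le> emeasure lborel (cell k z)"
    using k by (intro emeasure_mono) (auto simp: cell_def l_def u_def mem_box_cart floor_eq_iff field_simps less_imp_le)
  moreover have "emeasure lborel (cell k z) \<le> emeasure lborel (cbox l u)"
    using k by (intro emeasure_mono) (auto simp: cell_def l_def u_def mem_box_cart floor_eq_iff field_simps less_imp_le)
  moreover have "emeasure lborel (box l u) = ennreal ((1 / real k) ^ CARD('n))"
    "emeasure lborel (cbox l u) = ennreal ((1 / real k) ^ CARD('n))"
    using lu vol by (simp_all add: emeasure_lborel_box_eq emeasure_lborel_cbox_eq)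
  ultimately show ?thesis by simp
qed

lemma cell_diameter:
  fixes x y :: "real^'n"
  assumes k: "0 < k" and "x \<in> cell k z" "y \<in> cell k z"
  shows "norm (x - y) \<le> real CARD('n) / real k"
proof -
  have "\<bar>(x - y) $ i\<bar> \<le> 1 / real k" for i
  proof -
    have "\<lfloor>real k * x $ i\<rfloor> = \<lfloor>real k * y $ i\<rfloor>" using assms by (simp add: cell_def)
    then have "\<bar>real k * x $ i - real k * y $ i\<bar> \<le> 1" by linarith
    then have "real k * \<bar>x $ i - y $ i\<bar> \<le> 1"
      using k by (simp add: abs_mult flip: right_diff_distrib)
    then show ?thesis using k by (simp add: field_simps)
  qed
  then have "(\<Sum>i\<in>UNIV. \<bar>(x - y) $ i\<bar>) \<le> (\<Sum>i\<in>(UNIV :: 'n set). 1 / real k)"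
    by (intro sum_mono) auto
  then show ?thesis using norm_le_l1_cart[of "x - y"] by simp
qed

lemma finite_cell_indices:
  fixes \<Omega> :: "(real^'n) set"
  assumes "bounded \<Omega>"
  shows "finite ((\<lambda>x i. \<lfloor>real k * x $ i\<rfloor>) ` \<Omega>)"
proof -
  obtain R where R: "\<And>x. x \<in> \<Omega> \<Longrightarrow> norm x \<le> R"
    using assms by (auto simp: bounded_iff)
  have "(\<lambda>x i. \<lfloor>real k * x $ i\<rfloor>) ` \<Omega> \<subseteq> (\<Pi>\<^sub>E i\<in>UNIV. {\<lfloor>- (real k * R)\<rfloor>..\<lfloor>real k * R\<rfloor>})"
  proof (clarsimp simp: PiE_def Pi_def)
    fix x i assume x: "x \<in> \<Omega>"
    have "\<bar>x $ i\<bar> \<le> R" using component_le_norm_cart[of x i] R[OF x] by linarith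
    then have "\<bar>real k * x $ i\<bar> \<le> real k * R" by (simp add: abs_mult mult_left_mono)
    then show "\<lfloor>- (real k * R)\<rfloor> \<le> \<lfloor>real k * x $ i\<rfloor> \<and> \<lfloor>real k * x $ i\<rfloor> \<le> \<lfloor>real k * R\<rfloor>"
      by (intro conjI floor_mono) linarith+
  qed
  then show ?thesis by (rule finite_subset) (intro finite_PiE, auto)
qed

section \<open>Oscillation on cells controlled by the Gagliardo energy\<close>

text \<open>A difference above \<eta> satisfies
  \<open>\<bar>D\<bar> powr (1 - p) \<le> \<eta> powr (1 - p)\<close>, so it is controlled by its
  \<open>p\<close>-th power. The factor \<open>d powr e / n powr e\<close> is at least one and
  brings in the singular kernel.\<close>

lemma oscillation_le:
  fixes D d \<eta> p n :: real
  assumes \<eta>: "0 < \<eta>" and p: "1 \<le> p" and n: "0 < n" "n \<le> d" and e: "0 \<le> e"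
  shows "\<bar>D\<bar> \<le> \<eta> + \<eta> powr (1 - p) * d powr e * (\<bar>D\<bar> powr p / n powr e)"
proof (cases "\<bar>D\<bar> \<le> \<eta>")
  case True
  then show ?thesis by (smt (verit) divide_nonneg_nonneg mult_nonneg_nonneg powr_ge_zero)
next
  case False
  then have D: "\<bar>D\<bar> > \<eta>" by simp
  have "\<bar>D\<bar> = \<bar>D\<bar> powr (1 - p) * \<bar>D\<bar> powr p"
    using D \<eta> by (simp flip: powr_add)
  also have "\<dots> \<le> \<eta> powr (1 - p) * \<bar>D\<bar> powr p"
    using D \<eta> p by (intro mult_right_mono powr_mono2') auto
  also have "\<dots> \<le> \<eta> powr (1 - p) * (d powr e * (\<bar>D\<bar> powr p / n powr e))"
  proof (intro mult_left_mono)
    have "n powr e \<le> d powr e" using n e by (intro powr_mono2) auto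
    then have "n powr e * \<bar>D\<bar> powr p \<le> d powr e * \<bar>D\<bar> powr p" by (rule mult_right_mono) simp
    then show "\<bar>D\<bar> powr p \<le> d powr e * (\<bar>D\<bar> powr p / n powr e)" using n by (simp add: field_simps)
  qed simp
  finally show ?thesis using \<eta> by (simp add: mult_ac)
qed

text \<open>A Poincare inequality on a cell: for \<open>x\<close> in \<open>Q\<close>,
  \<open>c * w x\<close> is the integral of \<open>w\<close> over \<open>Q\<close> plus the integral
  of \<open>w x - w y\<close> in \<open>y\<close>. The differences are bounded by
  \<open>oscillation_le\<close>, and integrating in \<open>x\<close> yields the energy of the block
  \<open>Q \<times> Q\<close>.\<close>

lemma mean_oscillation_bound:
  fixes w :: "real^'n \<Rightarrow> real"
  assumes w[measurable]: "w \<in> borel_measurable borel" and int: "integrable lborel w"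
    and Q[measurable]: "Q \<in> sets borel" and c: "emeasure lborel Q = ennreal c" "0 < c"
    and diam: "\<And>x y. x \<in> Q \<Longrightarrow> y \<in> Q \<Longrightarrow> norm (x - y) \<le> d"
    and \<eta>: "0 < \<eta>" and sp: "0 < s" "1 \<le> p"
  shows "(\<integral>\<^sup>+x. ennreal \<bar>w x\<bar> * indicator Q x \<partial>lborel) \<le>
    ennreal (\<bar>LINT x:Q|lborel. w x\<bar> + \<eta> * c) +
    ennreal (\<eta> powr (1 - p) * d powr (real CARD('n) + s * p) / c) *
      (\<integral>\<^sup>+z. ennreal (gagliardo_integrand s p w z) * indicator (Q \<times> Q) z \<partial>lborel)"
proof -
  define N where "N = real CARD('n)"
  define E where "E = \<eta> powr (1 - p) * d powr (N + s * p)"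
  have E: "0 \<le> E" by (simp add: E_def)
  define g where "g = gagliardo_integrand s p w"
  have g[measurable]: "g \<in> borel_measurable (borel \<Otimes>\<^sub>M borel)"
    unfolding g_def borel_prod by (rule gagliardo_measurable) measurable
  define I where "I = (LINT x:Q|lborel. w x)"
  have intQ: "set_integrable lborel Q w"
    unfolding set_integrable_def using int Q by (intro integrable_mult_indicator) auto
  have intc: "set_integrable lborel Q (\<lambda>y. r)" for r :: real
    using c by (simp add: set_integrable_def integrable_mult_left_iff)
  have mQ: "measure lborel Q = c"
    using c by (simp add: measure_def)
  have pt: "ennreal c * (ennreal \<bar>w x\<bar> * indicator Q x) \<le>
      ennreal (\<bar>I\<bar> + \<eta> * c) * indicator Q x + ennreal E * (\<integral>\<^sup>+y. ennreal (g (x, y)) * indicator (Q \<times> Q) (x, y) \<partial>lborel)" for x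
  proof (cases "x \<in> Q")
    case x: True
    have intd: "set_integrable lborel Q (\<lambda>y. w x - w y)"
      using intc intQ by (rule set_integral_diff)
    have "c * w x = (LINT y:Q|lborel. w x)"
      using c mQ by (simp add: set_lebesgue_integral_def)
    also have "\<dots> = (LINT y:Q|lborel. w y) + (LINT y:Q|lborel. w x - w y)"
      using set_integral_diff(2)[OF intc intQ, of "w x"] by simp
    finally have eq: "c * w x = I + (LINT y:Q|lborel. w x - w y)"
      unfolding I_def .
    have "c * \<bar>w x\<bar> = \<bar>c * w x\<bar>"
      using c(2) by (simp add: abs_mult)
    also have "\<dots> \<le> \<bar>I\<bar> + \<bar>LINT y:Q|lborel. w x - w y\<bar>"
      unfolding eq by (rule abs_triangle_ineq)
    also have "\<bar>LINT y:Q|lborel. w x - w y\<bar> \<le> (LINT y:Q|lborel. \<bar>w x - w y\<bar>)"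
      using set_integral_norm_bound[OF intd] by simp
    finally have "ennreal (c * \<bar>w x\<bar>) \<le> ennreal \<bar>I\<bar> + ennreal (LINT y:Q|lborel. \<bar>w x - w y\<bar>)"
    proof (subst ennreal_plus[symmetric])
      show "0 \<le> (LINT y:Q|lborel. \<bar>w x - w y\<bar>)"
        unfolding set_lebesgue_integral_def by (intro integral_nonneg_AE) auto
    qed (auto intro: ennreal_leI)
    also have "ennreal (LINT y:Q|lborel. \<bar>w x - w y\<bar>) = (\<integral>\<^sup>+y. ennreal (indicator Q y *\<^sub>R \<bar>w x - w y\<bar>) \<partial>lborel)"
      unfolding set_lebesgue_integral_def
      using intd set_integrable_abs[OF intd] by (intro nn_integral_eq_integral[symmetric]) (auto simp: set_integrable_def)
    also have "\<dots> \<le> (\<integral>\<^sup>+y. ennreal \<eta> * indicator Q y + ennreal E * (ennreal (g (x, y)) * indicator (Q \<times> Q) (x, y)) \<partial>lborel)"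
    proof (rule nn_integral_mono)
      fix y
      show "ennreal (indicator Q y *\<^sub>R \<bar>w x - w y\<bar>) \<le> ennreal \<eta> * indicator Q y + ennreal E * (ennreal (g (x, y)) * indicator (Q \<times> Q) (x, y))"
      \<comment> \<open>\<open>oscillation_le\<close> asks for a positive distance; for
        \<open>y = x\<close> the difference on the left vanishes.\<close>
      proof (cases "y \<in> Q \<and> x \<noteq> y")
        case True
        then have "\<bar>w x - w y\<bar> \<le> \<eta> + E * g (x, y)"
          unfolding E_def g_def gagliardo_integrand_def prod.case N_def
          using x sp \<eta> diam by (intro oscillation_le) auto
        then have "ennreal \<bar>w x - w y\<bar> \<le> ennreal \<eta> + ennreal E * ennreal (g (x, y))"
          using E \<eta> by (simp add: ennreal_plus[symmetric] ennreal_mult[symmetric] g_def gagliardo_nonneg ennreal_leI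
              del: ennreal_plus)
        then show ?thesis using True x by simp
      qed auto
    qed
    also have "\<dots> = ennreal \<eta> * ennreal c + ennreal E * (\<integral>\<^sup>+y. ennreal (g (x, y)) * indicator (Q \<times> Q) (x, y) \<partial>lborel)"
      using c by (simp add: nn_integral_add nn_integral_cmult_indicator nn_integral_cmult)
    finally show ?thesis
      using x c \<eta> by (simp add: ennreal_mult ennreal_plus add.assoc)
  qed simp
  have "ennreal c * (\<integral>\<^sup>+x. ennreal \<bar>w x\<bar> * indicator Q x \<partial>lborel) =
      (\<integral>\<^sup>+x. ennreal c * (ennreal \<bar>w x\<bar> * indicator Q x) \<partial>lborel)"
    by (rule nn_integral_cmult[symmetric]) measurable
  also have "\<dots> \<le> (\<integral>\<^sup>+x. ennreal (\<bar>I\<bar> + \<eta> * c) * indicator Q x + ennreal E *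
      (\<integral>\<^sup>+y. ennreal (g (x, y)) * indicator (Q \<times> Q) (x, y) \<partial>lborel) \<partial>lborel)"
    by (rule nn_integral_mono) (rule pt)
  also have "\<dots> = ennreal (\<bar>I\<bar> + \<eta> * c) * ennreal c + ennreal E *
      (\<integral>\<^sup>+x. \<integral>\<^sup>+y. ennreal (g (x, y)) * indicator (Q \<times> Q) (x, y) \<partial>lborel \<partial>lborel)"
    using c by (simp add: nn_integral_add nn_integral_cmult_indicator nn_integral_cmult)
  also have "(\<integral>\<^sup>+x. \<integral>\<^sup>+y. ennreal (g (x, y)) * indicator (Q \<times> Q) (x, y) \<partial>lborel \<partial>lborel)
      = (\<integral>\<^sup>+z. ennreal (g z) * indicator (Q \<times> Q) z \<partial>(lborel \<Otimes>\<^sub>M lborel))"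
    by (rule lborel.nn_integral_fst) measurable
  finally have *: "ennreal c * (\<integral>\<^sup>+x. ennreal \<bar>w x\<bar> * indicator Q x \<partial>lborel) \<le>
      ennreal (\<bar>I\<bar> + \<eta> * c) * ennreal c + ennreal E * (\<integral>\<^sup>+z. ennreal (g z) * indicator (Q \<times> Q) z \<partial>lborel)"
    by (simp add: lborel_prod)
  define X where "X = (\<integral>\<^sup>+x. ennreal \<bar>w x\<bar> * indicator Q x \<partial>lborel)"
  define Y where "Y = (\<integral>\<^sup>+z. ennreal (g z) * indicator (Q \<times> Q) z \<partial>lborel)"
  have cc: "ennreal (1 / c) * ennreal c = 1"
    using c by (simp flip: ennreal_mult)
  have "X = ennreal (1 / c) * (ennreal c * X)"
    by (simp add: cc flip: mult.assoc)
  also have "\<dots> \<le> ennreal (1 / c) * (ennreal (\<bar>I\<bar> + \<eta> * c) * ennreal c + ennreal E * Y)"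
    using * by (intro mult_left_mono) (auto simp: X_def Y_def)
  also have "\<dots> = (ennreal (1 / c) * ennreal c) * ennreal (\<bar>I\<bar> + \<eta> * c) + (ennreal (1 / c) * ennreal E) * Y"
    by (simp add: distrib_left mult_ac)
  also have "ennreal (1 / c) * ennreal E = ennreal (E / c)"
    using c E by (simp flip: ennreal_mult)
  finally show ?thesis by (simp add: cc X_def Y_def I_def E_def N_def g_def)
qed

text \<open>The diagonal blocks of distinct cells are disjoint, so their energies add up to at most
  the full energy. The prefactor \<open>d powr (N + s * p) / c\<close>, with \<open>d\<close> of
  order \<open>1 / k\<close> and \<open>c\<close> the cell volume, reduces to order
  \<open>real k powr (- (s * p))\<close> and is small for fine grids.\<close>

lemma cell_sum_bound:
  fixes w :: "real^'n \<Rightarrow> real"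
  assumes w[measurable]: "w \<in> borel_measurable borel" and int: "integrable lborel w"
    and off: "\<And>x. x \<notin> \<Omega> \<Longrightarrow> w x = 0" and R: "\<And>x. x \<in> \<Omega> \<Longrightarrow> norm x < R"
    and k: "0 < k" and \<eta>: "0 < \<eta>" and sp: "0 < s" "1 \<le> p"
    and F: "F = (\<lambda>x i. \<lfloor>real k * x $ i\<rfloor>) ` \<Omega>" "finite F"
  shows "(\<integral>\<^sup>+x. ennreal \<bar>w x\<bar> \<partial>lborel) \<le>
    ennreal ((\<Sum>z\<in>F. \<bar>LINT x:cell k z|lborel. w x\<bar>) + \<eta> * measure lborel (ball (0::real^'n) (R + real CARD('n)))) +
    ennreal (\<eta> powr (1 - p) * real CARD('n) powr (real CARD('n) + s * p) * real k powr (- (s * p))) *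
      (\<integral>\<^sup>+z. ennreal (gagliardo_integrand s p w z) \<partial>lborel)"
proof -
  define N where "N = real CARD('n)"
  define c where "c = (1 / real k) ^ CARD('n)"
  have c: "0 < c" using k by (simp add: c_def)
  have N: "0 < N" by (simp add: N_def)
  define V where "V = measure lborel (ball (0::real^'n) (R + N))"
  define E where "E = \<eta> powr (1 - p) * (N / real k) powr (N + s * p) / c"
  have E: "0 \<le> E" using c by (simp add: E_def)
  define g where "g = gagliardo_integrand s p w"
  have g[measurable]: "g \<in> borel_measurable (borel \<Otimes>\<^sub>M borel)"
    unfolding g_def borel_prod by (rule gagliardo_measurable) measurable
  define Y where "Y z = (\<integral>\<^sup>+z'. ennreal (g z') * indicator (cell k z \<times> cell k z) z' \<partial>lborel)" for z
  \<comment> \<open>The cells meeting \<Omega> lie in one fixed ball, so their total volume is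
    bounded independently of \<open>k\<close>.\<close>
  have cells: "(\<Sum>z\<in>F. c) \<le> V"
  proof -
    have "(\<Sum>z\<in>F. ennreal c) = (\<Sum>z\<in>F. emeasure lborel (cell k z :: (real^'n) set))"
      using k by (simp add: measure_cell c_def)
    also have "\<dots> = emeasure lborel (\<Union>z\<in>F. cell k z :: (real^'n) set)"
      using F(2) by (intro sum_emeasure) (auto simp: disjoint_family_on_def dest: cell_unique)
    also have "\<dots> \<le> emeasure lborel (ball (0::real^'n) (R + N))"
    proof (rule emeasure_mono)
      show "(\<Union>z\<in>F. cell k z) \<subseteq> ball (0::real^'n) (R + N)"
      proof safe
        fix z x assume "z \<in> F" and x: "x \<in> (cell k z :: (real^'n) set)"
        then obtain y where y: "y \<in> \<Omega>" "y \<in> cell k z"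
          using F(1) cell_index by blast
        have "norm (x - y) \<le> N / real k"
          unfolding N_def by (rule cell_diameter[OF k x y(2)])
        also have "\<dots> \<le> N" using k N by (simp add: field_simps)
        finally show "x \<in> ball 0 (R + N)"
          using norm_triangle_ineq[of "x - y" y] R[OF y(1)] by simp
      qed
    qed simp
    also have "\<dots> = ennreal V"
      unfolding V_def using emeasure_bounded_finite[of "ball (0::real^'n) (R + N)"]
      by (intro emeasure_eq_ennreal_measure) auto
    finally have "ennreal (\<Sum>z\<in>F. c) \<le> ennreal V"
      using c by (subst sum_ennreal[symmetric]) auto
    then show ?thesis by (simp add: V_def)
  qed
  have "(\<integral>\<^sup>+x. ennreal \<bar>w x\<bar> \<partial>lborel) \<le> (\<integral>\<^sup>+x. (\<Sum>z\<in>F. ennreal \<bar>w x\<bar> * indicator (cell k z) x) \<partial>lborel)"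
  proof (rule nn_integral_mono)
    fix x
    show "ennreal \<bar>w x\<bar> \<le> (\<Sum>z\<in>F. ennreal \<bar>w x\<bar> * indicator (cell k z) x)"
    proof (cases "x \<in> \<Omega>")
      case True
      let ?z = "\<lambda>i. \<lfloor>real k * x $ i\<rfloor>"
      have "ennreal \<bar>w x\<bar> = ennreal \<bar>w x\<bar> * indicator (cell k ?z) x"
        by (simp add: cell_index)
      also have "\<dots> \<le> (\<Sum>z\<in>F. ennreal \<bar>w x\<bar> * indicator (cell k z) x)"
        using F True by (intro member_le_sum) auto
      finally show ?thesis .
    qed (simp add: off)
  qed
  also have "\<dots> = (\<Sum>z\<in>F. \<integral>\<^sup>+x. ennreal \<bar>w x\<bar> * indicator (cell k z) x \<partial>lborel)"
    by (rule nn_integral_sum) measurable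
  also have "\<dots> \<le> (\<Sum>z\<in>F. ennreal (\<bar>LINT x:cell k z|lborel. w x\<bar> + \<eta> * c) + ennreal E * Y z)"
  proof (rule sum_mono)
    fix z assume "z \<in> F"
    show "(\<integral>\<^sup>+x. ennreal \<bar>w x\<bar> * indicator (cell k z) x \<partial>lborel) \<le>
        ennreal (\<bar>LINT x:cell k z|lborel. w x\<bar> + \<eta> * c) + ennreal E * Y z"
      unfolding Y_def E_def g_def N_def
      by (rule mean_oscillation_bound[OF w int cell_borel _ c _ \<eta> sp])
        (use k in \<open>auto simp: measure_cell c_def intro: cell_diameter\<close>)
  qed
  also have "\<dots> = ennreal (\<Sum>z\<in>F. \<bar>LINT x:cell k z|lborel. w x\<bar> + \<eta> * c) + ennreal E * (\<Sum>z\<in>F. Y z)"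
    using c \<eta> by (subst sum_ennreal[symmetric]) (auto simp: sum.distrib sum_distrib_left)
  also have "\<dots> \<le> ennreal ((\<Sum>z\<in>F. \<bar>LINT x:cell k z|lborel. w x\<bar>) + \<eta> * V) + ennreal E * (\<integral>\<^sup>+z. ennreal (g z) \<partial>lborel)"
  proof (intro add_mono mult_left_mono ennreal_leI)
    have "(\<Sum>z\<in>F. \<eta> * c) \<le> \<eta> * V"
      using cells \<eta> unfolding sum_distrib_left[symmetric] by (intro mult_left_mono) auto
    then show "(\<Sum>z\<in>F. \<bar>LINT x:cell k z|lborel. w x\<bar> + \<eta> * c) \<le> (\<Sum>z\<in>F. \<bar>LINT x:cell k z|lborel. w x\<bar>) + \<eta> * V"
      by (simp add: sum.distrib)
    have "(\<Sum>z\<in>F. Y z) = (\<integral>\<^sup>+z'. (\<Sum>z\<in>F. ennreal (g z') * indicator (cell k z \<times> cell k z) z') \<partial>lborel)"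
      unfolding Y_def lborel_prod[symmetric] by (rule nn_integral_sum[symmetric]) measurable
    also have "\<dots> \<le> (\<integral>\<^sup>+z. ennreal (g z) \<partial>lborel)"
    proof (rule nn_integral_mono)
      fix z' :: "(real^'n) \<times> (real^'n)"
      define z0 where "z0 = (\<lambda>i. \<lfloor>real k * fst z' $ i\<rfloor>)"
      have "(\<Sum>z\<in>F. ennreal (g z') * indicator (cell k z \<times> cell k z) z')
          \<le> (\<Sum>z\<in>F. if z = z0 then ennreal (g z') else 0)"
      proof (rule sum_mono)
        fix z
        show "ennreal (g z') * indicator (cell k z \<times> cell k z) z' \<le> (if z = z0 then ennreal (g z') else 0)"
        proof (cases "z' \<in> cell k z \<times> cell k z")
          case True
          then have "z = z0"
            using cell_unique[of "fst z'" k z z0] cell_index[of "fst z'" k] by (auto simp: z0_def)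
          then show ?thesis by (simp add: indicator_def)
        qed simp
      qed
      also have "\<dots> \<le> ennreal (g z')" using F(2) by simp
      finally show "(\<Sum>z\<in>F. ennreal (g z') * indicator (cell k z \<times> cell k z) z') \<le> ennreal (g z')" .
    qed
    finally show "(\<Sum>z\<in>F. Y z) \<le> (\<integral>\<^sup>+z. ennreal (g z) \<partial>lborel)" .
  qed simp
  also have "E = \<eta> powr (1 - p) * N powr (N + s * p) * real k powr (- (s * p))"
  proof -
    have "c = real k powr (- N)"
      using k by (simp add: c_def N_def powr_minus powr_realpow power_divide inverse_eq_divide)
    then show ?thesis
      using k N by (simp add: E_def powr_divide powr_add powr_minus field_simps)
  qed
  finally show ?thesis by (simp add: V_def N_def g_def)
qed

text \<open>An Ehrling type inequality: under an energy bound, the \<open>L1\<close> norm is small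
  up to finitely many linear functionals, the integrals over cells. Compactness then only has to
  deal with countably many numbers per function.\<close>

lemma gagliardo_cell_ehrling:
  fixes \<Omega> :: "(real^'n) set"
  assumes \<Omega>: "open \<Omega>" "bounded \<Omega>" and sp: "0 < s" "1 \<le> p" and \<epsilon>: "0 < \<epsilon>" and G: "0 \<le> G"
  obtains k F where "finite F"
    "\<And>w. w \<in> frac_sobolev0 s p \<Omega> \<Longrightarrow> integrable lebesgue w \<Longrightarrow> gagliardo s p w \<le> G \<Longrightarrow>
      (LINT x|lebesgue. \<bar>w x\<bar>) \<le> \<epsilon> + (\<Sum>z\<in>F. \<bar>LINT x:cell k z|lebesgue. w x\<bar>)"
proof -
  define N where "N = real CARD('n)"
  have N: "0 < N" by (simp add: N_def)
  obtain R where R: "\<And>x. x \<in> \<Omega> \<Longrightarrow> norm x < R"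
    using \<Omega>(2) by (metis bounded_pos_less)
  define V where "V = measure lborel (ball (0::real^'n) (R + N))"
  have V: "0 \<le> V" by (simp add: V_def)
  define \<eta> where "\<eta> = \<epsilon> / (2 * (V + 1))"
  have \<eta>: "0 < \<eta>" "\<eta> * V \<le> \<epsilon> / 2"
    using \<epsilon> V by (auto simp: \<eta>_def field_simps)
  \<comment> \<open>\<open>X\<close> is the energy term without its power of \<open>k\<close>,
    measured in units of \<open>\<epsilon> / 2\<close>; the grid is then chosen with
    \<open>X \<le> real k powr (s * p)\<close>. The summand one in \<open>k\<close> keeps it
    positive when \<open>X\<close> is zero.\<close>
  define X where "X = \<eta> powr (1 - p) * N powr (N + s * p) * G * 2 / \<epsilon>"
  have X: "0 \<le> X" using G \<epsilon> by (simp add: X_def)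
  define k where "k = nat \<lceil>X powr (1 / (s * p))\<rceil> + 1"
  have k: "0 < k" by (simp add: k_def)
  have sp': "0 < s * p" using sp by simp
  have "X = (X powr (1 / (s * p))) powr (s * p)"
    using X sp sp' by (simp add: powr_powr)
  also have "\<dots> \<le> real k powr (s * p)"
    using sp' by (intro powr_mono2) (auto simp: k_def, linarith)
  finally have kX: "X * real k powr (- (s * p)) \<le> 1"
    using k by (simp add: powr_minus field_simps)
  define F where "F = (\<lambda>x i. \<lfloor>real k * x $ i\<rfloor>) ` \<Omega>"
  have F: "finite F" unfolding F_def using \<Omega>(2) by (rule finite_cell_indices)
  show ?thesis
  proof (rule that[OF F, of k])
    fix w :: "real^'n \<Rightarrow> real"
    assume w: "w \<in> frac_sobolev0 s p \<Omega>" and int: "integrable lebesgue w" and wG: "gagliardo s p w \<le> G"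
    obtain v where v: "v \<in> borel_measurable borel" "\<And>x. x \<notin> \<Omega> \<Longrightarrow> v x = 0"
      "AE x in lebesgue. w x = v x"
      "(\<integral>\<^sup>+z. gagliardo_integrand s p v z \<partial>lborel) = ennreal (gagliardo s p w)"
      using frac_sobolev0_representative[OF w borel_open[OF \<Omega>(1)]] by blast
    have vm[measurable]: "v \<in> borel_measurable lborel" using v(1) by simp
    have vl: "v \<in> borel_measurable lebesgue" by (rule measurable_completion) simp
    have iv: "integrable lebesgue v"
      using int by (rule integrable_cong_AE_imp) (use v(3) vl in \<open>auto elim: eventually_mono\<close>)
    then have ivb: "integrable lborel v"
      by (simp add: integrable_completion)
    have cellint: "(LINT x:cell k z|lborel. v x) = (LINT x:cell k z|lebesgue. w x)" for z
    proof -
      have "(LINT x:cell k z|lborel. v x) = (LINT x:cell k z|lebesgue. v x)"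
        unfolding set_lebesgue_integral_def by (rule integral_completion[symmetric]) measurable
      also have "\<dots> = (LINT x:cell k z|lebesgue. w x)"
        unfolding set_lebesgue_integral_def
      proof (rule integral_cong_AE)
        show "(\<lambda>x. indicator (cell k z) x *\<^sub>R v x) \<in> borel_measurable lebesgue"
          by (rule measurable_completion) measurable
        show "(\<lambda>x. indicator (cell k z) x *\<^sub>R w x) \<in> borel_measurable lebesgue"
          using int by (intro borel_measurable_scaleR borel_measurable_indicator) auto
        show "AE x in lebesgue. indicator (cell k z) x *\<^sub>R v x = indicator (cell k z) x *\<^sub>R w x"
          using v(3) by eventually_elim simp
      qed
      finally show ?thesis .
    qed
    have "ennreal (LINT x|lebesgue. \<bar>w x\<bar>) = (\<integral>\<^sup>+x. ennreal \<bar>w x\<bar> \<partial>lebesgue)"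
      using int by (intro nn_integral_eq_integral[symmetric]) auto
    also have "\<dots> = (\<integral>\<^sup>+x. ennreal \<bar>v x\<bar> \<partial>lebesgue)"
      using v(3) by (intro nn_integral_cong_AE) (auto elim: eventually_mono)
    also have "\<dots> = (\<integral>\<^sup>+x. ennreal \<bar>v x\<bar> \<partial>lborel)"
      by (rule nn_integral_completion)
    also have "\<dots> \<le> ennreal ((\<Sum>z\<in>F. \<bar>LINT x:cell k z|lborel. v x\<bar>) + \<eta> * V) +
        ennreal (\<eta> powr (1 - p) * N powr (N + s * p) * real k powr (- (s * p))) * ennreal (gagliardo s p w)"
      using cell_sum_bound[OF v(1) ivb v(2) R k \<eta>(1) sp F_def F] unfolding v(4) N_def V_def by simp
    also have "\<dots> = ennreal ((\<Sum>z\<in>F. \<bar>LINT x:cell k z|lborel. v x\<bar>) + \<eta> * V +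
        \<eta> powr (1 - p) * N powr (N + s * p) * real k powr (- (s * p)) * gagliardo s p w)"
      using \<eta> V gagliardo_ge_0[of s p w]
      by (simp add: ennreal_plus[symmetric] ennreal_mult[symmetric] sum_nonneg add_nonneg_nonneg del: ennreal_plus)
    finally have "(LINT x|lebesgue. \<bar>w x\<bar>) \<le> (\<Sum>z\<in>F. \<bar>LINT x:cell k z|lborel. v x\<bar>) + \<eta> * V +
        \<eta> powr (1 - p) * N powr (N + s * p) * real k powr (- (s * p)) * gagliardo s p w"
      using \<eta> V gagliardo_ge_0[of s p w]
      by (subst (asm) ennreal_le_iff) (auto intro!: add_nonneg_nonneg sum_nonneg)
    also have "\<eta> powr (1 - p) * N powr (N + s * p) * real k powr (- (s * p)) * gagliardo s p w
        \<le> \<eta> powr (1 - p) * N powr (N + s * p) * real k powr (- (s * p)) * G"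
      using wG by (intro mult_left_mono) auto
    also have "\<dots> = X * real k powr (- (s * p)) * (\<epsilon> / 2)"
      using \<epsilon> by (simp add: X_def)
    also have "\<dots> \<le> 1 * (\<epsilon> / 2)"
      using kX \<epsilon> by (intro mult_right_mono) auto
    finally show "(LINT x|lebesgue. \<bar>w x\<bar>) \<le> \<epsilon> + (\<Sum>z\<in>F. \<bar>LINT x:cell k z|lebesgue. w x\<bar>)"
      using \<eta>(2) by (simp add: cellint)
  qed
qed

section \<open>Compactness of the fractional Sobolev space\<close>

text \<open>The singular kernel split off from the integrand, so that the energy becomes a weighted
  modular of \<open>pair_diff u\<close>.\<close>

definition gagliardo_weight :: "real \<Rightarrow> real \<Rightarrow> (real^'n) \<times> (real^'n) \<Rightarrow> real" where
  "gagliardo_weight s p z = 1 / norm (fst z - snd z) powr (real CARD('n) + s * p)"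

definition pair_diff :: "('a \<Rightarrow> real) \<Rightarrow> 'a \<times> 'a \<Rightarrow> real" where
  "pair_diff u z = u (fst z) - u (snd z)"

lemma pair_diff_simps:
  "pair_diff (\<lambda>x. u x + v x) = (\<lambda>z. pair_diff u z + pair_diff v z)"
  "pair_diff (\<lambda>x. c * u x) = (\<lambda>z. c * pair_diff u z)"
  by (auto simp: pair_diff_def fun_eq_iff algebra_simps)

lemma gagliardo_integrand_eq:
  "gagliardo_integrand s p u = (\<lambda>z. \<bar>pair_diff u z\<bar> powr p * gagliardo_weight s p z)"
  by (auto simp: gagliardo_integrand_def gagliardo_weight_def pair_diff_def fun_eq_iff)

lemma gagliardo_weight_nonneg: "0 \<le> gagliardo_weight s p z"
  by (simp add: gagliardo_weight_def)

lemma gagliardo_weight_measurable: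
  "gagliardo_weight s p \<in> borel_measurable (lebesgue :: ((real^'n) \<times> (real^'n)) measure)"
proof -
  have "gagliardo_weight s p \<in> borel_measurable (borel \<Otimes>\<^sub>M borel :: ((real^'n) \<times> (real^'n)) measure)"
    unfolding gagliardo_weight_def by measurable
  then show ?thesis
    by (intro measurable_completion) (simp add: borel_prod)
qed

lemma frac_sobolev0_iff:
  "u \<in> frac_sobolev0 s p \<Omega> \<longleftrightarrow> u \<in> borel_measurable lebesgue \<and> u \<in> weighted_Lp p lebesgue (\<lambda>_. 1) \<and>
    pair_diff u \<in> weighted_Lp p lebesgue (gagliardo_weight s p) \<and>
    (AE x in lebesgue. x \<notin> \<Omega> \<longrightarrow> u x = 0)"
  using borel_measurable_pair_diff[of u]
  by (auto simp: frac_sobolev0_def frac_sobolev_def weighted_Lp_def gagliardo_integrand_eq pair_diff_def[abs_def])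

lemma gagliardo_eq_modular: "gagliardo s p u = weighted_modular p lebesgue (gagliardo_weight s p) (pair_diff u)"
  by (simp add: gagliardo_def weighted_modular_def gagliardo_integrand_eq)

lemma weighted_power_growth_gagliardo:
  assumes "1 < p"
  shows "weighted_power_growth p (min p 2) (2 * p * p) (\<lambda>t. \<bar>t\<bar> powr p) (\<lambda>t. p * (\<bar>t\<bar> powr (p - 2) * t))
    lebesgue (gagliardo_weight s p) (gagliardo_weight s p) 1"
  using power_growth_abs_powr[OF assms] gagliardo_weight_measurable
  by (auto simp: weighted_power_growth_def weighted_power_growth_axioms_def gagliardo_weight_nonneg)

lemma weighted_power_growth_lebesgue:
  assumes "1 < q" "k \<in> borel_measurable lebesgue" "0 \<le> c" "AE x in lebesgue. \<bar>k x\<bar> \<le> c"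
  shows "weighted_power_growth q (min q 2) (2 * q * q) (\<lambda>t. \<bar>t\<bar> powr q) (\<lambda>t. q * (\<bar>t\<bar> powr (q - 2) * t))
    lebesgue k (\<lambda>_. 1) c"
  using power_growth_abs_powr[OF assms(1)] assms(2-)
  by (auto simp: weighted_power_growth_def weighted_power_growth_axioms_def)

lemma frac_sobolev0_scale:
  assumes "1 < p" and u: "u \<in> frac_sobolev0 s p \<Omega>"
  shows "(\<lambda>x. c * u x) \<in> frac_sobolev0 s p \<Omega>"
    "gagliardo s p (\<lambda>x. c * u x) = \<bar>c\<bar> powr p * gagliardo s p u"
proof -
  interpret G: weighted_power_growth p "min p 2" "2 * p * p" "\<lambda>t. \<bar>t\<bar> powr p" "\<lambda>t. p * (\<bar>t\<bar> powr (p - 2) * t)"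
    lebesgue "gagliardo_weight s p" "gagliardo_weight s p" 1
    using assms(1) by (rule weighted_power_growth_gagliardo)
  interpret L: weighted_power_growth p "min p 2" "2 * p * p" "\<lambda>t. \<bar>t\<bar> powr p" "\<lambda>t. p * (\<bar>t\<bar> powr (p - 2) * t)"
    lebesgue "\<lambda>_. 1" "\<lambda>_. 1" 1
    using assms(1) by (intro weighted_power_growth_lebesgue) auto
  show "(\<lambda>x. c * u x) \<in> frac_sobolev0 s p \<Omega>"
    using u L.mod_space_scale(1)[of u c] G.mod_space_scale(1)[of "pair_diff u" c]
    by (auto simp: frac_sobolev0_iff pair_diff_simps)
  show "gagliardo s p (\<lambda>x. c * u x) = \<bar>c\<bar> powr p * gagliardo s p u"
    using u G.mod_space_scale(2)[of "pair_diff u" c]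
    by (auto simp: frac_sobolev0_iff gagliardo_eq_modular pair_diff_simps)
qed

lemma frac_sobolev0_add:
  assumes "1 < p" and u: "u \<in> frac_sobolev0 s p \<Omega>" and v: "v \<in> frac_sobolev0 s p \<Omega>"
  shows "(\<lambda>x. u x + v x) \<in> frac_sobolev0 s p \<Omega>"
    "gagliardo s p (\<lambda>x. u x + v x) \<le> 2 powr p * (gagliardo s p u + gagliardo s p v)"
proof -
  interpret G: weighted_power_growth p "min p 2" "2 * p * p" "\<lambda>t. \<bar>t\<bar> powr p" "\<lambda>t. p * (\<bar>t\<bar> powr (p - 2) * t)"
    lebesgue "gagliardo_weight s p" "gagliardo_weight s p" 1
    using assms(1) by (rule weighted_power_growth_gagliardo)
  interpret L: weighted_power_growth p "min p 2" "2 * p * p" "\<lambda>t. \<bar>t\<bar> powr p" "\<lambda>t. p * (\<bar>t\<bar> powr (p - 2) * t)"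
    lebesgue "\<lambda>_. 1" "\<lambda>_. 1" 1
    using assms(1) by (intro weighted_power_growth_lebesgue) auto
  have "AE x in lebesgue. x \<notin> \<Omega> \<longrightarrow> u x + v x = 0"
    using u v unfolding frac_sobolev0_iff by (auto elim: eventually_elim2)
  then show "(\<lambda>x. u x + v x) \<in> frac_sobolev0 s p \<Omega>"
    using u v L.mod_space_add(1)[of u v] G.mod_space_add(1)[of "pair_diff u" "pair_diff v"]
    by (auto simp: frac_sobolev0_iff pair_diff_simps)
  show "gagliardo s p (\<lambda>x. u x + v x) \<le> 2 powr p * (gagliardo s p u + gagliardo s p v)"
    using u v G.mod_space_add(2)[of "pair_diff u" "pair_diff v"]
    by (auto simp: frac_sobolev0_iff gagliardo_eq_modular pair_diff_simps)
qed

text \<open>Fatou's lemma for Bochner integrals with a convergent sequence of upper bounds. The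
  moving bounds are meant for the minimising sequence, where the bound on the principal part
  contains the lower order terms.\<close>

lemma fatou_integral_le:
  fixes f :: "nat \<Rightarrow> 'a \<Rightarrow> real"
  assumes f: "\<And>n. integrable M (f n)" and nn: "\<And>n. AE x in M. 0 \<le> f n x"
    and lim: "AE x in M. (\<lambda>n. f n x) \<longlonglongrightarrow> g x" and g[measurable]: "g \<in> borel_measurable M"
    and le: "\<And>n. (LINT x|M. f n x) \<le> b n" and b: "b \<longlonglongrightarrow> B"
  shows "integrable M g" "(LINT x|M. g x) \<le> B"
proof -
  have nn': "AE x in M. \<forall>n. 0 \<le> f n x" using nn by (simp add: AE_all_countable)
  have g0: "AE x in M. 0 \<le> g x"
    using nn' lim by eventually_elim (auto intro: LIMSEQ_le_const)
  have b0: "0 \<le> b n" for n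
    using integral_nonneg_AE[OF nn[of n]] le[of n] by linarith
  have B0: "0 \<le> B" using b b0 by (auto intro: LIMSEQ_le_const)
  have "(\<integral>\<^sup>+x. ennreal (g x) \<partial>M) = (\<integral>\<^sup>+x. liminf (\<lambda>n. ennreal (f n x)) \<partial>M)"
  proof (rule nn_integral_cong_AE)
    show "AE x in M. ennreal (g x) = liminf (\<lambda>n. ennreal (f n x))"
      using lim
    proof eventually_elim
      case (elim x)
      have "liminf (\<lambda>n. ennreal (f n x)) = ennreal (g x)"
        by (intro lim_imp_Liminf tendsto_ennrealI elim) simp
      then show ?case by simp
    qed
  qed
  also have "\<dots> \<le> liminf (\<lambda>n. \<integral>\<^sup>+x. ennreal (f n x) \<partial>M)"
    using f by (intro nn_integral_liminf) auto
  also have "\<dots> \<le> liminf (\<lambda>n. ennreal (b n))"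
  proof (intro Liminf_mono always_eventually allI)
    fix n
    have "(\<integral>\<^sup>+x. ennreal (f n x) \<partial>M) = ennreal (LINT x|M. f n x)"
      by (rule nn_integral_eq_integral[OF f nn])
    also have "\<dots> \<le> ennreal (b n)" by (rule ennreal_leI[OF le])
    finally show "(\<integral>\<^sup>+x. ennreal (f n x) \<partial>M) \<le> ennreal (b n)" .
  qed
  also have "\<dots> = ennreal B"
    by (intro lim_imp_Liminf tendsto_ennrealI b) simp
  finally have *: "(\<integral>\<^sup>+x. ennreal (g x) \<partial>M) \<le> ennreal B" .
  show i: "integrable M g"
    by (rule integrableI_nonneg[OF g g0]) (use * in \<open>auto intro: le_less_trans\<close>)
  have "ennreal (LINT x|M. g x) \<le> ennreal B"
    using * by (simp add: nn_integral_eq_integral[OF i g0])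
  then show "(LINT x|M. g x) \<le> B" using B0 by (simp add: ennreal_le_iff)
qed

lemma AE_tendsto_pair_diff:
  fixes u :: "nat \<Rightarrow> 'a::euclidean_space \<Rightarrow> real"
  assumes "AE x in lebesgue. (\<lambda>n. u n x) \<longlonglongrightarrow> v x"
  shows "AE z in lebesgue. (\<lambda>n. pair_diff (u n) z) \<longlonglongrightarrow> pair_diff v z"
  using AE_lebesgue_pair[OF assms] by eventually_elim (auto simp: pair_diff_def intro: tendsto_diff)

lemma frac_sobolev0_closed_AE:
  fixes u :: "nat \<Rightarrow> real^'n \<Rightarrow> real"
  assumes p: "0 < p" and u: "\<And>n. u n \<in> frac_sobolev0 s p \<Omega>"
    and lim: "AE x in lebesgue. (\<lambda>n. u n x) \<longlonglongrightarrow> v x" and v: "v \<in> borel_measurable lebesgue"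
    and T: "\<And>n. gagliardo s p (u n) \<le> T" and Lp: "\<And>n. (LINT x|lebesgue. \<bar>u n x\<bar> powr p) \<le> L"
  shows "v \<in> frac_sobolev0 s p \<Omega>" "gagliardo s p v \<le> T"
proof -
  have u': "integrable lebesgue (\<lambda>x. \<bar>u n x\<bar> powr p)" "integrable lebesgue (gagliardo_integrand s p (u n))"
    "AE x in lebesgue. x \<notin> \<Omega> \<longrightarrow> u n x = 0" for n
    using u[of n] by (auto simp: frac_sobolev0_def frac_sobolev_def)
  have Lpv: "integrable lebesgue (\<lambda>x. \<bar>v x\<bar> powr p)"
  proof (rule fatou_integral_le(1)[where f = "\<lambda>n x. \<bar>u n x\<bar> powr p" and b = "\<lambda>_. L" and B = L])
    show "AE x in lebesgue. (\<lambda>n. \<bar>u n x\<bar> powr p) \<longlonglongrightarrow> \<bar>v x\<bar> powr p"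
      using lim by eventually_elim (use p in \<open>auto intro!: tendsto_intros\<close>)
    show "(\<lambda>x. \<bar>v x\<bar> powr p) \<in> borel_measurable lebesgue" using v by measurable
  qed (use u' Lp in auto)
  have dm: "pair_diff v \<in> borel_measurable lebesgue"
    unfolding pair_diff_def[abs_def] by (rule borel_measurable_pair_diff[OF v])
  have lim2: "AE z in lebesgue. (\<lambda>n. gagliardo_integrand s p (u n) z) \<longlonglongrightarrow> gagliardo_integrand s p v z"
    using AE_tendsto_pair_diff[OF lim] unfolding gagliardo_integrand_eq
    by eventually_elim (use p in \<open>auto intro!: tendsto_intros\<close>)
  have gm: "gagliardo_integrand s p v \<in> borel_measurable lebesgue"
    unfolding gagliardo_integrand_eq using dm gagliardo_weight_measurable by measurable
  note F = fatou_integral_le[where f = "\<lambda>n. gagliardo_integrand s p (u n)" and b = "\<lambda>_. T", OF u'(2) _ lim2 gm]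
  have gv: "integrable lebesgue (gagliardo_integrand s p v)"
    by (rule F) (use T in \<open>auto simp: gagliardo_nonneg gagliardo_def\<close>)
  show "gagliardo s p v \<le> T"
    unfolding gagliardo_def by (rule F) (use T in \<open>auto simp: gagliardo_nonneg gagliardo_def\<close>)
  have "AE x in lebesgue. \<forall>n. x \<notin> \<Omega> \<longrightarrow> u n x = 0"
    by (subst AE_all_countable) (use u'(3) in blast)
  then have "AE x in lebesgue. x \<notin> \<Omega> \<longrightarrow> v x = 0"
    using lim by eventually_elim (auto simp: LIMSEQ_const_iff)
  then show "v \<in> frac_sobolev0 s p \<Omega>"
    using v Lpv gv by (simp add: frac_sobolev0_def frac_sobolev_def)
qed

text \<open>The integrals over cells are bounded and countable in number, so a diagonal subsequence
  makes all of them converge. The Ehrling inequality turns this into a Cauchy sequence in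
  \<open>L1\<close>, a further subsequence converges almost everywhere, and Fatou's lemma keeps the
  limit in the space.\<close>

theorem frac_sobolev0_compact:
  fixes \<Omega> :: "(real^'n) set" and u :: "nat \<Rightarrow> real^'n \<Rightarrow> real"
  assumes \<Omega>: "open \<Omega>" "bounded \<Omega>" and sp: "0 < s" "1 < p" "s * p < real CARD('n)"
    and u: "\<And>n. u n \<in> frac_sobolev0 s p \<Omega>" and T: "\<And>n. gagliardo s p (u n) \<le> T"
  obtains r :: "nat \<Rightarrow> nat" and v where "strict_mono r" "v \<in> frac_sobolev0 s p \<Omega>" "gagliardo s p v \<le> T"
    "AE x in lebesgue. (\<lambda>n. u (r n) x) \<longlonglongrightarrow> v x"
proof -
  define N where "N = real CARD('n)"
  have N: "0 < N" by (simp add: N_def)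
  have T0: "0 \<le> T" using T[of 0] gagliardo_ge_0[of s p "u 0"] by linarith
  \<comment> \<open>The summand one keeps the scale positive when \<open>T\<close> is zero.\<close>
  define t where "t = (T + 1) powr (1 / p)"
  have t: "0 < t" using T0 by (simp add: t_def)
  have tp: "t powr p = T + 1" using T0 sp by (simp add: t_def powr_powr)
  have ps: "p < N * p / (N - s * p)"
    using sp N by (simp add: N_def field_simps)
  have p0: "0 < p" and ps1: "1 < N * p / (N - s * p)" using sp(2) ps by auto
  obtain C1 where "0 \<le> C1" and C1: "\<And>u t. u \<in> frac_sobolev0 s p \<Omega> \<Longrightarrow> 0 < t \<Longrightarrow> gagliardo s p u \<le> t powr p \<Longrightarrow>
      integrable lebesgue (\<lambda>x. \<bar>u x\<bar> powr 1) \<and> (LINT x|lebesgue. \<bar>u x\<bar> powr 1) \<le> C1 * t powr 1"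
    by (rule fractional_sobolev_subcritical[OF \<Omega> sp(1) p0 sp(3) zero_less_one ps1[unfolded N_def]]) (rule that)
  obtain C2 where "0 \<le> C2" and C2: "\<And>u t. u \<in> frac_sobolev0 s p \<Omega> \<Longrightarrow> 0 < t \<Longrightarrow> gagliardo s p u \<le> t powr p \<Longrightarrow>
      integrable lebesgue (\<lambda>x. \<bar>u x\<bar> powr p) \<and> (LINT x|lebesgue. \<bar>u x\<bar> powr p) \<le> C2 * t powr p"
    by (rule fractional_sobolev_subcritical[OF \<Omega> sp(1) p0 sp(3) p0 ps[unfolded N_def]]) (rule that)
  have Tt: "gagliardo s p (u n) \<le> t powr p" for n using T[of n] tp by simp
  have um: "u n \<in> borel_measurable lebesgue" for n using u[of n] by (simp add: frac_sobolev0_iff)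
  have u1: "integrable lebesgue (u n)" "(LINT x|lebesgue. \<bar>u n x\<bar>) \<le> C1 * t" for n
    using C1[OF u t Tt, of n] um[of n] t by (auto simp: integrable_abs_iff)
  have u2: "(LINT x|lebesgue. \<bar>u n x\<bar> powr p) \<le> C2 * t powr p" for n
    using C2[OF u t Tt, of n] by simp
  define I where "I n kz = (LINT x:cell (fst kz) (snd kz)|lebesgue. u n x)" for n and kz :: "nat \<times> ('n \<Rightarrow> int)"
  have setint: "set_integrable lebesgue (cell k z) (u n)" for n k and z :: "'n \<Rightarrow> int"
    unfolding set_integrable_def using u1(1) by (intro integrable_mult_indicator) auto
  have Ibound: "norm (I n kz) \<le> C1 * t" for n kz
  proof -
    let ?S = "cell (fst kz) (snd kz)"
    have "norm (I n kz) \<le> (LINT x|lebesgue. norm (indicator ?S x *\<^sub>R u n x))"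
      unfolding I_def set_lebesgue_integral_def by (rule integral_norm_bound)
    also have "\<dots> \<le> (LINT x|lebesgue. \<bar>u n x\<bar>)"
      using setint[of "fst kz" "snd kz" n] u1(1)[of n]
      by (intro integral_mono) (auto simp: set_integrable_def indicator_def)
    finally show ?thesis using u1(2)[of n] by simp
  qed
  obtain r1 where r1: "strict_mono r1" and conv: "\<And>kz. \<exists>l. (\<lambda>n. I (r1 n) kz) \<longlonglongrightarrow> l"
    using function_convergent_subsequence[of UNIV I "C1 * t"] Ibound
    by (metis UNIV_I countableI_type)
  have cauchy: "\<exists>M. \<forall>i\<ge>M. \<forall>j\<ge>M. (LINT x|lebesgue. norm (u (r1 i) x - u (r1 j) x)) < e" if e: "e > 0" for e
  proof -
    obtain k F where F: "finite F" and ehr: "\<And>w. w \<in> frac_sobolev0 s p \<Omega> \<Longrightarrow> integrable lebesgue w \<Longrightarrow>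
        gagliardo s p w \<le> 2 powr p * (T + T) \<Longrightarrow>
        (LINT x|lebesgue. \<bar>w x\<bar>) \<le> e / 2 + (\<Sum>z\<in>F. \<bar>LINT x:cell k z|lebesgue. w x\<bar>)"
      using gagliardo_cell_ehrling[OF \<Omega> sp(1), of p "e / 2" "2 powr p * (T + T)"] sp e T0
      by (metis half_gt_zero less_imp_le add_nonneg_nonneg mult_nonneg_nonneg powr_ge_zero)
    \<comment> \<open>The sum over \<open>F\<close> must stay below \<open>e / 2\<close>; the
      summand one covers an empty \<open>F\<close> and makes the inequality strict.\<close>
    define e' where "e' = e / (2 * (real (card F) + 1))"
    have e': "0 < e'" using e by (simp add: e'_def add_nonneg_pos)
    have "\<forall>z\<in>F. \<exists>M. \<forall>i\<ge>M. \<forall>j\<ge>M. \<bar>I (r1 i) (k, z) - I (r1 j) (k, z)\<bar> < e'"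
    proof
      fix z
      have "Cauchy (\<lambda>n. I (r1 n) (k, z))" using conv[of "(k, z)"] LIMSEQ_imp_Cauchy by blast
      then show "\<exists>M. \<forall>i\<ge>M. \<forall>j\<ge>M. \<bar>I (r1 i) (k, z) - I (r1 j) (k, z)\<bar> < e'"
        using e' unfolding Cauchy_def dist_real_def by blast
    qed
    then obtain Mz where Mz: "\<And>z i j. z \<in> F \<Longrightarrow> i \<ge> Mz z \<Longrightarrow> j \<ge> Mz z \<Longrightarrow> \<bar>I (r1 i) (k, z) - I (r1 j) (k, z)\<bar> < e'"
      by metis
    define M where "M = (\<Sum>z\<in>F. Mz z)"
    have MM: "Mz z \<le> M" if "z \<in> F" for z
      unfolding M_def using F that by (intro member_le_sum) auto
    show ?thesis
    proof (intro exI[of _ M] allI impI)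
      fix i j assume ij: "M \<le> i" "M \<le> j"
      define w where "w = (\<lambda>x. u (r1 i) x + (- 1) * u (r1 j) x)"
      have wW: "w \<in> frac_sobolev0 s p \<Omega>"
        unfolding w_def using sp u by (intro frac_sobolev0_add frac_sobolev0_scale) auto
      have "gagliardo s p w \<le> 2 powr p * (gagliardo s p (u (r1 i)) + gagliardo s p (\<lambda>x. (- 1) * u (r1 j) x))"
        unfolding w_def using sp u by (intro frac_sobolev0_add frac_sobolev0_scale) auto
      also have "\<dots> \<le> 2 powr p * (T + T)"
        using T[of "r1 i"] T[of "r1 j"] sp u by (subst frac_sobolev0_scale(2)) (auto intro!: mult_left_mono)
      finally have wG: "gagliardo s p w \<le> 2 powr p * (T + T)" .
      have wi: "integrable lebesgue w" unfolding w_def using u1 by auto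
      have "(LINT x|lebesgue. \<bar>w x\<bar>) \<le> e / 2 + (\<Sum>z\<in>F. \<bar>LINT x:cell k z|lebesgue. w x\<bar>)"
        by (rule ehr[OF wW wi wG])
      also have "(\<Sum>z\<in>F. \<bar>LINT x:cell k z|lebesgue. w x\<bar>) \<le> (\<Sum>z\<in>F. e')"
      proof (rule sum_mono)
        fix z assume z: "z \<in> F"
        have "(LINT x:cell k z|lebesgue. w x) = I (r1 i) (k, z) - I (r1 j) (k, z)"
          using set_integral_diff(2)[OF setint setint, of k z "r1 i" "r1 j"] by (simp add: w_def I_def)
        then show "\<bar>LINT x:cell k z|lebesgue. w x\<bar> \<le> e'"
          using Mz[OF z, of i j] MM[OF z] ij by simp
      qed
      also have "(\<Sum>z\<in>F. e') < e / 2"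
        using e by (simp add: e'_def field_simps)
      finally show "(LINT x|lebesgue. norm (u (r1 i) x - u (r1 j) x)) < e"
        by (simp add: w_def)
    qed
  qed
  obtain r2 where r2: "strict_mono r2" and AEC: "AE x in lebesgue. Cauchy (\<lambda>i. u (r1 (r2 i)) x)"
    using cauchy_L1_AE_cauchy_subseq[of lebesgue "\<lambda>n. u (r1 n)"] u1(1) cauchy by blast
  define v where "v x = lim (\<lambda>n. u (r1 (r2 n)) x)" for x
  have v: "v \<in> borel_measurable lebesgue"
    unfolding v_def[abs_def] using um by (intro borel_measurable_lim_metric) auto
  have lim: "AE x in lebesgue. (\<lambda>n. u (r1 (r2 n)) x) \<longlonglongrightarrow> v x"
    using AEC by eventually_elim (simp add: v_def Cauchy_convergent_iff convergent_LIMSEQ_iff)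
  show ?thesis
  proof (rule that[of "r1 \<circ> r2" v])
    show "strict_mono (r1 \<circ> r2)" using r1 r2 by (rule strict_mono_o)
    show "v \<in> frac_sobolev0 s p \<Omega>" "gagliardo s p v \<le> T"
      using frac_sobolev0_closed_AE[where u = "\<lambda>n. u (r1 (r2 n))", OF _ u lim v T u2] sp by auto
    show "AE x in lebesgue. (\<lambda>n. u ((r1 \<circ> r2) n) x) \<longlonglongrightarrow> v x" using lim by simp
  qed
qed

section \<open>Lower order terms and test functions\<close>

text \<open>Above the level \<open>T\<close> the factor \<open>\<bar>t\<bar> powr (q - q')\<close>
  is at most \<open>T powr (q - q')\<close>, as the exponent is negative: the Chebyshev estimate
  behind uniform integrability.\<close>

lemma truncation_error:
  fixes t T q q' :: real
  assumes q: "0 < q" "q < q'" and T: "0 < T"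
  shows "\<bar>\<bar>t\<bar> powr q - min (\<bar>t\<bar> powr q) (T powr q)\<bar> \<le> T powr (q - q') * \<bar>t\<bar> powr q'"
proof (cases "\<bar>t\<bar> \<le> T")
  case True
  then have "\<bar>t\<bar> powr q \<le> T powr q" using q by (intro powr_mono2) auto
  then show ?thesis by (simp add: min_def)
next
  case False
  have "\<bar>\<bar>t\<bar> powr q - min (\<bar>t\<bar> powr q) (T powr q)\<bar> \<le> \<bar>t\<bar> powr q"
    by (simp add: min_def)
  also have "\<dots> = \<bar>t\<bar> powr (q - q') * \<bar>t\<bar> powr q'"
    using False T by (simp flip: powr_add)
  also have "\<dots> \<le> T powr (q - q') * \<bar>t\<bar> powr q'"
    using False T q by (intro mult_right_mono powr_mono2') auto
  finally show ?thesis .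
qed

text \<open>The bound on a higher moment makes the powers uniformly integrable, so that almost
  everywhere convergence suffices.\<close>

lemma tendsto_integral_powr:
  fixes u :: "nat \<Rightarrow> 'a \<Rightarrow> real"
  assumes k[measurable]: "k \<in> borel_measurable M" and c: "0 \<le> c" "AE x in M. \<bar>k x\<bar> \<le> c"
    and S: "S \<in> sets M" "emeasure M S < \<infinity>" "\<And>x. x \<notin> S \<Longrightarrow> k x = 0"
    and u[measurable]: "\<And>n. u n \<in> borel_measurable M" and v[measurable]: "v \<in> borel_measurable M"
    and lim: "AE x in M. (\<lambda>n. u n x) \<longlonglongrightarrow> v x"
    and q: "0 < q" "q < q'"
    and uq: "\<And>n. integrable M (\<lambda>x. \<bar>u n x\<bar> powr q)" and vq: "integrable M (\<lambda>x. \<bar>v x\<bar> powr q)"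
    and uL: "\<And>n. integrable M (\<lambda>x. \<bar>u n x\<bar> powr q')" "\<And>n. (LINT x|M. \<bar>u n x\<bar> powr q') \<le> L"
    and vL: "integrable M (\<lambda>x. \<bar>v x\<bar> powr q')" "(LINT x|M. \<bar>v x\<bar> powr q') \<le> L"
  shows "(\<lambda>n. LINT x|M. \<bar>u n x\<bar> powr q * k x) \<longlonglongrightarrow> (LINT x|M. \<bar>v x\<bar> powr q * k x)"
proof (rule LIMSEQ_I)
  fix e :: real assume e: "0 < e"
  have "0 \<le> (LINT x|M. \<bar>v x\<bar> powr q')" by (intro integral_nonneg_AE) auto
  then have L: "0 \<le> L" using vL(2) by linarith
  \<comment> \<open>The level solves \<open>T powr (q - q') * (c * L + 1) = e / 3\<close>, so the
    truncation error \<open>c * (T powr (q - q') * L)\<close> is strictly below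
    \<open>e / 3\<close>, also when \<open>c * L\<close> is zero.\<close>
  define T where "T = (e / (3 * (c * L + 1))) powr (1 / (q - q'))"
  have cL: "0 < c * L + 1" using c L by (simp add: add_nonneg_pos)
  have T: "0 < T" using e cL by (simp add: T_def)
  have "T powr (q - q') = e / (3 * (c * L + 1))"
    using e cL q by (simp add: T_def powr_powr)
  then have "3 * (c * (T powr (q - q') * L)) = e - 3 * T powr (q - q')"
    using cL by (simp add: field_simps)
  moreover have "0 < T powr (q - q')" using T by simp
  ultimately have err: "c * (T powr (q - q') * L) < e / 3" by linarith
  define \<phi> where "\<phi> t = min (\<bar>t\<bar> powr q) (T powr q)" for t :: real
  have [measurable]: "\<phi> \<in> borel_measurable borel" unfolding \<phi>_def[abs_def] by measurable
  have kint: "integrable M (\<lambda>x. f x * k x)" if "integrable M f" for f :: "'a \<Rightarrow> real"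
  proof (rule Bochner_Integration.integrable_bound)
    have [measurable]: "f \<in> borel_measurable M" using that by auto
    show "integrable M (\<lambda>x. c * f x)" using that by simp
    show "(\<lambda>x. f x * k x) \<in> borel_measurable M" by measurable
    show "AE x in M. norm (f x * k x) \<le> norm (c * f x)"
      using c(2)
    proof eventually_elim
      case (elim x)
      then show ?case using c(1) mult_right_mono[of "\<bar>k x\<bar>" c "\<bar>f x\<bar>"] by (simp add: abs_mult mult.commute)
    qed
  qed
  let ?g = "\<lambda>x. c * T powr q * indicator S x"
  have g: "integrable M ?g" using S by (auto simp: integrable_mult_right_iff)
  have \<phi>k: "AE x in M. norm (\<phi> (f x) * k x) \<le> ?g x" for f :: "'a \<Rightarrow> real"
    using c(2)
  proof eventually_elim
    case (elim x)
    have "\<bar>\<phi> (f x)\<bar> * \<bar>k x\<bar> \<le> T powr q * c"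
      using elim by (intro mult_mono) (auto simp: \<phi>_def min_def)
    then show ?case using S(3)[of x] by (cases "x \<in> S") (auto simp: abs_mult mult.commute)
  qed
  have \<phi>int: "integrable M (\<lambda>x. \<phi> (f x) * k x)" if [measurable]: "f \<in> borel_measurable M" for f
    by (rule Bochner_Integration.integrable_bound[OF g])
      (use \<phi>k[of f] in \<open>auto elim!: eventually_mono intro: order_trans[OF _ abs_ge_self]\<close>)
  have close: "\<bar>(LINT x|M. \<bar>f x\<bar> powr q * k x) - (LINT x|M. \<phi> (f x) * k x)\<bar> < e / 3"
    if [measurable]: "f \<in> borel_measurable M" and fq: "integrable M (\<lambda>x. \<bar>f x\<bar> powr q)"
      and fL: "integrable M (\<lambda>x. \<bar>f x\<bar> powr q')" "(LINT x|M. \<bar>f x\<bar> powr q') \<le> L" for f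
  proof -
    let ?d = "\<lambda>x. \<bar>f x\<bar> powr q * k x - \<phi> (f x) * k x"
    have d: "integrable M ?d" using kint[OF fq] \<phi>int[of f] by auto
    have "\<bar>(LINT x|M. \<bar>f x\<bar> powr q * k x) - (LINT x|M. \<phi> (f x) * k x)\<bar> = \<bar>LINT x|M. ?d x\<bar>"
      using kint[OF fq] \<phi>int[of f] by simp
    also have "\<dots> \<le> (LINT x|M. norm (?d x))"
      using integral_norm_bound[of M ?d] by simp
    also have "\<dots> \<le> (LINT x|M. c * (T powr (q - q') * \<bar>f x\<bar> powr q'))"
    proof (rule integral_mono_AE)
      show "AE x in M. norm (?d x) \<le> c * (T powr (q - q') * \<bar>f x\<bar> powr q')"
        using c(2)
      proof eventually_elim
        case (elim x)
        have "\<bar>k x\<bar> * \<bar>\<bar>f x\<bar> powr q - \<phi> (f x)\<bar> \<le> c * (T powr (q - q') * \<bar>f x\<bar> powr q')"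
          unfolding \<phi>_def using elim c(1) q T by (intro mult_mono truncation_error) auto
        then show ?case by (simp add: mult.commute right_diff_distrib flip: abs_mult)
      qed
    qed (use d fL in auto)
    also have "\<dots> = c * (T powr (q - q') * (LINT x|M. \<bar>f x\<bar> powr q'))" by simp
    also have "\<dots> \<le> c * (T powr (q - q') * L)"
      using fL(2) c(1) by (intro mult_left_mono) auto
    finally show ?thesis using err by simp
  qed
  have "(\<lambda>n. LINT x|M. \<phi> (u n x) * k x) \<longlonglongrightarrow> (LINT x|M. \<phi> (v x) * k x)"
  proof (rule integral_dominated_convergence[where w = ?g])
    show "AE x in M. (\<lambda>n. \<phi> (u n x) * k x) \<longlonglongrightarrow> \<phi> (v x) * k x"
      using lim unfolding \<phi>_def by eventually_elim (use q in \<open>auto intro!: tendsto_intros\<close>)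
  qed (use g \<phi>k in auto)
  from LIMSEQ_D[OF this, of "e / 3"] e
  obtain n0 where n0: "\<forall>n\<ge>n0. norm ((LINT x|M. \<phi> (u n x) * k x) - (LINT x|M. \<phi> (v x) * k x)) < e / 3"
    by auto
  show "\<exists>no. \<forall>n\<ge>no. norm ((LINT x|M. \<bar>u n x\<bar> powr q * k x) - (LINT x|M. \<bar>v x\<bar> powr q * k x)) < e"
  proof (intro exI[of _ n0] allI impI)
    fix n assume "n0 \<le> n"
    from n0[rule_format, OF this] close[OF u uq uL, of n] close[OF v vq vL]
    show "norm ((LINT x|M. \<bar>u n x\<bar> powr q * k x) - (LINT x|M. \<bar>v x\<bar> powr q * k x)) < e"
      unfolding real_norm_def by linarith
  qed
qed

section \<open>Lipschitz test functions\<close>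

text \<open>Estimates radial singularities by a series: a bound \<open>c j\<close> on a shell is
  charged to the whole ball of radius \<open>\<rho> j\<close>, which for dyadic radii costs only a
  constant factor.\<close>

lemma nn_integral_le_ball_series:
  fixes h :: "'a::euclidean_space \<Rightarrow> real" and c \<rho> :: "nat \<Rightarrow> real"
  assumes le: "\<And>x. P x \<Longrightarrow> \<exists>j. x \<in> ball 0 (\<rho> j) \<and> h x \<le> c j"
    and nP: "\<And>x. \<not> P x \<Longrightarrow> h x \<le> 0"
    and c: "\<And>j. 0 \<le> c j" and \<rho>: "\<And>j. 0 \<le> \<rho> j" and sum: "summable (\<lambda>j. c j * \<rho> j ^ DIM('a))"
  shows "(\<integral>\<^sup>+x. ennreal (h x) \<partial>lborel) < \<infinity>"
proof -
  have "(\<integral>\<^sup>+x. ennreal (h x) \<partial>lborel) \<le> (\<integral>\<^sup>+x. (\<Sum>j. ennreal (c j) * indicator (ball (0::'a) (\<rho> j)) x) \<partial>lborel)"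
  proof (rule nn_integral_mono)
    fix x :: 'a
    show "ennreal (h x) \<le> (\<Sum>j. ennreal (c j) * indicator (ball (0::'a) (\<rho> j)) x)"
    proof (cases "P x")
      case True
      then obtain j where j: "x \<in> ball 0 (\<rho> j)" "h x \<le> c j" using le by blast
      have "f j \<le> suminf f" for f :: "nat \<Rightarrow> ennreal"
        using sum_le_suminf[of f "{j}"] by simp
      from this[of "\<lambda>j. ennreal (c j) * indicator (ball (0::'a) (\<rho> j)) x"]
      show ?thesis using j by (auto intro: order_trans[rotated] ennreal_leI)
    next
      case False
      then show ?thesis using nP[of x] by (simp add: ennreal_neg)
    qed
  qed
  also have "\<dots> = (\<Sum>j. ennreal (c j) * emeasure lborel (ball (0::'a) (\<rho> j)))"
  proof -
    have [measurable]: "ball (0::'a) (\<rho> j) \<in> sets borel" for j by simp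
    have "(\<integral>\<^sup>+x. (\<Sum>j. ennreal (c j) * indicator (ball (0::'a) (\<rho> j)) x) \<partial>lborel) =
        (\<Sum>j. \<integral>\<^sup>+x. ennreal (c j) * indicator (ball (0::'a) (\<rho> j)) x \<partial>lborel)"
      by (rule nn_integral_suminf) measurable
    then show ?thesis by (simp add: nn_integral_cmult_indicator)
  qed
  also have "\<dots> = (\<Sum>j. ennreal (unit_ball_vol (DIM('a)) * (c j * \<rho> j ^ DIM('a))))"
    using c \<rho> by (simp add: emeasure_ball ennreal_mult[symmetric] mult_ac)
  also have "\<dots> = ennreal (\<Sum>j. unit_ball_vol (DIM('a)) * (c j * \<rho> j ^ DIM('a)))"
    using c \<rho> sum by (intro suminf_ennreal2 summable_mult) auto
  also have "\<dots> < \<infinity>" by simp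
  finally show ?thesis .
qed

lemma dyadic_near:
  fixes t :: real
  assumes "0 < t" "t < 1"
  shows "\<exists>j. t < (1 / 2) ^ j \<and> (1 / 2) ^ Suc j \<le> t"
proof -
  define j where "j = (LEAST j. (1 / 2) ^ Suc j \<le> t)"
  obtain n where "(1 / 2) ^ n < t" using real_arch_pow_inv[of t "1 / 2"] assms by auto
  then have "(1 / 2) ^ Suc n \<le> t" by (smt (verit, best) power_Suc mult_left_le_one_le zero_le_power divide_nonneg_nonneg field_sum_of_halves)
  then have 1: "(1 / 2) ^ Suc j \<le> t" unfolding j_def by (rule LeastI)
  have "t < (1 / 2) ^ j"
  proof (cases j)
    case 0
    then show ?thesis using assms by simp
  next
    case (Suc i)
    then have "\<not> (1 / 2) ^ Suc i \<le> t"
      using not_less_Least[of i "\<lambda>j. (1 / 2) ^ Suc j \<le> t"] by (simp add: j_def)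
    then show ?thesis by (simp add: Suc)
  qed
  with 1 show ?thesis by blast
qed

lemma dyadic_far:
  fixes t :: real
  assumes "1 \<le> t"
  shows "\<exists>j. t < 2 ^ Suc j \<and> 2 ^ j \<le> t"
proof -
  define j where "j = (LEAST j. t < 2 ^ Suc j)"
  obtain n where n: "t < 2 ^ n" using real_arch_pow[of 2 t] by auto
  then have "t < 2 ^ Suc n" using assms by simp
  then have 1: "t < 2 ^ Suc j" unfolding j_def by (rule LeastI)
  have "2 ^ j \<le> t"
  proof (cases j)
    case 0
    then show ?thesis using assms by simp
  next
    case (Suc i)
    then have "\<not> t < 2 ^ Suc i"
      using not_less_Least[of i "\<lambda>j. t < 2 ^ Suc j"] by (simp add: j_def)
    then show ?thesis by (simp add: Suc)
  qed
  with 1 show ?thesis by blast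
qed

text \<open>With \<open>N\<close> the dimension, the integrand is of order
  \<open>norm x powr (p - N - s * p)\<close> near the origin, summable over dyadic shells since
  \<open>s < 1\<close>; far away it is at most \<open>norm x powr (- N - s * p)\<close>, summable
  since \<open>s * p > 0\<close>. The ratios of the two geometric series are
  \<open>2 powr (s * p - p)\<close> and \<open>2 powr (- (s * p))\<close>.\<close>

lemma lipschitz_kernel_integrable:
  fixes L s p :: real
  assumes sp: "0 < s" "s < 1" "0 < p" and L: "0 \<le> L"
  shows "(\<integral>\<^sup>+x. ennreal (min ((L * norm x) powr p) 1 / norm (x :: real^'n) powr (real CARD('n::finite) + s * p)) \<partial>lborel) < \<infinity>"
    (is "(\<integral>\<^sup>+x. ennreal (?h x) \<partial>lborel) < \<infinity>")
proof -
  define N where "N = real CARD('n)"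
  define e where "e = N + s * p"
  have e: "0 < e" "0 < N" using sp by (auto simp: e_def N_def add_pos_pos)
  define h where "h x = ?h x" for x :: "real^'n"
  have h0: "0 \<le> h x" for x by (simp add: h_def)
  define h1 where "h1 x = (if norm x < 1 then h x else 0)" for x :: "real^'n"
  define h2 where "h2 x = (if norm x < 1 then 0 else h x)" for x :: "real^'n"
  have [measurable]: "h \<in> borel_measurable borel" unfolding h_def by measurable
  have m[measurable]: "h1 \<in> borel_measurable borel" "h2 \<in> borel_measurable borel"
    unfolding h1_def[abs_def] h2_def[abs_def] by measurable
  have geo1: "((1 / 2) ^ j) powr p * ((1 / 2) ^ Suc j) powr (- e) * ((1 / 2) ^ j) ^ CARD('n) = 2 powr e * (2 powr (s * p - p)) ^ j" for j :: nat
  proof -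
    have half: "(1 / 2 :: real) ^ j = 2 powr (- real j)" for j
      by (simp add: powr_minus powr_realpow power_divide inverse_eq_divide)
    have "((1 / 2 :: real) ^ j) ^ CARD('n) = ((1 / 2) ^ j) powr N"
      by (simp add: N_def powr_realpow)
    moreover have "(2 powr (s * p - p)) ^ j = (2::real) powr ((s * p - p) * real j)"
      by (simp add: powr_realpow[symmetric] powr_powr)
    ultimately show ?thesis
      unfolding half by (simp add: powr_powr e_def algebra_simps flip: powr_add)
  qed
  have geo2: "(2 ^ j) powr (- e) * (2 ^ Suc j) ^ CARD('n) = 2 powr N * (2 powr (- (s * p))) ^ j" for j :: nat
  proof -
    have two: "(2 :: real) ^ j = 2 powr (real j)" for j
      by (simp add: powr_realpow)
    have "((2 :: real) ^ Suc j) ^ CARD('n) = (2 ^ Suc j) powr N"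
      by (simp add: N_def powr_realpow)
    moreover have "(2 powr (- (s * p))) ^ j = (2::real) powr (- (s * p) * real j)"
      by (simp add: powr_realpow[symmetric] powr_powr)
    ultimately show ?thesis
      unfolding two by (simp add: powr_powr e_def algebra_simps flip: powr_add)
  qed
  have "(\<integral>\<^sup>+x. ennreal (h1 x) \<partial>lborel) < \<infinity>"
  \<comment> \<open>The origin is left out of \<open>P\<close>: no dyadic shell reaches it, and
    \<open>h1\<close> is zero there because its numerator is.\<close>
  proof (rule nn_integral_le_ball_series[where P = "\<lambda>x. norm x < 1 \<and> x \<noteq> 0" and \<rho> = "\<lambda>j. (1 / 2) ^ j"
        and c = "\<lambda>j. L powr p * (((1 / 2) ^ j) powr p * ((1 / 2) ^ Suc j) powr (- e))"])
    fix x :: "real^'n" assume x: "norm x < 1 \<and> x \<noteq> 0"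
    then obtain j where j: "norm x < (1 / 2) ^ j" "(1 / 2) ^ Suc j \<le> norm x"
      using dyadic_near[of "norm x"] by auto
    have "h x \<le> (L * norm x) powr p / norm x powr e"
      unfolding h_def e_def N_def by (intro divide_right_mono) auto
    also have "\<dots> = L powr p * (norm x powr p * norm x powr (- e))"
      using L by (simp add: powr_mult powr_minus divide_inverse)
    also have "\<dots> \<le> L powr p * (((1 / 2) ^ j) powr p * ((1 / 2) ^ Suc j) powr (- e))"
      using j x sp e by (intro mult_left_mono mult_mono powr_mono2 powr_mono2') (auto simp del: power_Suc)
    finally have "h1 x \<le> L powr p * (((1 / 2) ^ j) powr p * ((1 / 2) ^ Suc j) powr (- e))"
      using x by (simp add: h1_def)
    then show "\<exists>j. x \<in> ball 0 ((1 / 2) ^ j) \<and> h1 x \<le> L powr p * (((1 / 2) ^ j) powr p * ((1 / 2) ^ Suc j) powr (- e))"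
      using j by auto
  next
    have "summable (\<lambda>j. L powr p * (2 powr e * (2 powr (s * p - p)) ^ j))"
      using sp powr_less_mono[of "s * p - p" 0 2]
      by (intro summable_mult summable_geometric) auto
    then show "summable (\<lambda>j. L powr p * (((1 / 2) ^ j) powr p * ((1 / 2) ^ Suc j) powr (- e)) * ((1 / 2) ^ j) ^ DIM(real^'n))"
      using geo1 by (simp add: mult.assoc del: power_Suc)
  qed (auto simp: h1_def h_def)
  moreover have "(\<integral>\<^sup>+x. ennreal (h2 x) \<partial>lborel) < \<infinity>"
  proof (rule nn_integral_le_ball_series[where P = "\<lambda>x. 1 \<le> norm x" and \<rho> = "\<lambda>j. 2 ^ Suc j"
        and c = "\<lambda>j. (2 ^ j) powr (- e)"])
    fix x :: "real^'n" assume x: "1 \<le> norm x"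
    then obtain j where j: "norm x < 2 ^ Suc j" "2 ^ j \<le> norm x"
      using dyadic_far[of "norm x"] by auto
    have "h x \<le> 1 / norm x powr e"
      unfolding h_def e_def N_def by (intro divide_right_mono) auto
    also have "\<dots> = norm x powr (- e)" by (simp add: powr_minus divide_inverse)
    also have "\<dots> \<le> (2 ^ j) powr (- e)"
      using j e by (intro powr_mono2') auto
    finally have "h2 x \<le> (2 ^ j) powr (- e)" using x by (simp add: h2_def)
    then show "\<exists>j. x \<in> ball 0 (2 ^ Suc j) \<and> h2 x \<le> (2 ^ j) powr (- e)" using j by auto
  next
    have "summable (\<lambda>j. 2 powr N * ((2::real) powr (- (s * p))) ^ j)"
      using sp powr_less_mono[of "- (s * p)" 0 2]
      by (intro summable_mult summable_geometric) auto
    then show "summable (\<lambda>j. (2 ^ j) powr (- e) * (2 ^ Suc j) ^ DIM(real^'n))"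
      using geo2 by (simp del: power_Suc)
  qed (auto simp: h2_def)
  moreover have "(\<integral>\<^sup>+x. ennreal (h x) \<partial>lborel) = (\<integral>\<^sup>+x. ennreal (h1 x) \<partial>lborel) + (\<integral>\<^sup>+x. ennreal (h2 x) \<partial>lborel)"
    by (subst nn_integral_add[symmetric]) (auto intro!: nn_integral_cong simp: h1_def h2_def)
  ultimately show ?thesis by (simp add: h_def)
qed

text \<open>The integrand vanishes unless one of the two points lies in \<Omega>, and it is at most
  \<open>h (x - y)\<close>. By translation invariance each of the two cases contributes at most the
  integral of \<open>h\<close> times the measure of \<Omega>.\<close>

lemma lipschitz_in_frac_sobolev0:
  fixes f :: "real^'n \<Rightarrow> real"
  assumes sp: "0 < s" "s < 1" "0 < p" and L: "0 \<le> L" and \<Omega>: "open \<Omega>" "bounded \<Omega>"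
    and lip: "\<And>x y. \<bar>f x - f y\<bar> \<le> L * norm (x - y)" and f01: "\<And>x. 0 \<le> f x" "\<And>x. f x \<le> 1"
    and off: "\<And>x. x \<notin> \<Omega> \<Longrightarrow> f x = 0"
  shows "f \<in> frac_sobolev0 s p \<Omega>"
proof -
  define h where "h x = min ((L * norm x) powr p) 1 / norm x powr (real CARD('n) + s * p)" for x :: "real^'n"
  define H where "H = (\<integral>\<^sup>+x. ennreal (h x) \<partial>lborel)"
  have H: "H < \<infinity>" unfolding H_def h_def by (rule lipschitz_kernel_integrable[OF sp L])
  have [measurable]: "h \<in> borel_measurable borel" unfolding h_def by measurable
  have h0: "0 \<le> h x" for x by (simp add: h_def)
  have "L-lipschitz_on UNIV f"
    using lip L by (intro lipschitz_onI) (auto simp: dist_norm)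
  then have [measurable]: "f \<in> borel_measurable borel"
    by (intro borel_measurable_continuous_onI lipschitz_on_continuous_on)
  have fm: "f \<in> borel_measurable lebesgue" by (rule measurable_completion) simp
  have \<Omega>b[measurable]: "\<Omega> \<in> sets borel" and \<Omega>f: "emeasure lborel \<Omega> < \<infinity>"
    using \<Omega> emeasure_bounded_finite[of \<Omega>] by (auto simp: less_top)
  have "integrable lebesgue (\<lambda>x. indicator \<Omega> x :: real)"
    using \<Omega>f by (intro integrable_real_indicator) auto
  then have Lp: "integrable lebesgue (\<lambda>x. \<bar>f x\<bar> powr p)"
  proof (rule Bochner_Integration.integrable_bound)
    show "AE x in lebesgue. norm (\<bar>f x\<bar> powr p) \<le> norm (indicator \<Omega> x :: real)"
      using f01 off sp by (auto simp: indicator_def powr_le1)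
  qed (use fm in measurable)
  have gb: "gagliardo_integrand s p f \<in> borel_measurable borel"
    by (rule gagliardo_measurable) measurable
  have shift: "(\<integral>\<^sup>+y. ennreal (h (x - y)) \<partial>lborel) = H" for x :: "real^'n"
  proof -
    have "H = (\<integral>\<^sup>+y. ennreal (h y) \<partial>distr lborel borel ((+) (- x)))"
      by (simp add: H_def lborel_distr_plus)
    also have "\<dots> = (\<integral>\<^sup>+y. ennreal (h (- x + y)) \<partial>lborel)"
      by (rule nn_integral_distr) measurable
    also have "\<dots> = (\<integral>\<^sup>+y. ennreal (h (x - y)) \<partial>lborel)"
    proof (rule nn_integral_cong)
      fix y
      have "norm (- x + y) = norm (x - y)" using norm_minus_commute[of x y] by simp
      then show "ennreal (h (- x + y)) = ennreal (h (x - y))" by (simp add: h_def)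
    qed
    finally show ?thesis by simp
  qed
  let ?k = "\<lambda>z. ennreal (h (fst z - snd z))"
  have "(\<integral>\<^sup>+z. ennreal (gagliardo_integrand s p f z) \<partial>lborel) \<le>
      (\<integral>\<^sup>+z. ?k z * indicator \<Omega> (fst z) + ?k z * indicator \<Omega> (snd z) \<partial>(lborel \<Otimes>\<^sub>M lborel))"
    unfolding lborel_prod
  proof (rule nn_integral_mono)
    fix z :: "(real^'n) \<times> (real^'n)"
    obtain x y where z: "z = (x, y)" by (cases z)
    show "ennreal (gagliardo_integrand s p f z) \<le> ?k z * indicator \<Omega> (fst z) + ?k z * indicator \<Omega> (snd z)"
    proof (cases "x \<in> \<Omega> \<or> y \<in> \<Omega>")
      case True
      have "\<bar>f x - f y\<bar> powr p \<le> min ((L * norm (x - y)) powr p) 1"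
        using lip[of x y] f01[of x] f01[of y] sp
        by (auto intro!: powr_mono2 powr_le1)
      then have "gagliardo_integrand s p f z \<le> h (x - y)"
        unfolding z gagliardo_integrand_def h_def prod.case by (intro divide_right_mono) auto
      then have "ennreal (gagliardo_integrand s p f z) \<le> ?k z" by (simp add: z ennreal_leI)
      then show ?thesis using True by (auto simp: z indicator_def intro: order_trans)
    qed (simp add: z gagliardo_integrand_def off)
  qed
  also have "\<dots> = (\<integral>\<^sup>+z. ?k z * indicator \<Omega> (fst z) \<partial>(lborel \<Otimes>\<^sub>M lborel)) +
      (\<integral>\<^sup>+z. ?k z * indicator \<Omega> (snd z) \<partial>(lborel \<Otimes>\<^sub>M lborel))"
    by (rule nn_integral_add) measurable
  also have "(\<integral>\<^sup>+z. ?k z * indicator \<Omega> (fst z) \<partial>(lborel \<Otimes>\<^sub>M lborel))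
      = (\<integral>\<^sup>+x. \<integral>\<^sup>+y. ennreal (h (x - y)) * indicator \<Omega> x \<partial>lborel \<partial>lborel)"
    by (subst lborel.nn_integral_fst[symmetric]) auto
  also have "\<dots> = H * emeasure lborel \<Omega>"
    by (simp add: nn_integral_multc shift nn_integral_cmult_indicator)
  also have "(\<integral>\<^sup>+z. ?k z * indicator \<Omega> (snd z) \<partial>(lborel \<Otimes>\<^sub>M lborel))
      = (\<integral>\<^sup>+y. \<integral>\<^sup>+x. ennreal (h (x - y)) * indicator \<Omega> y \<partial>lborel \<partial>lborel)"
    by (subst lborel_pair.nn_integral_snd[symmetric]) auto
  also have "\<dots> = (\<integral>\<^sup>+y. H * indicator \<Omega> y \<partial>lborel)"
  proof (rule nn_integral_cong)
    fix y
    have "(\<integral>\<^sup>+x. ennreal (h (x - y)) \<partial>lborel) = (\<integral>\<^sup>+x. ennreal (h (y - x)) \<partial>lborel)"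
      by (rule nn_integral_cong) (simp add: h_def norm_minus_commute)
    then have "(\<integral>\<^sup>+x. ennreal (h (x - y)) \<partial>lborel) = H" by (simp add: shift)
    then show "(\<integral>\<^sup>+x. ennreal (h (x - y)) * indicator \<Omega> y \<partial>lborel) = H * indicator \<Omega> y"
      by (simp add: nn_integral_multc)
  qed
  also have "\<dots> = H * emeasure lborel \<Omega>" by (simp add: nn_integral_cmult_indicator)
  also have "H * emeasure lborel \<Omega> + H * emeasure lborel \<Omega> < \<infinity>"
    using H \<Omega>f by (simp add: ennreal_mult_less_top ennreal_add_less_top)
  finally have fin: "(\<integral>\<^sup>+z. ennreal (gagliardo_integrand s p f z) \<partial>lborel) < \<infinity>" .
  have "integrable lborel (gagliardo_integrand s p f)"
    by (rule integrableI_nonneg) (use gb fin in \<open>auto simp: gagliardo_nonneg\<close>)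
  then have "integrable lebesgue (gagliardo_integrand s p f)"
    using gb by (subst integrable_completion) auto
  then show ?thesis
    using fm Lp off by (auto simp: frac_sobolev0_def frac_sobolev_def)
qed

text \<open>The indicator of a compact part \<open>T\<close> of the set where \<open>a\<close> is
  positive would be the natural choice. Lipschitz functions equal to one on \<open>T\<close> and
  supported in shrinking neighbourhoods approximate it, and the integrals converge to the positive
  integral of \<open>a\<close> over \<open>T\<close>.\<close>

lemma frac_sobolev0_positive_weight:
  fixes a :: "real^'n \<Rightarrow> real"
  assumes sp: "0 < s" "s < 1" "0 < p" and \<Omega>: "open \<Omega>" "bounded \<Omega>"
    and a[measurable]: "a \<in> borel_measurable lebesgue" and c: "AE x in lebesgue. \<bar>a x\<bar> \<le> c"
    and a0: "\<And>x. x \<notin> \<Omega> \<Longrightarrow> a x = 0" and pos: "\<not> (AE x in lebesgue. a x \<le> 0)" and q: "0 < q"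
  obtains f where "f \<in> frac_sobolev0 s p \<Omega>" "0 < (LINT x|lebesgue. \<bar>f x\<bar> powr q * a x)"
proof -
  define P where "P = {x. 0 < a x}"
  have "{x \<in> space lebesgue. 0 < a x} \<in> sets lebesgue" by measurable
  then have P[measurable]: "P \<in> sets lebesgue" by (simp add: P_def)
  have P\<Omega>: "P \<subseteq> \<Omega>" using a0 by (force simp: P_def)
  have Pnn: "emeasure lebesgue P \<noteq> 0"
  proof
    assume "emeasure lebesgue P = 0"
    then have "P \<in> null_sets lebesgue" using P by (simp add: null_sets_def)
    then have "AE x in lebesgue. x \<notin> P" by (rule AE_not_in)
    then have "AE x in lebesgue. a x \<le> 0" by eventually_elim (simp add: P_def)
    with pos show False by blast
  qed
  \<comment> \<open>Inner regularity leaves a remainder of measure below \<open>e\<close>; a finite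
    \<open>e\<close> below the measure of \<open>P\<close> therefore gives \<open>T\<close> positive
    measure.\<close>
  obtain y where y: "0 < y" "y < emeasure lebesgue P"
    using Pnn dense[of 0 "emeasure lebesgue P"] by (auto simp: zero_less_iff_neq_zero)
  define e where "e = enn2real y"
  have ye: "y = ennreal e"
    using y by (auto simp: e_def intro!: ennreal_enn2real[symmetric] elim: less_le_trans)
  then have e: "0 < e" "ennreal e < emeasure lebesgue P"
    using y by auto
  obtain T where T: "closed T" "T \<subseteq> P" "P - T \<in> lmeasurable" "emeasure lebesgue (P - T) < ennreal e"
    using sets_lebesgue_inner_closed[OF P e(1)] by blast
  have Tm[measurable]: "T \<in> sets lebesgue" using T(1) by simp
  have Tpos: "emeasure lebesgue T \<noteq> 0"
  proof
    assume "emeasure lebesgue T = 0"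
    moreover have "emeasure lebesgue P \<le> emeasure lebesgue (P - T) + emeasure lebesgue T"
      using emeasure_subadditive[of "P - T" lebesgue T] T(2) P Tm by (simp add: Un_absorb2)
    ultimately have "emeasure lebesgue P < ennreal e" using T(4) by simp
    with e(2) show False by simp
  qed
  then have Tne: "T \<noteq> {}" by auto
  have Tc: "compact T"
    using T(1) bounded_subset[OF \<Omega>(2), of T] T(2) P\<Omega> by (auto simp: compact_eq_bounded_closed)
  obtain d where d: "0 < d" "{x. infdist x T \<le> d} \<subseteq> \<Omega>"
    using compact_in_open_separated[OF Tne Tc \<Omega>(1)] T(2) P\<Omega> by blast
  \<comment> \<open>The radii tend to zero and never exceed \<open>d\<close>, so every
    \<open>f n\<close> vanishes outside \<Omega>.\<close>
  define \<delta> where "\<delta> n = d / real (Suc n)" for n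
  have \<delta>: "0 < \<delta> n" "\<delta> n \<le> d" for n
    using d by (auto simp: \<delta>_def field_simps)
  define f where "f n x = max 0 (1 - infdist x T / \<delta> n)" for n x
  have f01: "0 \<le> f n x" "f n x \<le> 1" for n x
    using \<delta>[of n] infdist_nonneg[of x T] by (auto simp: f_def)
  have foff: "f n x = 0" if "x \<notin> \<Omega>" for n x
  proof -
    have "\<delta> n \<le> infdist x T" using that d(2) \<delta>[of n] by force
    then show ?thesis using \<delta>[of n] by (simp add: f_def)
  qed
  have fW: "f n \<in> frac_sobolev0 s p \<Omega>" for n
  proof (rule lipschitz_in_frac_sobolev0[OF sp _ \<Omega>, of "1 / \<delta> n"])
    fix x y
    have "\<bar>f n x - f n y\<bar> \<le> \<bar>infdist x T / \<delta> n - infdist y T / \<delta> n\<bar>"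
      unfolding f_def by linarith
    also have "\<dots> = \<bar>infdist x T - infdist y T\<bar> / \<delta> n"
      using \<delta>[of n] by (simp add: abs_divide flip: diff_divide_distrib)
    also have "\<dots> \<le> norm (x - y) / \<delta> n"
      using \<delta>[of n] infdist_triangle_abs[of x T y] by (intro divide_right_mono) (auto simp: dist_norm)
    finally show "\<bar>f n x - f n y\<bar> \<le> 1 / \<delta> n * norm (x - y)" by simp
  qed (use f01 foff \<delta>[of n] in auto)
  have \<Omega>f: "emeasure lebesgue \<Omega> < \<infinity>" and \<Omega>m[measurable]: "\<Omega> \<in> sets lebesgue"
    using \<Omega> emeasure_bounded_finite[of \<Omega>] by (auto simp: less_top)
  let ?g = "\<lambda>x. c * indicator \<Omega> x :: real"
  have g: "integrable lebesgue ?g" using \<Omega>f \<Omega>m by (auto simp: integrable_mult_right_iff)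
  have fm[measurable]: "f n \<in> borel_measurable lebesgue" for n using fW[of n] by (simp add: frac_sobolev0_iff)
  have lim: "(\<lambda>n. LINT x|lebesgue. \<bar>f n x\<bar> powr q * a x) \<longlonglongrightarrow> (LINT x|lebesgue. indicator T x * a x)"
  proof (rule integral_dominated_convergence[where w = ?g])
    show "AE x in lebesgue. (\<lambda>n. \<bar>f n x\<bar> powr q * a x) \<longlonglongrightarrow> indicator T x * a x"
    proof (rule AE_I2)
      fix x :: "real^'n"
      show "(\<lambda>n. \<bar>f n x\<bar> powr q * a x) \<longlonglongrightarrow> indicator T x * a x"
      proof (cases "x \<in> T")
        case True
        then have "f n x = 1" for n by (simp add: f_def)
        then show ?thesis using True by simp
      next
        case False
        then have "0 < infdist x T"
          using T(1) Tne infdist_nonneg[of x T] in_closed_iff_infdist_zero[of T x] by fastforce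
        moreover have "\<delta> \<longlonglongrightarrow> 0"
          unfolding \<delta>_def using tendsto_mult_right_zero[OF LIMSEQ_inverse_real_of_nat, of d] by (simp add: divide_inverse)
        ultimately have "\<forall>\<^sub>F n in sequentially. \<delta> n < infdist x T"
          by (auto elim: order_tendstoD)
        then have "\<forall>\<^sub>F n in sequentially. \<bar>f n x\<bar> powr q * a x = 0"
        proof eventually_elim
          case (elim n)
          then have "f n x = 0" using \<delta>[of n] by (simp add: f_def)
          then show ?case by simp
        qed
        then show ?thesis using False by (auto intro: tendsto_eventually)
      qed
    qed
    show "AE x in lebesgue. norm (\<bar>f n x\<bar> powr q * a x) \<le> ?g x" for n
      using c
    proof eventually_elim
      case (elim x)
      have "\<bar>f n x\<bar> powr q \<le> 1" using f01[of n x] q by (simp add: powr_le1)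
      then have "\<bar>f n x\<bar> powr q * \<bar>a x\<bar> \<le> 1 * c" using elim by (intro mult_mono) auto
      then show ?case using a0[of x] by (cases "x \<in> \<Omega>") (auto simp: abs_mult)
    qed
  qed (use g in measurable)
  have int: "integrable lebesgue (\<lambda>x. indicator T x * a x)"
  proof (rule Bochner_Integration.integrable_bound[OF g])
    show "AE x in lebesgue. norm (indicator T x * a x) \<le> norm (?g x)"
      using c by eventually_elim (use a0 T(2) P\<Omega> in \<open>auto simp: indicator_def\<close>)
  qed measurable
  have nn: "AE x in lebesgue. 0 \<le> indicator T x * a x"
    using T(2) by (intro AE_I2) (auto simp: P_def indicator_def intro: less_imp_le)
  have "0 < (LINT x|lebesgue. indicator T x * a x)"
  proof (rule ccontr)
    assume "\<not> 0 < (LINT x|lebesgue. indicator T x * a x)"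
    then have "(LINT x|lebesgue. indicator T x * a x) = 0"
      using integral_nonneg_AE[OF nn] by linarith
    then have "AE x in lebesgue. indicator T x * a x = 0"
      using integral_nonneg_eq_0_iff_AE[OF int nn] by simp
    then have "AE x in lebesgue. x \<notin> T"
      by eventually_elim (use T(2) in \<open>auto simp: P_def\<close>)
    then have "T \<in> null_sets lebesgue" using Tm by (simp add: AE_iff_null_sets)
    with Tpos show False by auto
  qed
  then have "\<forall>\<^sub>F n in sequentially. 0 < (LINT x|lebesgue. \<bar>f n x\<bar> powr q * a x)"
    using order_tendstoD(1)[OF lim] by blast
  then obtain n where "0 < (LINT x|lebesgue. \<bar>f n x\<bar> powr q * a x)"
    by (auto simp: eventually_sequentially)
  then show ?thesis using that fW by blast
qed

section \<open>The nonlinearity\<close>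

text \<open>Differentiability keeps \<open>A t / t\<close> bounded near zero, while the lower growth
  bound makes it at least \<open>c * t powr (p - 2)\<close> for \<open>t > 0\<close>, which is
  unbounded near zero if \<open>p < 2\<close>.\<close>

lemma growth_exponent_ge_2:
  fixes A :: "real \<Rightarrow> real"
  assumes A0: "A 0 = 0" and A': "(A has_real_derivative D) (at 0)"
    and c: "0 < c" "\<And>t. A t * t \<ge> c * \<bar>t\<bar> powr p"
  shows "2 \<le> p"
proof (rule ccontr)
  assume "\<not> 2 \<le> p"
  then have p: "p - 2 < 0" by simp
  have "((\<lambda>h. A h / h) \<longlongrightarrow> D) (at 0)"
    using A' by (simp add: DERIV_def A0)
  then have "\<forall>\<^sub>F h in at 0. dist (A h / h) D < 1"
    by (rule tendstoD) simp
  then obtain d where d: "0 < d" "\<And>h. h \<noteq> 0 \<Longrightarrow> \<bar>h\<bar> < d \<Longrightarrow> \<bar>A h / h - D\<bar> < 1"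
    unfolding eventually_at by (auto simp: dist_real_def)
  define X where "X = (\<bar>D\<bar> + 1) / c"
  have X: "0 < X" using c by (simp add: X_def add_nonneg_pos)
  \<comment> \<open>Small enough for the quotient to lie within one of \<open>D\<close>, and for
    \<open>c * t powr (p - 2)\<close> to reach \<open>\<bar>D\<bar> + 1\<close>.\<close>
  define t where "t = min (d / 2) (X powr (1 / (p - 2)))"
  have t: "0 < t" "t < d" using d X by (auto simp: t_def)
  have "X = (X powr (1 / (p - 2))) powr (p - 2)"
    using X p by (simp add: powr_powr)
  also have "\<dots> \<le> t powr (p - 2)"
    using t p X by (intro powr_mono2') (auto simp: t_def)
  finally have "\<bar>D\<bar> + 1 \<le> c * t powr (p - 2)"
    using c by (simp add: X_def field_simps)
  also have "\<dots> \<le> A t / t"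
  proof -
    have "c * t powr p / t^2 \<le> A t * t / t^2"
      using c(2)[of t] t by (intro divide_right_mono) auto
    moreover have "t powr (p - 2) = t powr p / t^2"
      using t by (simp add: powr_diff)
    ultimately show ?thesis using t by (simp add: power2_eq_square)
  qed
  finally show False using d(2)[of t] t by auto
qed

lemma even_primitive_deriv:
  fixes A :: "real \<Rightarrow> real"
  assumes odd: "\<And>t. A (- t) = - A t" and cont: "\<And>t. isCont A t"
  shows "(even_primitive A has_real_derivative A t) (at t)"
proof -
  obtain F where F0: "\<forall>x. - \<infinity> < ereal x \<longrightarrow> ereal x < \<infinity> \<longrightarrow> (F has_vector_derivative A x) (at x)"
    using einterval_antiderivative[of "- \<infinity>" \<infinity> A] cont by auto
  then have F: "(F has_real_derivative A x) (at x)" for x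
    by (simp add: has_real_derivative_iff_has_vector_derivative)
  have even: "F (- x) = F x" for x
  proof -
    have "((\<lambda>x. F (- x) - F x) has_real_derivative - A (- x) - A x) (at x)" for x
    proof -
      have "((\<lambda>x. F (- x)) has_real_derivative A (- x) * (- 1)) (at x)"
        by (rule DERIV_chain2[OF F]) (auto intro!: derivative_eq_intros)
      from DERIV_diff[OF this F] show ?thesis by simp
    qed
    then have "((\<lambda>x. F (- x) - F x) has_real_derivative 0) (at x)" for x
      by (simp add: odd)
    then have "F (- x) - F x = F (- 0) - F 0"
      using DERIV_isconst_all[of "\<lambda>x. F (- x) - F x"] by blast
    then show ?thesis by simp
  qed
  have "even_primitive A = (\<lambda>t. F t - F 0)"
  proof
    fix t
    have "(A has_integral (F \<bar>t\<bar> - F 0)) {0..\<bar>t\<bar>}"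
      by (rule fundamental_theorem_of_calculus)
        (auto simp: has_real_derivative_iff_has_vector_derivative[symmetric] intro: has_field_derivative_at_within F)
    then have "even_primitive A t = F \<bar>t\<bar> - F 0"
      by (simp add: even_primitive_def integral_unique)
    also have "F \<bar>t\<bar> = F t" using even[of t] by (simp add: abs_if)
    finally show "even_primitive A t = F t - F 0" .
  qed
  then show ?thesis using F[of t] by (auto intro!: derivative_eq_intros)
qed

text \<open>\<open>ii\<close> bounds \<open>t^2 * A' t\<close> by
  \<open>(m - 1) * (A t * t)\<close>, and with the growth of \<open>A\<close> this gives
  \<open>\<bar>A' t\<bar> \<le> m * C * \<bar>t\<bar> powr (p - 2)\<close> for \<open>t\<close>
  other than zero. By the mean value theorem \<open>A\<close> is then Lipschitz on bounded ranges
  with the scaling that \<open>power_growth\<close> asks for at \<open>r = 2\<close>.\<close>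

lemma power_growth_even_primitive:
  fixes A A' :: "real \<Rightarrow> real"
  assumes odd: "\<And>t. A (- t) = - A t"
    and A': "\<And>t. (A has_real_derivative A' t) (at t)" and A'_cont: "isCont A' 0"
    and exps: "1 < l" "1 \<le> m" "2 \<le> p"
    and C: "0 < C" "\<And>t. \<bar>A t\<bar> \<le> C * \<bar>t\<bar> powr (p - 1)" and pos: "\<And>t. 0 \<le> A t * t"
    and ii: "\<And>t. (l - 1) * (A t * t) \<le> t^2 * A' t" "\<And>t. t^2 * A' t \<le> (m - 1) * (A t * t)"
  shows "power_growth p 2 (m * C) (even_primitive A) A"
proof
  have cont: "isCont A t" for t using A' DERIV_isCont by blast
  show "(even_primitive A has_real_derivative A t) (at t)" for t
    using odd cont by (rule even_primitive_deriv)
  show A0: "A 0 = 0" using odd[of 0] by simp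
  show "even_primitive A 0 = 0" by (simp add: even_primitive_def)
  have A'_bound: "\<bar>A' x\<bar> \<le> m * C * M powr (p - 2)" if "x \<noteq> 0" "\<bar>x\<bar> \<le> M" for x M
  proof -
    have "0 \<le> (l - 1) * (A x * x)" using exps pos[of x] by simp
    then have "0 \<le> x^2 * A' x" using ii(1)[of x] by linarith
    then have nn: "0 \<le> A' x" using that by (simp add: zero_le_mult_iff)
    have "A x * x \<le> \<bar>A x\<bar> * \<bar>x\<bar>" by (simp flip: abs_mult)
    also have "\<dots> \<le> C * \<bar>x\<bar> powr (p - 1) * \<bar>x\<bar>" by (intro mult_right_mono C) auto
    also have "\<dots> = C * \<bar>x\<bar> powr (p - 2) * x^2"
      using that by (simp add: powr_diff power2_eq_square abs_mult[symmetric] field_simps)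
    finally have Ax: "A x * x \<le> C * \<bar>x\<bar> powr (p - 2) * x^2" .
    have "x^2 * A' x \<le> (m - 1) * (A x * x)" by (rule ii(2))
    also have "\<dots> \<le> m * (A x * x)" using pos[of x] by (intro mult_right_mono) auto
    also have "\<dots> \<le> m * (C * \<bar>x\<bar> powr (p - 2) * x^2)" using Ax exps by (intro mult_left_mono) auto
    finally have "A' x * x^2 \<le> (m * C * \<bar>x\<bar> powr (p - 2)) * x^2" by (simp add: mult_ac)
    then have "A' x \<le> m * C * \<bar>x\<bar> powr (p - 2)"
      by (rule mult_right_le_imp_le) (use that in simp)
    also have "\<dots> \<le> m * C * M powr (p - 2)"
      using that exps C by (intro mult_left_mono powr_mono2) auto
    finally show ?thesis using nn by simp
  qed
  have A'_bound': "\<bar>A' x\<bar> \<le> m * C * M powr (p - 2)" if "0 < M" "\<bar>x\<bar> \<le> M" for x M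
  proof (cases "x = 0")
    case True
    \<comment> \<open>At zero \<open>ii\<close> says nothing about \<open>A'\<close> since
      \<open>t^2\<close> vanishes; continuity of \<open>A'\<close> passes the bound to the
      limit.\<close>
    have "((\<lambda>x. \<bar>A' x\<bar>) \<longlongrightarrow> \<bar>A' 0\<bar>) (at 0)"
      using A'_cont by (intro tendsto_rabs) (simp add: isCont_def)
    moreover have "\<forall>\<^sub>F x in at 0. \<bar>A' x\<bar> \<le> m * C * M powr (p - 2)"
      unfolding eventually_at using that A'_bound by (intro exI[of _ M]) auto
    ultimately have "\<bar>A' 0\<bar> \<le> m * C * M powr (p - 2)"
      by (rule tendsto_upperbound) simp
    then show ?thesis by (simp add: True)
  qed (use that A'_bound in auto)
  fix M x y :: real assume M: "M > 0" "\<bar>x\<bar> \<le> M" "\<bar>y\<bar> \<le> M"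
  have key: "\<bar>A y - A x\<bar> \<le> m * C * M powr (p - 2) * (y - x)"
    if xy: "x < y" "\<bar>x\<bar> \<le> M" "\<bar>y\<bar> \<le> M" for x y
  proof -
    obtain z where z: "x < z" "z < y" "A y - A x = (y - x) * A' z"
      using MVT2[OF xy(1), of A A'] A' by blast
    have "\<bar>A y - A x\<bar> = (y - x) * \<bar>A' z\<bar>" using xy by (simp add: z abs_mult)
    also have "\<dots> \<le> (y - x) * (m * C * M powr (p - 2))"
      using z xy M by (intro mult_left_mono A'_bound') auto
    finally show ?thesis by (simp add: mult_ac)
  qed
  show "\<bar>A x - A y\<bar> \<le> m * C * M powr (p - 2) * \<bar>x - y\<bar> powr (2 - 1)"
  proof (cases x y rule: linorder_cases)
    case less
    then show ?thesis using key[of x y] M by (simp add: abs_minus_commute)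
  next
    case greater
    then show ?thesis using key[of y x] M by simp
  qed simp
next
  show "(1::real) < 2" by simp
  show "2 \<le> p" by (rule exps)
  show "0 \<le> m * C" using exps C by simp
qed

lemma AE_off_diagonal: "AE z in (lebesgue :: ('a::euclidean_space \<times> 'a) measure). fst z \<noteq> snd z"
proof -
  have "AE z in (lborel \<Otimes>\<^sub>M lborel :: ('a \<times> 'a) measure). fst z \<noteq> snd z"
  proof (rule lborel_pair.AE_pair_measure)
    have "open {z :: 'a \<times> 'a. fst z \<noteq> snd z}"
      by (intro open_Collect_neq continuous_intros)
    then show "{z \<in> space (lborel \<Otimes>\<^sub>M lborel). fst z \<noteq> (snd z :: 'a)} \<in> sets (lborel \<Otimes>\<^sub>M lborel)"
      unfolding lborel_prod by simp
    show "AE x in lborel. AE y in lborel. fst (x, y) \<noteq> snd (x, y :: 'a)"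
    proof (rule AE_I2)
      fix x :: 'a
      show "AE y in lborel. fst (x, y) \<noteq> snd (x, y)"
        using AE_lborel_singleton[of x] by eventually_elim auto
    qed
  qed
  then show ?thesis unfolding lborel_prod by (rule AE_completion)
qed

text \<open>Meant for increments of zero seminorm: their remainder estimate holds at every scale
  \<eta>, which forces the remainder to vanish.\<close>

lemma zero_of_le_powr:
  fixes x B r :: real
  assumes "1 < r" and le: "\<And>\<eta>. 0 < \<eta> \<Longrightarrow> \<eta> \<le> 1 \<Longrightarrow> \<bar>x\<bar> \<le> B * \<eta> powr r"
  shows "x = 0"
proof -
  have "((\<lambda>\<eta>. B * \<bar>\<eta>\<bar> powr r) \<longlongrightarrow> B * \<bar>0\<bar> powr r) (at (0::real))"
    using assms(1) by (intro tendsto_intros) auto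
  then have "((\<lambda>\<eta>. B * \<bar>\<eta>\<bar> powr r) \<longlongrightarrow> 0) (at (0::real))" by simp
  moreover have "\<forall>\<^sub>F \<eta> in at (0::real). \<bar>x\<bar> \<le> B * \<bar>\<eta>\<bar> powr r"
    unfolding eventually_at using le by (intro exI[of _ 1]) auto
  ultimately have "\<bar>x\<bar> \<le> 0" by (rule tendsto_lowerbound) simp
  then show ?thesis by simp
qed

section \<open>The energy functional\<close>

text \<open>Extending a coefficient by zero turns integrals over \<Omega> into integrals over the
  whole space.\<close>

lemma L_infty_zero_extension:
  fixes \<Omega> :: "'a::euclidean_space set"
  assumes "L_infty \<Omega> f"
  obtains c where "0 < c" "(\<lambda>x. indicator \<Omega> x * f x) \<in> borel_measurable lebesgue"
    "AE x in lebesgue. \<bar>indicator \<Omega> x * f x\<bar> \<le> c"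
proof -
  obtain C where C: "AE x in lebesgue. x \<in> \<Omega> \<longrightarrow> \<bar>f x\<bar> \<le> C"
    using assms by (auto simp: L_infty_def)
  show ?thesis
  proof (rule that[of "\<bar>C\<bar> + 1"])
    show "(\<lambda>x. indicator \<Omega> x * f x) \<in> borel_measurable lebesgue"
      using assms by (simp add: L_infty_def set_borel_measurable_def)
    show "AE x in lebesgue. \<bar>indicator \<Omega> x * f x\<bar> \<le> \<bar>C\<bar> + 1"
      using C by eventually_elim (auto simp: indicator_def)
  qed simp
qed

lemma abs_diff_diff_le: "\<bar>x - y - z\<bar> \<le> \<bar>x\<bar> + \<bar>y\<bar> + \<bar>z\<bar>" for x y z :: real
  by linarith

text \<open>\<open>CA\<close> is here the constant of \<open>power_growth\<close>, thus a local
  Lipschitz constant of \<open>A\<close>, and not the growth constant of the original problem. The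
  assumptions on the coefficients concern their zero extensions.\<close>

locale nehari_problem =
  fixes \<Omega> :: "(real^'n) set"
    and s l p m m1 m2 cA CA b0 b1 ca cb :: real
    and A A' :: "real \<Rightarrow> real"
    and K :: "real^'n \<Rightarrow> real^'n \<Rightarrow> real"
    and a b :: "real^'n \<Rightarrow> real"
  assumes \<Omega>: "open \<Omega>" "bounded \<Omega>"
    and s: "0 < s" "s < 1"
    and exponents: "1 < m1" "m1 < l" "l \<le> p" "p \<le> m" "m < m2"
      "m2 < real CARD('n) * p / (real CARD('n) - s * p)" "s * p < real CARD('n)"
    and p2: "2 \<le> p"
    and A_deriv: "\<And>t. (A has_real_derivative A' t) (at t)" and A'_cont: "\<And>t. isCont A' t"
    and A_growth: "0 < cA" "0 < CA" "\<And>t. cA * \<bar>t\<bar> powr p \<le> A t * t"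
      "power_growth p 2 CA (even_primitive A) A"
    and A_i: "\<And>t. A t * t \<le> p * even_primitive A t"
    and A_ii: "\<And>t. (l - 1) * (A t * t) \<le> t^2 * A' t" "\<And>t. t^2 * A' t \<le> (m - 1) * (A t * t)"
    and K_meas: "(\<lambda>(x, y). K x y) \<in> borel_measurable lebesgue"
    and K_nonneg: "\<And>x y. 0 \<le> K x y"
    and K_bounds: "0 < b0" "0 < b1"
      "\<And>x y. x \<noteq> y \<Longrightarrow> b0 \<le> K x y * norm (x - y) powr (real CARD('n) + s * p)"
      "\<And>x y. x \<noteq> y \<Longrightarrow> K x y * norm (x - y) powr (real CARD('n) + s * p) \<le> b1"
    and a: "(\<lambda>x. indicator \<Omega> x * a x) \<in> borel_measurable lebesgue" "0 < ca"
      "AE x in lebesgue. \<bar>indicator \<Omega> x * a x\<bar> \<le> ca"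
      "\<not> (AE x in lebesgue. indicator \<Omega> x * a x \<le> 0)"
    and b: "(\<lambda>x. indicator \<Omega> x * b x) \<in> borel_measurable lebesgue" "0 < cb"
      "AE x in lebesgue. \<bar>indicator \<Omega> x * b x\<bar> \<le> cb"
begin

abbreviation W :: "(real^'n \<Rightarrow> real) set" where "W \<equiv> frac_sobolev0 s p \<Omega>"
abbreviation G :: "(real^'n \<Rightarrow> real) \<Rightarrow> real" where "G \<equiv> gagliardo s p"
abbreviation wt :: "(real^'n) \<times> (real^'n) \<Rightarrow> real" where "wt \<equiv> gagliardo_weight s p"
abbreviation kk :: "(real^'n) \<times> (real^'n) \<Rightarrow> real" where "kk \<equiv> \<lambda>(x, y). K x y"
abbreviation a\<^sub>\<Omega> :: "real^'n \<Rightarrow> real" where "a\<^sub>\<Omega> \<equiv> \<lambda>x. indicator \<Omega> x * a x"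
abbreviation b\<^sub>\<Omega> :: "real^'n \<Rightarrow> real" where "b\<^sub>\<Omega> \<equiv> \<lambda>x. indicator \<Omega> x * b x"

lemma p1: "1 < p" "0 < p" and m2_1: "1 < m2" and ps: "p < real CARD('n) * p / (real CARD('n) - s * p)"
  and m1p: "m1 < p" and pm2: "p < m2"
  using exponents p2 by auto

text \<open>On the diagonal the weight is \<open>1 / 0 = 0\<close> while \<open>K\<close> is arbitrary, so the bound
  holds only almost everywhere.\<close>

lemma K_le: "AE z in lebesgue. \<bar>kk z\<bar> \<le> b1 * wt z"
  using AE_off_diagonal
proof eventually_elim
  case (elim z)
  obtain x y where z: "z = (x, y)" "x \<noteq> y" using elim by (cases z) auto
  then have "0 < norm (x - y) powr (real CARD('n) + s * p)" by simp
  then show ?case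
    using K_bounds(4)[OF z(2)] K_nonneg[of x y] by (simp add: z gagliardo_weight_def field_simps)
qed

sublocale E: weighted_power_growth p 2 CA "even_primitive A" A lebesgue kk wt b1
  using A_growth K_meas K_bounds K_le
  by (auto simp: weighted_power_growth_def weighted_power_growth_axioms_def
      gagliardo_weight_nonneg gagliardo_weight_measurable)

text \<open>The energy \<open>G\<close> as a functional of the same kind. Its derivative along lines
  gives the continuity by which small perturbations stay inside the ball.\<close>

sublocale S: weighted_power_growth p "min p 2" "2 * p * p" "\<lambda>t. \<bar>t\<bar> powr p" "\<lambda>t. p * (\<bar>t\<bar> powr (p - 2) * t)"
    lebesgue wt wt 1
  by (rule weighted_power_growth_gagliardo) (rule p1)

sublocale F: weighted_power_growth m1 "min m1 2" "2 * m1 * m1" "\<lambda>t. \<bar>t\<bar> powr m1"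
    "\<lambda>t. m1 * (\<bar>t\<bar> powr (m1 - 2) * t)" lebesgue a\<^sub>\<Omega> "\<lambda>_. 1" ca
  using a exponents by (intro weighted_power_growth_lebesgue) auto

sublocale H: weighted_power_growth m2 "min m2 2" "2 * m2 * m2" "\<lambda>t. \<bar>t\<bar> powr m2"
    "\<lambda>t. m2 * (\<bar>t\<bar> powr (m2 - 2) * t)" lebesgue b\<^sub>\<Omega> "\<lambda>_. 1" cb
  using b m2_1 by (intro weighted_power_growth_lebesgue) auto

section \<open>The terms of the energy and its Frechet derivative\<close>

definition \<Phi> :: "(real^'n \<Rightarrow> real) \<Rightarrow> real" where
  "\<Phi> u = (LINT z|lebesgue. even_primitive A (pair_diff u z) * kk z)"
definition fa :: "(real^'n \<Rightarrow> real) \<Rightarrow> real" where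
  "fa u = (LINT x|lebesgue. \<bar>u x\<bar> powr m1 * a\<^sub>\<Omega> x)"
definition fb :: "(real^'n \<Rightarrow> real) \<Rightarrow> real" where
  "fb u = (LINT x|lebesgue. \<bar>u x\<bar> powr m2 * b\<^sub>\<Omega> x)"
definition dual\<Phi> :: "(real^'n \<Rightarrow> real) \<Rightarrow> (real^'n \<Rightarrow> real) \<Rightarrow> real" where
  "dual\<Phi> u v = (LINT z|lebesgue. A (pair_diff u z) * pair_diff v z * kk z)"
text \<open>The derivative of \<open>fa\<close> including its factor \<open>m1\<close>, which the
  factor \<open>lam / m1\<close> in \<open>L\<close> removes again; likewise for
  \<open>dual_b\<close>.\<close>

definition dual_a :: "(real^'n \<Rightarrow> real) \<Rightarrow> (real^'n \<Rightarrow> real) \<Rightarrow> real" where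
  "dual_a u v = (LINT x|lebesgue. m1 * (\<bar>u x\<bar> powr (m1 - 2) * u x) * v x * a\<^sub>\<Omega> x)"
definition dual_b :: "(real^'n \<Rightarrow> real) \<Rightarrow> (real^'n \<Rightarrow> real) \<Rightarrow> real" where
  "dual_b u v = (LINT x|lebesgue. m2 * (\<bar>u x\<bar> powr (m2 - 2) * u x) * v x * b\<^sub>\<Omega> x)"
definition L :: "real \<Rightarrow> (real^'n \<Rightarrow> real) \<Rightarrow> (real^'n \<Rightarrow> real) \<Rightarrow> real" where
  "L lam u v = dual\<Phi> u v - lam / m1 * dual_a u v - 1 / m2 * dual_b u v"

abbreviation J :: "real \<Rightarrow> (real^'n \<Rightarrow> real) \<Rightarrow> real" where
  "J lam \<equiv> energy \<Omega> A K a b m1 m2 lam"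

lemma J_eq: "J lam u = \<Phi> u - lam / m1 * fa u - 1 / m2 * fb u"
proof -
  have "(\<lambda>(x, y). even_primitive A (u x - u y) * K x y) = (\<lambda>z. even_primitive A (pair_diff u z) * kk z)"
    by (auto simp: pair_diff_def fun_eq_iff)
  moreover have "(LINT x:\<Omega>|lebesgue. a x * \<bar>u x\<bar> powr m1) = fa u"
    "(LINT x:\<Omega>|lebesgue. b x * \<bar>u x\<bar> powr m2) = fb u"
    unfolding fa_def fb_def set_lebesgue_integral_def
    by (auto intro!: Bochner_Integration.integral_cong simp: mult_ac)
  ultimately show ?thesis by (simp add: energy_def \<Phi>_def)
qed

text \<open>Fixing the embedding constants by choice makes them terms of the locale, from which the
  radius and the bound on \<open>lam\<close> can be defined.\<close>

definition C1 :: real where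
  "C1 = (SOME C. 0 \<le> C \<and> (\<forall>u t. u \<in> W \<longrightarrow> 0 < t \<longrightarrow> G u \<le> t powr p \<longrightarrow>
    integrable lebesgue (\<lambda>x. \<bar>u x\<bar> powr m1) \<and> (LINT x|lebesgue. \<bar>u x\<bar> powr m1) \<le> C * t powr m1))"
definition C2 :: real where
  "C2 = (SOME C. 0 \<le> C \<and> (\<forall>u t. u \<in> W \<longrightarrow> 0 < t \<longrightarrow> G u \<le> t powr p \<longrightarrow>
    integrable lebesgue (\<lambda>x. \<bar>u x\<bar> powr m2) \<and> (LINT x|lebesgue. \<bar>u x\<bar> powr m2) \<le> C * t powr m2))"

lemma embedding_ex:
  assumes "0 < q" "q < real CARD('n) * p / (real CARD('n) - s * p)"
  shows "\<exists>C. 0 \<le> C \<and> (\<forall>u t. u \<in> W \<longrightarrow> 0 < t \<longrightarrow> G u \<le> t powr p \<longrightarrow>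
    integrable lebesgue (\<lambda>x. \<bar>u x\<bar> powr q) \<and> (LINT x|lebesgue. \<bar>u x\<bar> powr q) \<le> C * t powr q)"
  by (rule fractional_sobolev_subcritical[OF \<Omega> s(1) p1(2) exponents(7) assms]) blast

lemma C1: "0 \<le> C1"
  "u \<in> W \<Longrightarrow> 0 < t \<Longrightarrow> G u \<le> t powr p \<Longrightarrow> integrable lebesgue (\<lambda>x. \<bar>u x\<bar> powr m1)"
  "u \<in> W \<Longrightarrow> 0 < t \<Longrightarrow> G u \<le> t powr p \<Longrightarrow> (LINT x|lebesgue. \<bar>u x\<bar> powr m1) \<le> C1 * t powr m1"
  using someI_ex[OF embedding_ex[of m1]] exponents m1p ps unfolding C1_def[symmetric] by auto

lemma C2: "0 \<le> C2"
  "u \<in> W \<Longrightarrow> 0 < t \<Longrightarrow> G u \<le> t powr p \<Longrightarrow> integrable lebesgue (\<lambda>x. \<bar>u x\<bar> powr m2)"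
  "u \<in> W \<Longrightarrow> 0 < t \<Longrightarrow> G u \<le> t powr p \<Longrightarrow> (LINT x|lebesgue. \<bar>u x\<bar> powr m2) \<le> C2 * t powr m2"
  using someI_ex[OF embedding_ex[of m2]] exponents m2_1 unfolding C2_def[symmetric] by auto

lemma W_scale: "u \<in> W \<Longrightarrow> (\<lambda>x. c * u x) \<in> W" "u \<in> W \<Longrightarrow> G (\<lambda>x. c * u x) = \<bar>c\<bar> powr p * G u"
  using frac_sobolev0_scale p1 by blast+

lemma W_add: "u \<in> W \<Longrightarrow> v \<in> W \<Longrightarrow> (\<lambda>x. u x + v x) \<in> W"
  using frac_sobolev0_add p1 by blast

lemma W_spaces:
  assumes u: "u \<in> W"
  shows "pair_diff u \<in> E.mod_space" "u \<in> F.mod_space" "u \<in> H.mod_space"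
proof -
  show "pair_diff u \<in> E.mod_space" using u by (simp add: frac_sobolev0_iff)
  define t where "t = (G u + 1) powr (1 / p)"
  have "0 < G u + 1" using gagliardo_ge_0[of s p u] by linarith
  then have t: "0 < t" "G u \<le> t powr p" using p1 by (auto simp: t_def powr_powr)
  show "u \<in> F.mod_space" "u \<in> H.mod_space"
    using u C1(2)[OF u t] C2(2)[OF u t] by (auto simp: frac_sobolev0_iff weighted_Lp_def)
qed

lemma modular_G: "E.modular (pair_diff u) = G u"
  by (simp add: gagliardo_eq_modular)

lemma modular_le:
  assumes "u \<in> W" "0 < t" "G u \<le> t powr p"
  shows "F.modular u \<le> C1 * t powr m1" "H.modular u \<le> C2 * t powr m2"
  using C1(3)[OF assms] C2(3)[OF assms] by (auto simp: weighted_modular_def)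

lemma L_add:
  assumes "u \<in> W" "v \<in> W" "w \<in> W"
  shows "L lam u (\<lambda>x. v x + w x) = L lam u v + L lam u w"
proof -
  have "dual\<Phi> u (\<lambda>x. v x + w x) = dual\<Phi> u v + dual\<Phi> u w"
    using E.AV_bound(1)[OF W_spaces(1) W_spaces(1)] assms
    by (simp add: dual\<Phi>_def pair_diff_simps distrib_left distrib_right)
  moreover have "dual_a u (\<lambda>x. v x + w x) = dual_a u v + dual_a u w"
    using F.AV_bound(1)[OF W_spaces(2) W_spaces(2)] assms
    by (simp add: dual_a_def distrib_left distrib_right)
  moreover have "dual_b u (\<lambda>x. v x + w x) = dual_b u v + dual_b u w"
    using H.AV_bound(1)[OF W_spaces(3) W_spaces(3)] assms
    by (simp add: dual_b_def distrib_left distrib_right)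
  ultimately show ?thesis by (simp add: L_def algebra_simps)
qed

lemma L_scale: "L lam u (\<lambda>x. c * v x) = c * L lam u v"
proof -
  have "dual\<Phi> u (\<lambda>x. c * v x) = c * dual\<Phi> u v"
    unfolding dual\<Phi>_def pair_diff_simps by (subst integral_mult_right_zero[symmetric]) (simp add: mult_ac)
  moreover have "dual_a u (\<lambda>x. c * v x) = c * dual_a u v"
    unfolding dual_a_def by (subst integral_mult_right_zero[symmetric]) (simp add: mult_ac)
  moreover have "dual_b u (\<lambda>x. c * v x) = c * dual_b u v"
    unfolding dual_b_def by (subst integral_mult_right_zero[symmetric]) (simp add: mult_ac)
  ultimately show ?thesis by (simp add: L_def algebra_simps)
qed

lemma gagliardo_norm_eq: "gagliardo_norm s p u = G u powr (1 / p)"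
  by (simp add: gagliardo_norm_def gagliardo_def)

lemma gagliardo_norm_powr: "gagliardo_norm s p u powr p = G u"
  using gagliardo_ge_0[of s p u] p1 by (simp add: gagliardo_norm_eq powr_powr)

lemma gagliardo_norm_nonneg: "0 \<le> gagliardo_norm s p (u :: real^'n \<Rightarrow> real)"
  by (simp add: gagliardo_norm_eq)

text \<open>\<open>AV_bound\<close> controls \<open>L\<close> on increments with
  \<open>G v \<le> 1\<close>, and scaling turns this into a linear bound. An increment of zero
  seminorm has all its multiples in the unit ball, so \<open>L\<close> must vanish on it.\<close>

lemma L_bounded:
  assumes u: "u \<in> W"
  obtains B where "0 \<le> B" "\<And>v. v \<in> W \<Longrightarrow> \<bar>L lam u v\<bar> \<le> B * gagliardo_norm s p v"
proof -
  define B where "B = CA * b1 * (G u + 1) + \<bar>lam / m1\<bar> * (2 * m1 * m1 * ca * (F.modular u + C1))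
    + \<bar>1 / m2\<bar> * (2 * m2 * m2 * cb * (H.modular u + C2))"
  have unit: "\<bar>L lam u v\<bar> \<le> B" if v: "v \<in> W" "G v \<le> 1" for v
  proof -
    have G1: "G v \<le> 1 powr p" using v by simp
    have "\<bar>dual\<Phi> u v\<bar> \<le> CA * b1 * (E.modular (pair_diff u) + E.modular (pair_diff v))"
      unfolding dual\<Phi>_def using u v by (intro E.AV_bound(2) W_spaces)
    also have "\<dots> \<le> CA * b1 * (G u + 1)"
      using v E.C E.c by (intro mult_left_mono) (auto simp: modular_G)
    finally have 1: "\<bar>dual\<Phi> u v\<bar> \<le> CA * b1 * (G u + 1)" .
    have "\<bar>dual_a u v\<bar> \<le> 2 * m1 * m1 * ca * (F.modular u + F.modular v)"
      unfolding dual_a_def using u v by (intro F.AV_bound(2) W_spaces)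
    also have "\<dots> \<le> 2 * m1 * m1 * ca * (F.modular u + C1)"
      using modular_le(1)[OF v(1) _ G1] F.C F.c by (intro mult_left_mono) auto
    finally have 2: "\<bar>dual_a u v\<bar> \<le> 2 * m1 * m1 * ca * (F.modular u + C1)" .
    have "\<bar>dual_b u v\<bar> \<le> 2 * m2 * m2 * cb * (H.modular u + H.modular v)"
      unfolding dual_b_def using u v by (intro H.AV_bound(2) W_spaces)
    also have "\<dots> \<le> 2 * m2 * m2 * cb * (H.modular u + C2)"
      using modular_le(2)[OF v(1) _ G1] H.C H.c by (intro mult_left_mono) auto
    finally have 3: "\<bar>dual_b u v\<bar> \<le> 2 * m2 * m2 * cb * (H.modular u + C2)" .
    have "\<bar>L lam u v\<bar> \<le> \<bar>dual\<Phi> u v\<bar> + \<bar>lam / m1\<bar> * \<bar>dual_a u v\<bar> + \<bar>1 / m2\<bar> * \<bar>dual_b u v\<bar>"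
      unfolding L_def abs_mult[symmetric] by (rule abs_diff_diff_le)
    also have "\<dots> \<le> B" unfolding B_def using 1 2 3 by (intro add_mono mult_left_mono) auto
    finally show ?thesis .
  qed
  have B0: "0 \<le> B" using unit[OF W_scale(1)[OF u, of 0]] W_scale(2)[OF u, of 0] by force
  show ?thesis
  proof (rule that[OF B0])
    fix v assume v: "v \<in> W"
    show "\<bar>L lam u v\<bar> \<le> B * gagliardo_norm s p v"
    proof (cases "G v = 0")
      case False
      define n where "n = gagliardo_norm s p v"
      have n: "0 < n" using False gagliardo_ge_0[of s p v] by (auto simp: n_def gagliardo_norm_eq)
      have "G (\<lambda>x. 1 / n * v x) = 1"
        using n False gagliardo_norm_powr[of v] by (subst W_scale(2)[OF v]) (simp add: n_def powr_divide)
      then have "\<bar>L lam u (\<lambda>x. 1 / n * v x)\<bar> \<le> B"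
        using W_scale(1)[OF v, of "1 / n"] by (intro unit) simp_all
      then have "\<bar>L lam u v\<bar> / n \<le> B" unfolding L_scale using n by (simp add: abs_mult)
      then show ?thesis using n by (simp add: n_def[symmetric] field_simps)
    next
      case True
      have "L lam u v = 0"
      proof (rule ccontr)
        assume ne: "L lam u v \<noteq> 0"
        define c where "c = (B + 1) / \<bar>L lam u v\<bar>"
        have "G (\<lambda>x. c * v x) \<le> 1" using True by (simp add: W_scale(2)[OF v])
        then have "\<bar>c * L lam u v\<bar> \<le> B" unfolding L_scale[symmetric] using W_scale(1)[OF v] by (intro unit)
        then show False using ne B0 by (simp add: c_def abs_mult)
      qed
      then show ?thesis using B0 gagliardo_norm_nonneg[of v] by simp
    qed
  qed
qed

text \<open>If \<open>G h \<le> \<eta> powr p\<close>, the embedding bounds the modulars of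
  \<open>h\<close> by multiples of \<open>\<eta> powr m1\<close> and \<open>\<eta> powr m2\<close>,
  so each quotient in \<open>remainder\<close> is bounded. The powers of \<eta> gained have
  exponents \<open>2\<close>, \<open>min m1 2\<close> and \<open>min m2 2\<close>; for
  \<open>\<eta> \<le> 1\<close> the middle one is the largest.\<close>

lemma remainder_le:
  assumes u: "u \<in> W"
  obtains B where "0 \<le> B" "\<And>h \<eta>. h \<in> W \<Longrightarrow> 0 < \<eta> \<Longrightarrow> \<eta> \<le> 1 \<Longrightarrow> G h \<le> \<eta> powr p \<Longrightarrow>
    \<bar>J lam (\<lambda>x. u x + h x) - J lam u - L lam u h\<bar> \<le> B * \<eta> powr (min m1 2)"
proof -
  define r where "r = min m1 2"
  define B1 where "B1 = CA * b1 * 2 powr p * (G u + 1)"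
  define B2 where "B2 = 2 * m1 * m1 * ca * 2 powr m1 * (F.modular u + C1)"
  define B3 where "B3 = 2 * m2 * m2 * cb * 2 powr m2 * (H.modular u + C2)"
  have modn: "0 \<le> F.modular u" "0 \<le> H.modular u"
    by (auto simp: weighted_modular_def intro!: integral_nonneg_AE)
  have Bs: "0 \<le> B1" "0 \<le> B2" "0 \<le> B3"
    unfolding B1_def B2_def B3_def
    using E.C E.c F.C F.c H.C H.c modn C1(1) C2(1) gagliardo_ge_0[of s p u]
    by (auto intro!: mult_nonneg_nonneg add_nonneg_nonneg)
  define B where "B = B1 + \<bar>lam / m1\<bar> * B2 + \<bar>1 / m2\<bar> * B3"
  have B0: "0 \<le> B" using Bs by (simp add: B_def)
  show ?thesis
  proof (rule that[OF B0])
    fix h \<eta> assume h: "h \<in> W" and \<eta>: "0 < \<eta>" "\<eta> \<le> 1" and Gh: "G h \<le> \<eta> powr p"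
    have pw: "\<eta> powr r' \<le> \<eta> powr r" if "r \<le> r'" for r' using \<eta> that by (intro powr_mono') auto
    define R1 where "R1 = \<Phi> (\<lambda>x. u x + h x) - \<Phi> u - dual\<Phi> u h"
    define R2 where "R2 = fa (\<lambda>x. u x + h x) - fa u - dual_a u h"
    define R3 where "R3 = fb (\<lambda>x. u x + h x) - fb u - dual_b u h"
    have "\<bar>R1\<bar> \<le> CA * b1 * 2 powr p * \<eta> powr 2 * (E.modular (pair_diff u) + E.modular (pair_diff h) / \<eta> powr p)"
      unfolding R1_def \<Phi>_def dual\<Phi>_def pair_diff_simps
      by (rule E.remainder[OF W_spaces(1)[OF u] W_spaces(1)[OF h] \<eta>])
    also have "\<dots> \<le> CA * b1 * 2 powr p * \<eta> powr r * (G u + 1)"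
      using Gh \<eta> E.C E.c gagliardo_ge_0[of s p u] gagliardo_ge_0[of s p h] pw[of 2]
      by (intro mult_mono) (auto simp: modular_G r_def divide_le_eq_1 intro!: mult_nonneg_nonneg add_nonneg_nonneg)
    finally have 1: "\<bar>R1\<bar> \<le> B1 * \<eta> powr r" by (simp add: B1_def mult_ac)
    have "\<bar>R2\<bar> \<le> 2 * m1 * m1 * ca * 2 powr m1 * \<eta> powr (min m1 2) * (F.modular u + F.modular h / \<eta> powr m1)"
      unfolding R2_def fa_def dual_a_def by (rule F.remainder[OF W_spaces(2)[OF u] W_spaces(2)[OF h] \<eta>])
    also have "\<dots> \<le> 2 * m1 * m1 * ca * 2 powr m1 * \<eta> powr r * (F.modular u + C1)"
      using modular_le(1)[OF h \<eta>(1) Gh] \<eta> F.C F.c unfolding r_def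
      by (intro mult_left_mono) (auto simp: divide_le_eq)
    finally have 2: "\<bar>R2\<bar> \<le> B2 * \<eta> powr r" by (simp add: B2_def mult_ac)
    have "\<bar>R3\<bar> \<le> 2 * m2 * m2 * cb * 2 powr m2 * \<eta> powr (min m2 2) * (H.modular u + H.modular h / \<eta> powr m2)"
      unfolding R3_def fb_def dual_b_def by (rule H.remainder[OF W_spaces(3)[OF u] W_spaces(3)[OF h] \<eta>])
    also have "\<dots> \<le> 2 * m2 * m2 * cb * 2 powr m2 * \<eta> powr (min m2 2) * (H.modular u + C2)"
      using modular_le(2)[OF h \<eta>(1) Gh] \<eta> H.C H.c
      by (intro mult_left_mono) (auto simp: divide_le_eq)
    also have "\<dots> = B3 * \<eta> powr (min m2 2)" by (simp add: B3_def mult_ac)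
    also have "\<dots> \<le> B3 * \<eta> powr r"
      using Bs pw[of "min m2 2"] m1p pm2 by (intro mult_left_mono) (auto simp: r_def)
    finally have 3: "\<bar>R3\<bar> \<le> B3 * \<eta> powr r" .
    have "J lam (\<lambda>x. u x + h x) - J lam u - L lam u h = R1 - lam / m1 * R2 - 1 / m2 * R3"
      by (simp add: J_eq L_def R1_def R2_def R3_def algebra_simps)
    also have "\<bar>\<dots>\<bar> \<le> \<bar>R1\<bar> + \<bar>lam / m1\<bar> * \<bar>R2\<bar> + \<bar>1 / m2\<bar> * \<bar>R3\<bar>"
      unfolding abs_mult[symmetric] by (rule abs_diff_diff_le)
    also have "\<dots> \<le> B1 * \<eta> powr r + \<bar>lam / m1\<bar> * (B2 * \<eta> powr r) + \<bar>1 / m2\<bar> * (B3 * \<eta> powr r)"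
      using 1 2 3 by (intro add_mono mult_left_mono) auto
    also have "\<dots> = B * \<eta> powr r" by (simp add: B_def algebra_simps)
    finally show "\<bar>J lam (\<lambda>x. u x + h x) - J lam u - L lam u h\<bar> \<le> B * \<eta> powr (min m1 2)"
      by (simp add: r_def)
  qed
qed

text \<open>The seminorm of the increment serves as \<eta>; the remainder is then of order
  \<open>min m1 2\<close>, which exceeds one.\<close>

lemma J_frechet:
  assumes u: "u \<in> W"
  shows "has_frechet_derivative_W0 s p \<Omega> (J lam) u (L lam u)"
  unfolding has_frechet_derivative_W0_def
proof (intro conjI ballI allI impI)
  show "L lam u (\<lambda>x. v x + w x) = L lam u v + L lam u w" if "v \<in> W" "w \<in> W" for v w
    using L_add u that by blast
  show "L lam u (\<lambda>x. c * v x) = c * L lam u v" for v c by (rule L_scale)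
  show "\<exists>C. \<forall>v\<in>W. \<bar>L lam u v\<bar> \<le> C * gagliardo_norm s p v"
  proof -
    obtain B where "0 \<le> B" "\<And>v. v \<in> W \<Longrightarrow> \<bar>L lam u v\<bar> \<le> B * gagliardo_norm s p v"
      by (rule L_bounded[OF u, of lam]) (rule that)
    then show ?thesis by blast
  qed
  fix \<epsilon> :: real assume \<epsilon>: "0 < \<epsilon>"
  define r where "r = min m1 2"
  have r: "1 < r" using exponents by (simp add: r_def)
  obtain B where B0: "0 \<le> B" and B1: "\<And>h \<eta>. h \<in> W \<Longrightarrow> 0 < \<eta> \<Longrightarrow> \<eta> \<le> 1 \<Longrightarrow> G h \<le> \<eta> powr p \<Longrightarrow>
    \<bar>J lam (\<lambda>x. u x + h x) - J lam u - L lam u h\<bar> \<le> B * \<eta> powr (min m1 2)"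
    by (rule remainder_le[OF u, of lam]) (rule that)
  note B = B0 B1[folded r_def]
  \<comment> \<open>Chosen so that \<open>B * \<delta> powr (r - 1) \<le> \<epsilon>\<close>: the
    remainder \<open>B * n powr r\<close> then keeps one factor \<open>n\<close>.\<close>
  define \<delta> where "\<delta> = min 1 ((\<epsilon> / (B + 1)) powr (1 / (r - 1)))"
  have \<delta>: "0 < \<delta>" "\<delta> \<le> 1" using \<epsilon> B by (auto simp: \<delta>_def)
  have "\<delta> powr (r - 1) \<le> ((\<epsilon> / (B + 1)) powr (1 / (r - 1))) powr (r - 1)"
    using r \<delta> by (intro powr_mono2) (auto simp: \<delta>_def)
  also have "\<dots> = \<epsilon> / (B + 1)" using r \<epsilon> B by (simp add: powr_powr)
  finally have \<delta>r: "\<delta> powr (r - 1) \<le> \<epsilon> / (B + 1)" .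
  show "\<exists>\<delta>>0. \<forall>h\<in>W. gagliardo_norm s p h < \<delta> \<longrightarrow>
    \<bar>J lam (\<lambda>x. u x + h x) - J lam u - L lam u h\<bar> \<le> \<epsilon> * gagliardo_norm s p h"
  proof (intro exI[of _ \<delta>] conjI ballI impI \<delta>(1))
    fix h assume h: "h \<in> W" "gagliardo_norm s p h < \<delta>"
    define n where "n = gagliardo_norm s p h"
    show "\<bar>J lam (\<lambda>x. u x + h x) - J lam u - L lam u h\<bar> \<le> \<epsilon> * gagliardo_norm s p h"
    proof (cases "n = 0")
      case True
      then have "G h = 0" using gagliardo_norm_powr[of h] by (simp add: n_def)
      then have "J lam (\<lambda>x. u x + h x) - J lam u - L lam u h = 0"
        by (intro zero_of_le_powr[OF r, of _ B] B(2) h) auto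
      then show ?thesis using True by (simp add: n_def)
    next
      case False
      then have n: "0 < n" using gagliardo_norm_nonneg[of h] by (simp add: n_def)
      have "\<bar>J lam (\<lambda>x. u x + h x) - J lam u - L lam u h\<bar> \<le> B * n powr r"
        using n h \<delta> gagliardo_norm_powr[of h] by (intro B(2)) (auto simp: n_def)
      also have "\<dots> = B * n powr (r - 1) * n" using n by (simp add: powr_diff)
      also have "\<dots> \<le> B * (\<epsilon> / (B + 1)) * n"
      proof (intro mult_right_mono mult_left_mono)
        have "n powr (r - 1) \<le> \<delta> powr (r - 1)" using n h r by (intro powr_mono2) (auto simp: n_def)
        with \<delta>r show "n powr (r - 1) \<le> \<epsilon> / (B + 1)" by linarith
      qed (use n B in auto)
      also have "\<dots> \<le> \<epsilon> * n" using n B \<epsilon> by (intro mult_right_mono) (auto simp: field_simps)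
      finally show ?thesis by (simp add: n_def)
    qed
  qed
qed

section \<open>Fibering maps\<close>

text \<open>The Nehari condition only asserts some Frechet derivative \<open>D\<close>. On
  increments that are multiples of \<open>u\<close> the definition determines \<open>D u\<close> as
  a fibering derivative, which makes it comparable with the explicit formula.\<close>

lemma frechet_imp_fibering_deriv:
  assumes u: "u \<in> W" and fr: "has_frechet_derivative_W0 s p \<Omega> j u D"
  shows "(fibering j u has_real_derivative D u) (at 1)"
proof -
  have "((\<lambda>e. (fibering j u (1 + e) - fibering j u 1) / e - D u) \<longlongrightarrow> 0) (at 0)"
  proof (rule tendstoI)
    fix \<epsilon> :: real assume \<epsilon>: "0 < \<epsilon>"
    define n where "n = gagliardo_norm s p u"
    have n: "0 \<le> n" by (simp add: n_def gagliardo_norm_nonneg)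
    define \<epsilon>' where "\<epsilon>' = \<epsilon> / (n + 1) / 2"
    have \<epsilon>': "0 < \<epsilon>'" using \<epsilon> n by (simp add: \<epsilon>'_def add_nonneg_pos)
    obtain \<delta> where \<delta>: "0 < \<delta>" "\<And>h. h \<in> W \<Longrightarrow> gagliardo_norm s p h < \<delta> \<Longrightarrow>
        \<bar>j (\<lambda>x. u x + h x) - j u - D h\<bar> \<le> \<epsilon>' * gagliardo_norm s p h"
      using fr \<epsilon>' unfolding has_frechet_derivative_W0_def by blast
    have D: "D (\<lambda>x. c * u x) = c * D u" for c
      using fr u unfolding has_frechet_derivative_W0_def by blast
    show "\<forall>\<^sub>F e in at 0. dist ((fibering j u (1 + e) - fibering j u 1) / e - D u) 0 < \<epsilon>"
      unfolding eventually_at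
    proof (intro exI[of _ "\<delta> / (n + 1)"] conjI ballI impI)
      show "0 < \<delta> / (n + 1)" using \<delta> n by (simp add: add_nonneg_pos)
      fix e :: real assume "e \<noteq> 0 \<and> dist e 0 < \<delta> / (n + 1)"
      then have e: "e \<noteq> 0" "\<bar>e\<bar> * (n + 1) < \<delta>" using n by (auto simp: field_simps)
      have nh: "gagliardo_norm s p (\<lambda>x. e * u x) = \<bar>e\<bar> * n"
        using p1 gagliardo_ge_0[of s p u] by (simp add: gagliardo_norm_eq W_scale(2)[OF u] powr_mult powr_powr n_def)
      have "\<bar>e\<bar> * n < \<delta>" using e(2) by (simp add: distrib_left)
      have eq: "(\<lambda>x. u x + e * u x) = (\<lambda>x. (1 + e) * u x)"
        by (simp add: distrib_right)
      from \<open>\<bar>e\<bar> * n < \<delta>\<close> have "\<bar>j (\<lambda>x. u x + e * u x) - j u - D (\<lambda>x. e * u x)\<bar> \<le> \<epsilon>' * (\<bar>e\<bar> * n)"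
        using \<delta>(2)[OF W_scale(1)[OF u, of e]] by (simp add: nh)
      then have "\<bar>fibering j u (1 + e) - fibering j u 1 - e * D u\<bar> \<le> \<epsilon>' * n * \<bar>e\<bar>"
        unfolding eq by (simp add: fibering_def D mult_ac)
      moreover have "(fibering j u (1 + e) - fibering j u 1) / e - D u
          = (fibering j u (1 + e) - fibering j u 1 - e * D u) / e"
        using e by (simp add: field_simps)
      ultimately have "\<bar>(fibering j u (1 + e) - fibering j u 1) / e - D u\<bar> \<le> \<epsilon>' * n"
        using e by (simp add: abs_divide divide_le_eq)
      also have "\<dots> \<le> \<epsilon> / 2" using n \<epsilon> by (simp add: \<epsilon>'_def field_simps)
      also have "\<dots> < \<epsilon>" using \<epsilon> by simp
      finally show "dist ((fibering j u (1 + e) - fibering j u 1) / e - D u) 0 < \<epsilon>" by simp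
    qed
  qed
  then show ?thesis unfolding DERIV_def by (simp add: LIM_zero_iff)
qed


lemma fa_scale: "fa (\<lambda>x. t * u x) = \<bar>t\<bar> powr m1 * fa u"
  unfolding fa_def by (subst integral_mult_right_zero[symmetric]) (simp add: abs_mult powr_mult mult_ac)

lemma fb_scale: "fb (\<lambda>x. t * u x) = \<bar>t\<bar> powr m2 * fb u"
  unfolding fb_def by (subst integral_mult_right_zero[symmetric]) (simp add: abs_mult powr_mult mult_ac)

text \<open>The explicit first derivative of the fibering map at positive \<open>t\<close>, where
  the powers need no absolute value.\<close>

definition fiber1 :: "real \<Rightarrow> (real^'n \<Rightarrow> real) \<Rightarrow> real \<Rightarrow> real" where
  "fiber1 lam u t = (LINT z|lebesgue. A (t * pair_diff u z) * pair_diff u z * kk z)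
    - lam * t powr (m1 - 1) * fa u - t powr (m2 - 1) * fb u"

definition E2 :: "(real^'n \<Rightarrow> real) \<Rightarrow> real" where
  "E2 u = (LINT z|lebesgue. A' (pair_diff u z) * (pair_diff u z)^2 * kk z)"

lemma fiber1_1: "fiber1 lam u 1 = dual\<Phi> u u - lam * fa u - fb u"
  by (simp add: fiber1_def dual\<Phi>_def)

lemma fibering_has_deriv:
  assumes u: "u \<in> W" and t: "0 < t"
  shows "(fibering (J lam) u has_real_derivative fiber1 lam u t) (at t)"
proof -
  have "fibering (J lam) u = (\<lambda>t. (LINT z|lebesgue. even_primitive A (t * pair_diff u z) * kk z)
      - lam / m1 * (\<bar>t\<bar> powr m1 * fa u) - 1 / m2 * (\<bar>t\<bar> powr m2 * fb u))"
    by (simp add: fun_eq_iff fibering_def J_eq fa_scale fb_scale \<Phi>_def pair_diff_simps)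
  moreover have "((\<lambda>t. (LINT z|lebesgue. even_primitive A (t * pair_diff u z) * kk z)
      - lam / m1 * (\<bar>t\<bar> powr m1 * fa u) - 1 / m2 * (\<bar>t\<bar> powr m2 * fb u)) has_real_derivative
      (LINT z|lebesgue. A (t * pair_diff u z) * pair_diff u z * kk z)
      - lam / m1 * (m1 * (\<bar>t\<bar> powr (m1 - 2) * t) * fa u)
      - 1 / m2 * (m2 * (\<bar>t\<bar> powr (m2 - 2) * t) * fb u)) (at t)"
    by (intro DERIV_diff DERIV_cmult DERIV_cmult_right E.fibering_deriv[OF W_spaces(1)[OF u]] F.P_deriv H.P_deriv)
  moreover have "\<bar>t\<bar> powr (q - 2) * t = t powr (q - 1)" for q
    using t by (simp add: powr_diff power2_eq_square)
  ultimately show ?thesis using exponents m2_1 by (simp add: fiber1_def mult.assoc)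
qed

text \<open>For \<open>t\<close> within one of \<open>1\<close> the arguments stay within twice the
  size of \<open>pair_diff u z\<close>, where \<open>A\<close> has a Lipschitz constant of order
  \<open>\<bar>pair_diff u z\<bar> powr (p - 2)\<close>. The difference quotients are thus dominated
  by a multiple of the Gagliardo integrand.\<close>

lemma principal_second_deriv:
  assumes u: "u \<in> W"
  shows "integrable lebesgue (\<lambda>z. A' (pair_diff u z) * (pair_diff u z)^2 * kk z)"
    "((\<lambda>t. LINT z|lebesgue. A (t * pair_diff u z) * pair_diff u z * kk z) has_real_derivative E2 u) (at 1)"
proof -
  let ?D = "pair_diff u"
  have DW: "?D \<in> E.mod_space" using u by (rule W_spaces(1))
  have [measurable]: "?D \<in> borel_measurable lebesgue" using E.mod_spaceD(1)[OF DW] .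
  have [measurable]: "A' \<in> borel_measurable borel"
    using A'_cont by (intro borel_measurable_continuous_onI continuous_at_imp_continuous_on) blast
  let ?f = "\<lambda>t z. A (t * ?D z) * ?D z * kk z"
  let ?g = "\<lambda>z. CA * 2 powr (p - 2) * b1 * (\<bar>?D z\<bar> powr p * wt z)"
  have int: "integrable lebesgue (?f t)" for t
    using E.AV_bound(1)[OF E.mod_space_scale(1)[OF DW] DW] .
  have g: "integrable lebesgue ?g"
    using E.mod_spaceD(2)[OF DW] by simp
  have lip: "AE z in lebesgue. \<bar>?f t z - ?f 1 z\<bar> \<le> \<bar>t - 1\<bar> * ?g z" if t: "\<bar>t - 1\<bar> < 1" for t
    using E.k_le
  proof eventually_elim
    case (elim z)
    define d where "d = ?D z"
    have "\<bar>A (t * d) - A d\<bar> * \<bar>d\<bar> \<le> \<bar>t - 1\<bar> * (CA * 2 powr (p - 2) * \<bar>d\<bar> powr p)"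
    proof (cases "d = 0")
      case False
      have t2: "\<bar>t\<bar> \<le> 2" using t by linarith
      have "\<bar>A (t * d) - A d\<bar> \<le> CA * (2 * \<bar>d\<bar>) powr (p - 2) * \<bar>t * d - d\<bar> powr (2 - 1)"
        using False t2 by (intro E.A_hoelder) (auto simp: abs_mult mult_right_mono)
      also have "\<bar>t * d - d\<bar> powr (2 - 1) = \<bar>t - 1\<bar> * \<bar>d\<bar>"
        by (simp add: abs_mult[symmetric] left_diff_distrib)
      finally have "\<bar>A (t * d) - A d\<bar> * \<bar>d\<bar> \<le> CA * (2 * \<bar>d\<bar>) powr (p - 2) * (\<bar>t - 1\<bar> * \<bar>d\<bar>) * \<bar>d\<bar>"
        by (rule mult_right_mono) simp
      also have "\<dots> = \<bar>t - 1\<bar> * (CA * 2 powr (p - 2) * \<bar>d\<bar> powr p)"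
      proof -
        have dd: "\<bar>d\<bar> powr p = \<bar>d\<bar> powr (p - 2) * (\<bar>d\<bar> * \<bar>d\<bar>)"
          using False by (simp add: powr_diff power2_eq_square)
        show ?thesis unfolding dd by (simp add: powr_mult mult_ac)
      qed
      finally show ?thesis .
    qed (simp add: E.A0)
    then have "(\<bar>A (t * d) - A d\<bar> * \<bar>d\<bar>) * \<bar>kk z\<bar> \<le> (\<bar>t - 1\<bar> * (CA * 2 powr (p - 2) * \<bar>d\<bar> powr p)) * (b1 * wt z)"
      by (rule mult_mono) (use elim E.C in \<open>auto intro!: mult_nonneg_nonneg\<close>)
    moreover have "\<bar>?f t z - ?f 1 z\<bar> = (\<bar>A (t * d) - A d\<bar> * \<bar>d\<bar>) * \<bar>kk z\<bar>"
      by (simp add: d_def left_diff_distrib flip: abs_mult)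
    ultimately show ?case by (simp add: d_def mult_ac)
  qed
  have deriv: "AE z in lebesgue. ((\<lambda>t. ?f t z) has_real_derivative A' (?D z) * (?D z)^2 * kk z) (at 1)"
  proof (rule AE_I2)
    fix z
    have "((\<lambda>t. A (t * ?D z)) has_real_derivative A' (1 * ?D z) * ?D z) (at 1)"
      by (rule DERIV_chain2[OF A_deriv]) (auto intro!: derivative_eq_intros)
    from DERIV_cmult_right[OF this, of "?D z * kk z"]
    show "((\<lambda>t. ?f t z) has_real_derivative A' (?D z) * (?D z)^2 * kk z) (at 1)"
      by (simp add: power2_eq_square mult_ac)
  qed
  have m: "(\<lambda>z. A' (?D z) * (?D z)^2 * kk z) \<in> borel_measurable lebesgue"
    using E.k_meas by measurable
  note * = DERIV_integral_dominated[where f = ?f and d = 1 and g = ?g, OF _ int g lip deriv m]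
  show "integrable lebesgue (\<lambda>z. A' (?D z) * (?D z)^2 * kk z)" by (rule *(1)) simp_all
  show "((\<lambda>t. LINT z|lebesgue. ?f t z) has_real_derivative E2 u) (at 1)"
    unfolding E2_def by (rule *(2)) simp_all
qed

lemma fiber1_has_deriv:
  assumes u: "u \<in> W"
  shows "(fiber1 lam u has_real_derivative E2 u - lam * (m1 - 1) * fa u - (m2 - 1) * fb u) (at 1)"
proof -
  have pw: "((\<lambda>t. t powr (q - 1)) has_real_derivative (q - 1)) (at 1)" for q :: real
    using has_real_derivative_powr[of 1 "q - 1"] by simp
  have "((\<lambda>t. (LINT z|lebesgue. A (t * pair_diff u z) * pair_diff u z * kk z)
    - lam * t powr (m1 - 1) * fa u - t powr (m2 - 1) * fb u) has_real_derivative
    E2 u - lam * (m1 - 1) * fa u - (m2 - 1) * fb u) (at 1)"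
    by (intro DERIV_diff DERIV_cmult_right DERIV_cmult principal_second_deriv[OF u] pw)
  then show ?thesis by (simp add: fiber1_def[abs_def])
qed

section \<open>Coercivity and growth estimates\<close>

lemma kk_nonneg: "0 \<le> kk z"
  using K_nonneg by (cases z) auto

lemma At_nonneg: "0 \<le> A t * t"
  using A_growth(3)[of t] A_growth(1) by (intro order_trans[OF _ A_growth(3)]) auto

lemma even_primitive_nonneg: "0 \<le> even_primitive A t"
proof -
  have "0 \<le> p * even_primitive A t" using At_nonneg[of t] A_i[of t] by linarith
  then show ?thesis using p1 by (simp add: zero_le_mult_iff)
qed

lemma principal_integrable:
  assumes u: "u \<in> W"
  shows "integrable lebesgue (\<lambda>z. A (pair_diff u z) * pair_diff u z * kk z)"
    "integrable lebesgue (\<lambda>z. even_primitive A (pair_diff u z) * kk z)"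
  using E.AV_bound(1)[OF W_spaces(1) W_spaces(1), OF u u] E.integrable_P[OF W_spaces(1)[OF u]] by auto

lemma E2_bounds:
  assumes u: "u \<in> W"
  shows "(l - 1) * dual\<Phi> u u \<le> E2 u" "E2 u \<le> (m - 1) * dual\<Phi> u u"
proof -
  note i = principal_integrable(1)[OF u] principal_second_deriv(1)[OF u]
  have "(l - 1) * dual\<Phi> u u = (LINT z|lebesgue. (l - 1) * (A (pair_diff u z) * pair_diff u z * kk z))"
    by (simp add: dual\<Phi>_def)
  also have "\<dots> \<le> E2 u"
    unfolding E2_def
  proof (rule integral_mono)
    fix z
    show "(l - 1) * (A (pair_diff u z) * pair_diff u z * kk z) \<le> A' (pair_diff u z) * (pair_diff u z)^2 * kk z"
      using mult_right_mono[OF A_ii(1) kk_nonneg, of "pair_diff u z" z] by (simp add: mult_ac)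
  qed (use i in auto)
  finally show "(l - 1) * dual\<Phi> u u \<le> E2 u" .
  have "E2 u \<le> (LINT z|lebesgue. (m - 1) * (A (pair_diff u z) * pair_diff u z * kk z))"
    unfolding E2_def
  proof (rule integral_mono)
    fix z
    show "A' (pair_diff u z) * (pair_diff u z)^2 * kk z \<le> (m - 1) * (A (pair_diff u z) * pair_diff u z * kk z)"
      using mult_right_mono[OF A_ii(2) kk_nonneg, of "pair_diff u z" z] by (simp add: mult_ac)
  qed (use i in auto)
  then show "E2 u \<le> (m - 1) * dual\<Phi> u u" by (simp add: dual\<Phi>_def)
qed

text \<open>The coercivity constant of the principal part relative to \<open>G\<close>.\<close>

definition \<alpha> :: real where "\<alpha> = cA * b0"

lemma \<alpha>_pos: "0 < \<alpha>"
  using A_growth K_bounds by (simp add: \<alpha>_def)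

lemma dual\<Phi>_lower:
  assumes u: "u \<in> W"
  shows "\<alpha> * G u \<le> dual\<Phi> u u"
proof -
  have "\<alpha> * G u = (LINT z|lebesgue. \<alpha> * (\<bar>pair_diff u z\<bar> powr p * wt z))"
    by (simp add: gagliardo_eq_modular weighted_modular_def)
  also have "\<dots> \<le> dual\<Phi> u u"
    unfolding dual\<Phi>_def
  proof (rule integral_mono)
    fix z :: "(real^'n) \<times> (real^'n)"
    obtain x y where z: "z = (x, y)" by (cases z)
    show "\<alpha> * (\<bar>pair_diff u z\<bar> powr p * wt z) \<le> A (pair_diff u z) * pair_diff u z * kk z"
    proof (cases "x = y")
      case True
      then show ?thesis by (simp add: z pair_diff_def)
    next
      case False
      then have "0 < norm (x - y) powr (real CARD('n) + s * p)" by simp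
      then have "b0 * wt z \<le> kk z"
        using K_bounds(3)[OF False] by (simp add: z gagliardo_weight_def field_simps)
      then have "(cA * \<bar>pair_diff u z\<bar> powr p) * (b0 * wt z) \<le> (A (pair_diff u z) * pair_diff u z) * kk z"
        by (rule mult_mono[OF A_growth(3)])
          (rule At_nonneg, rule mult_nonneg_nonneg[OF less_imp_le[OF K_bounds(1)] gagliardo_weight_nonneg])
      then show ?thesis by (simp add: \<alpha>_def mult_ac)
    qed
  qed (use E.mod_spaceD(2)[OF W_spaces(1)[OF u]] principal_integrable[OF u] in auto)
  finally show ?thesis .
qed

lemma \<Phi>_lower:
  assumes u: "u \<in> W"
  shows "dual\<Phi> u u \<le> p * \<Phi> u"
proof -
  have "dual\<Phi> u u \<le> (LINT z|lebesgue. p * (even_primitive A (pair_diff u z) * kk z))"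
    unfolding dual\<Phi>_def
  proof (rule integral_mono)
    fix z
    show "A (pair_diff u z) * pair_diff u z * kk z \<le> p * (even_primitive A (pair_diff u z) * kk z)"
      using mult_right_mono[OF A_i kk_nonneg, of "pair_diff u z" z] by (simp add: mult_ac)
  qed (use principal_integrable[OF u] in auto)
  then show ?thesis by (simp add: \<Phi>_def)
qed

lemma \<Phi>_upper:
  assumes u: "u \<in> W"
  shows "\<Phi> u \<le> CA * b1 * G u"
proof -
  have "\<Phi> u \<le> (LINT z|lebesgue. CA * b1 * (\<bar>pair_diff u z\<bar> powr p * wt z))"
    unfolding \<Phi>_def
  proof (rule integral_mono_AE)
    show "AE z in lebesgue. even_primitive A (pair_diff u z) * kk z \<le> CA * b1 * (\<bar>pair_diff u z\<bar> powr p * wt z)"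
      using E.k_le
    proof eventually_elim
      case (elim z)
      have "even_primitive A (pair_diff u z) * kk z \<le> \<bar>even_primitive A (pair_diff u z)\<bar> * \<bar>kk z\<bar>"
        by (simp flip: abs_mult)
      also have "\<dots> \<le> (CA * \<bar>pair_diff u z\<bar> powr p) * (b1 * wt z)"
        using elim E.C by (intro mult_mono E.P_bound) auto
      finally show ?case by (simp add: mult_ac)
    qed
  qed (use E.mod_spaceD(2)[OF W_spaces(1)[OF u]] principal_integrable[OF u] in auto)
  then show ?thesis by (simp add: gagliardo_eq_modular weighted_modular_def)
qed

text \<open>The summand one makes \<open>D1\<close> positive, and \<open>D2\<close> likewise, since
  they appear in the denominators of the thresholds.\<close>

definition D1 :: real where "D1 = ca * C1 + 1"
definition D2 :: real where "D2 = cb * C2 + 1"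

lemma D_pos: "0 < D1" "0 < D2"
  using a(2) b(2) C1(1) C2(1) by (auto simp: D1_def D2_def intro: add_nonneg_pos)

lemma abs_integral_powr_le:
  fixes u k :: "real^'n \<Rightarrow> real" and c q :: real
  assumes i: "integrable lebesgue (\<lambda>x. \<bar>u x\<bar> powr q)" and k: "k \<in> borel_measurable lebesgue"
    and u: "u \<in> borel_measurable lebesgue" and c: "0 \<le> c" "AE x in lebesgue. \<bar>k x\<bar> \<le> c"
  shows "\<bar>LINT x|lebesgue. \<bar>u x\<bar> powr q * k x\<bar> \<le> c * (LINT x|lebesgue. \<bar>u x\<bar> powr q)"
proof -
  have le: "AE x in lebesgue. norm (\<bar>u x\<bar> powr q * k x) \<le> c * \<bar>u x\<bar> powr q"
    using c(2) by eventually_elim (auto simp: abs_mult mult.commute mult_right_mono)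
  have int: "integrable lebesgue (\<lambda>x. \<bar>u x\<bar> powr q * k x)"
  proof (rule Bochner_Integration.integrable_bound)
    show "integrable lebesgue (\<lambda>x. c * \<bar>u x\<bar> powr q)" using i by simp
    show "AE x in lebesgue. norm (\<bar>u x\<bar> powr q * k x) \<le> norm (c * \<bar>u x\<bar> powr q)"
      using le by eventually_elim auto
  qed (use k u in measurable)
  have "\<bar>LINT x|lebesgue. \<bar>u x\<bar> powr q * k x\<bar> \<le> (LINT x|lebesgue. norm (\<bar>u x\<bar> powr q * k x))"
    using integral_norm_bound[of lebesgue "\<lambda>x. \<bar>u x\<bar> powr q * k x"] by simp
  also have "\<dots> \<le> (LINT x|lebesgue. c * \<bar>u x\<bar> powr q)"
    using int i le by (intro integral_mono_AE) auto
  finally show ?thesis by simp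
qed

lemma fa_fb_le:
  assumes u: "u \<in> W" and t: "0 < t" "G u \<le> t powr p"
  shows "\<bar>fa u\<bar> \<le> D1 * t powr m1" "\<bar>fb u\<bar> \<le> D2 * t powr m2"
proof -
  have um: "u \<in> borel_measurable lebesgue" using u by (simp add: frac_sobolev0_iff)
  have "\<bar>fa u\<bar> \<le> ca * (LINT x|lebesgue. \<bar>u x\<bar> powr m1)"
    unfolding fa_def using a by (intro abs_integral_powr_le C1(2)[OF u t] um) auto
  also have "\<dots> \<le> ca * (C1 * t powr m1)" using C1(3)[OF u t] a(2) by (intro mult_left_mono) auto
  also have "\<dots> \<le> D1 * t powr m1" by (simp add: D1_def algebra_simps)
  finally show "\<bar>fa u\<bar> \<le> D1 * t powr m1" .
  have "\<bar>fb u\<bar> \<le> cb * (LINT x|lebesgue. \<bar>u x\<bar> powr m2)"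
    unfolding fb_def using b by (intro abs_integral_powr_le C2(2)[OF u t] um) auto
  also have "\<dots> \<le> cb * (C2 * t powr m2)" using C2(3)[OF u t] b(2) by (intro mult_left_mono) auto
  also have "\<dots> \<le> D2 * t powr m2" by (simp add: D2_def algebra_simps)
  finally show "\<bar>fb u\<bar> \<le> D2 * t powr m2" .
qed

text \<open>\<open>t\<close> is not tied to \<open>G u\<close>: it is the radius for estimates on
  the ball and its sphere, and it tends to zero for functions of zero seminorm.\<close>

lemma J_lower:
  assumes u: "u \<in> W" and t: "0 < t" "G u \<le> t powr p" and lam: "0 < lam"
  shows "\<alpha> / p * G u - lam / m1 * D1 * t powr m1 - 1 / m2 * D2 * t powr m2 \<le> J lam u"
proof -
  have "\<alpha> * G u \<le> p * \<Phi> u" using dual\<Phi>_lower[OF u] \<Phi>_lower[OF u] by linarith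
  then have "\<alpha> / p * G u \<le> \<Phi> u" using p1 by (simp add: field_simps)
  moreover have "lam / m1 * fa u \<le> lam / m1 * (D1 * t powr m1)"
    using fa_fb_le(1)[OF u t] lam exponents by (intro mult_left_mono) auto
  moreover have "1 / m2 * fb u \<le> 1 / m2 * (D2 * t powr m2)"
    using fa_fb_le(2)[OF u t] m2_1 by (intro mult_left_mono) auto
  ultimately show ?thesis unfolding J_eq mult.assoc by linarith
qed

section \<open>Localisation of the Nehari set\<close>

text \<open>Membership only provides some derivatives \<open>D\<close>, \<open>q\<close> and
  \<open>d\<close>; uniqueness of real derivatives identifies them with \<open>fiber1\<close> and
  its explicit derivative.\<close>

lemma nehari_plus_fiber:
  assumes v: "v \<in> nehari_plus s p \<Omega> (J lam)"
  shows "v \<in> W" "dual\<Phi> v v - lam * fa v - fb v = 0"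
    "0 < E2 v - lam * (m1 - 1) * fa v - (m2 - 1) * fb v"
proof -
  obtain D q d where vW: "v \<in> W" and D: "has_frechet_derivative_W0 s p \<Omega> (J lam) v D" "D v = 0"
    and q: "\<And>t. t > 0 \<Longrightarrow> (fibering (J lam) v has_real_derivative q t) (at t)"
    and d: "(q has_real_derivative d) (at 1)" "d > 0"
    using v by (auto simp: nehari_plus_def nehari_def)
  show "v \<in> W" by (rule vW)
  have qeq: "q t = fiber1 lam v t" if "0 < t" for t
    using DERIV_unique[OF q[OF that] fibering_has_deriv[OF vW that]] .
  have "fiber1 lam v 1 = D v"
    using DERIV_unique[OF fibering_has_deriv[OF vW, of 1] frechet_imp_fibering_deriv[OF vW D(1)]] by simp
  then show "dual\<Phi> v v - lam * fa v - fb v = 0" using D(2) by (simp add: fiber1_1)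
  \<comment> \<open>\<open>q\<close> is known only at positive arguments, which form an open set
    around one.\<close>
  have "(fiber1 lam v has_real_derivative d) (at 1)"
    by (rule has_field_derivative_transform_within_open[OF d(1), of "{0<..}"]) (auto simp: qeq)
  then have "d = E2 v - lam * (m1 - 1) * fa v - (m2 - 1) * fb v"
    using DERIV_unique fiber1_has_deriv[OF vW] by blast
  then show "0 < E2 v - lam * (m1 - 1) * fa v - (m2 - 1) * fb v" using d(2) by simp
qed

text \<open>After elimination of \<open>fb\<close> the remaining inequality has a left side of at
  least \<open>p\<close>-th order in the seminorm and a right side of at most \<open>m1\<close>-th
  order times \<open>lam\<close>. As \<open>m1 < p\<close>, a seminorm above \<rho> contradicts
  \<open>small\<close>.\<close>

lemma nehari_plus_in_ball:
  assumes v: "v \<in> nehari_plus s p \<Omega> (J lam)" and lam: "0 < lam" and \<rho>: "0 < \<rho>"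
    and small: "(m2 - m1) * lam * D1 \<le> (m2 - m) * \<alpha> * \<rho> powr (p - m1)"
  shows "G v \<le> \<rho> powr p"
proof (rule ccontr)
  assume "\<not> G v \<le> \<rho> powr p"
  then have gt: "\<rho> powr p < G v" by simp
  note nv = nehari_plus_fiber[OF v]
  define n where "n = gagliardo_norm s p v"
  have np: "n powr p = G v" by (simp add: n_def gagliardo_norm_powr)
  have "0 < G v" using gt \<rho> by (auto intro: le_less_trans[OF powr_ge_zero])
  then have n: "0 < n" by (simp add: n_def gagliardo_norm_eq)
  have \<rho>n: "\<rho> < n" using gt \<rho> n p1 np powr_mono2[of p n \<rho>] by (cases "\<rho> < n") auto
  have "0 < E2 v - lam * (m1 - 1) * fa v - (m2 - 1) * (dual\<Phi> v v - lam * fa v)"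
    using nv(2,3) by (simp add: algebra_simps)
  also have "\<dots> \<le> (m - 1) * dual\<Phi> v v - lam * (m1 - 1) * fa v - (m2 - 1) * (dual\<Phi> v v - lam * fa v)"
    using E2_bounds(2)[OF nv(1)] by simp
  finally have "(m2 - m) * dual\<Phi> v v < (m2 - m1) * (lam * fa v)"
    by (simp add: algebra_simps)
  moreover have "(m2 - m) * (\<alpha> * n powr p) \<le> (m2 - m) * dual\<Phi> v v"
    using dual\<Phi>_lower[OF nv(1)] exponents unfolding np by (intro mult_left_mono) auto
  moreover have "(m2 - m1) * (lam * fa v) \<le> (m2 - m1) * (lam * (D1 * n powr m1))"
    using fa_fb_le(1)[OF nv(1) n] np lam m1p pm2 by (intro mult_left_mono) auto
  ultimately have "(m2 - m) * (\<alpha> * n powr p) < (m2 - m1) * (lam * (D1 * n powr m1))" by linarith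
  also have "n powr p = n powr (p - m1) * n powr m1" by (simp flip: powr_add)
  finally have "((m2 - m) * \<alpha> * n powr (p - m1)) * n powr m1 < ((m2 - m1) * lam * D1) * n powr m1"
    by (simp add: mult_ac)
  then have "(m2 - m) * \<alpha> * n powr (p - m1) < (m2 - m1) * lam * D1"
    using n by (simp add: mult_less_cancel_right)
  moreover have "(m2 - m) * \<alpha> * \<rho> powr (p - m1) \<le> (m2 - m) * \<alpha> * n powr (p - m1)"
    using \<rho>n \<rho> m1p exponents \<alpha>_pos by (intro mult_left_mono powr_mono2) auto
  ultimately show False using small by linarith
qed

section \<open>Minimisation on the ball\<close>

text \<open>Along the extracted sequence the lower order terms converge, and Fatou's lemma bounds
  the principal part of the limit; together the energy of the limit does not exceed the
  infimum.\<close>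

lemma ball_minimizer:
  assumes lam: "0 < lam" and \<rho>: "0 < \<rho>"
  obtains u where "u \<in> W" "G u \<le> \<rho> powr p" "\<And>v. v \<in> W \<Longrightarrow> G v \<le> \<rho> powr p \<Longrightarrow> J lam u \<le> J lam v"
proof -
  define T where "T = \<rho> powr p"
  define ps where "ps = real CARD('n) * p / (real CARD('n) - s * p)"
  define B where "B = {u \<in> W. G u \<le> T}"
  define S where "S = J lam ` B"
  define c where "c = - lam / m1 * D1 * \<rho> powr m1 - 1 / m2 * D2 * \<rho> powr m2"
  have low: "c \<le> J lam u" if "u \<in> B" for u
  proof -
    have "0 \<le> \<alpha> / p * G u" using \<alpha>_pos p1 gagliardo_ge_0[of s p u] by simp
    then show ?thesis using J_lower[of u \<rho> lam] that \<rho> lam by (simp add: B_def T_def c_def)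
  qed
  have bdd: "bdd_below S" using low unfolding S_def by (intro bdd_belowI[of _ c]) auto
  have "(\<lambda>_. 0) \<in> B"
    by (simp add: B_def T_def frac_sobolev0_def frac_sobolev_def gagliardo_def gagliardo_integrand_def case_prod_unfold)
  then have Sne: "S \<noteq> {}" by (auto simp: S_def)
  have "\<exists>v\<in>B. J lam v < Inf S + inverse (real (Suc n))" for n
    using cInf_lessD[OF Sne, of "Inf S + inverse (real (Suc n))"] by (auto simp: S_def)
  then obtain w where w: "\<And>n. w n \<in> B" "\<And>n. J lam (w n) < Inf S + inverse (real (Suc n))" by metis
  have wW: "w n \<in> W" and wT: "G (w n) \<le> T" for n using w(1)[of n] by (auto simp: B_def)
  obtain r :: "nat \<Rightarrow> nat" and u where r: "strict_mono r" and u: "u \<in> W" "G u \<le> T"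
    and lim: "AE x in lebesgue. (\<lambda>n. w (r n) x) \<longlonglongrightarrow> u x"
    by (rule frac_sobolev0_compact[OF \<Omega> s(1) p1(1) exponents(7) wW wT]) (rule that)
  \<comment> \<open>An exponent strictly between \<open>m2\<close> and the critical one supplies the
    higher moment for both lower order terms.\<close>
  define q where "q = (m2 + ps) / 2"
  have q: "m2 < q" "q < ps" using exponents(6) by (auto simp: q_def ps_def[symmetric])
  obtain C3 where "0 \<le> C3" and C3: "\<And>u t. u \<in> W \<Longrightarrow> 0 < t \<Longrightarrow> G u \<le> t powr p \<Longrightarrow>
      integrable lebesgue (\<lambda>x. \<bar>u x\<bar> powr q) \<and> (LINT x|lebesgue. \<bar>u x\<bar> powr q) \<le> C3 * t powr q"
    using embedding_ex[of q] q m2_1 unfolding ps_def by auto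
  have um: "v \<in> borel_measurable lebesgue" if "v \<in> W" for v using that by (simp add: frac_sobolev0_iff)
  have \<Omega>f: "\<Omega> \<in> sets lebesgue" "emeasure lebesgue \<Omega> < \<infinity>"
    using \<Omega> emeasure_bounded_finite[of \<Omega>] by (auto simp: less_top)
  have fa_lim: "(\<lambda>n. fa (w (r n))) \<longlonglongrightarrow> fa u"
    unfolding fa_def
  proof (rule tendsto_integral_powr[where c = ca and S = \<Omega> and q' = q and L = "C3 * \<rho> powr q"])
    show "integrable lebesgue (\<lambda>x. \<bar>w (r n) x\<bar> powr m1)" for n
      using C1(2)[OF wW \<rho>] wT by (simp add: T_def)
    show "integrable lebesgue (\<lambda>x. \<bar>u x\<bar> powr m1)" using C1(2)[OF u(1) \<rho>] u by (simp add: T_def)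
    show "integrable lebesgue (\<lambda>x. \<bar>w (r n) x\<bar> powr q)" "(LINT x|lebesgue. \<bar>w (r n) x\<bar> powr q) \<le> C3 * \<rho> powr q" for n
      using C3[OF wW \<rho>] wT by (auto simp: T_def)
    show "integrable lebesgue (\<lambda>x. \<bar>u x\<bar> powr q)" "(LINT x|lebesgue. \<bar>u x\<bar> powr q) \<le> C3 * \<rho> powr q"
      using C3[OF u(1) \<rho>] u by (auto simp: T_def)
  qed (use a \<Omega>f um wW u lim q exponents m1p pm2 in auto)
  have fb_lim: "(\<lambda>n. fb (w (r n))) \<longlonglongrightarrow> fb u"
    unfolding fb_def
  proof (rule tendsto_integral_powr[where c = cb and S = \<Omega> and q' = q and L = "C3 * \<rho> powr q"])
    show "integrable lebesgue (\<lambda>x. \<bar>w (r n) x\<bar> powr m2)" for n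
      using C2(2)[OF wW \<rho>] wT by (simp add: T_def)
    show "integrable lebesgue (\<lambda>x. \<bar>u x\<bar> powr m2)" using C2(2)[OF u(1) \<rho>] u by (simp add: T_def)
    show "integrable lebesgue (\<lambda>x. \<bar>w (r n) x\<bar> powr q)" "(LINT x|lebesgue. \<bar>w (r n) x\<bar> powr q) \<le> C3 * \<rho> powr q" for n
      using C3[OF wW \<rho>] wT by (auto simp: T_def)
    show "integrable lebesgue (\<lambda>x. \<bar>u x\<bar> powr q)" "(LINT x|lebesgue. \<bar>u x\<bar> powr q) \<le> C3 * \<rho> powr q"
      using C3[OF u(1) \<rho>] u by (auto simp: T_def)
  qed (use b \<Omega>f um wW u lim q m2_1 in auto)
  \<comment> \<open>The near-minimality of \<open>w (r n)\<close> solved for its principal part: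
    these bounds converge, as \<open>fatou_integral_le\<close> demands.\<close>
  define bn where "bn n = Inf S + inverse (real (Suc (r n))) + lam / m1 * fa (w (r n)) + 1 / m2 * fb (w (r n))" for n
  have "(\<lambda>n. inverse (real (Suc (r n)))) \<longlonglongrightarrow> 0"
    using LIMSEQ_subseq_LIMSEQ[OF LIMSEQ_inverse_real_of_nat r] by (simp add: comp_def)
  then have bn: "bn \<longlonglongrightarrow> Inf S + 0 + lam / m1 * fa u + 1 / m2 * fb u"
    unfolding bn_def using fa_lim fb_lim by (intro tendsto_intros)
  have "\<Phi> u \<le> Inf S + 0 + lam / m1 * fa u + 1 / m2 * fb u"
    unfolding \<Phi>_def
  proof (rule fatou_integral_le(2)[OF _ _ _ _ _ bn, where f = "\<lambda>n z. even_primitive A (pair_diff (w (r n)) z) * kk z"])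
    show "integrable lebesgue (\<lambda>z. even_primitive A (pair_diff (w (r n)) z) * kk z)" for n
      by (rule principal_integrable(2)[OF wW])
    show "AE z in lebesgue. 0 \<le> even_primitive A (pair_diff (w (r n)) z) * kk z" for n
      using even_primitive_nonneg kk_nonneg by (intro AE_I2 mult_nonneg_nonneg) auto
    show "AE z in lebesgue. (\<lambda>n. even_primitive A (pair_diff (w (r n)) z) * kk z) \<longlonglongrightarrow> even_primitive A (pair_diff u z) * kk z"
      using AE_tendsto_pair_diff[OF lim]
    proof eventually_elim
      case (elim z)
      have "isCont (even_primitive A) (pair_diff u z)" using E.P_deriv DERIV_isCont by blast
      from isCont_tendsto_compose[OF this elim] show ?case by (intro tendsto_mult_right)
    qed
    show "(\<lambda>z. even_primitive A (pair_diff u z) * kk z) \<in> borel_measurable lebesgue"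
      using principal_integrable(2)[OF u(1)] by auto
    show "(LINT z|lebesgue. even_primitive A (pair_diff (w (r n)) z) * kk z) \<le> bn n" for n
      using w(2)[of "r n"] by (simp add: J_eq bn_def \<Phi>_def)
  qed
  then have "J lam u \<le> Inf S" by (simp add: J_eq)
  moreover have "Inf S \<le> J lam v" if "v \<in> B" for v
    using bdd that by (intro cInf_lower) (auto simp: S_def)
  ultimately show ?thesis
    using u by (intro that[of u]) (auto simp: B_def T_def intro: order_trans)
qed

text \<open>On small multiples \<open>t * f\<close> of a test function with \<open>0 < fa f\<close>,
  the term of order \<open>t powr m1\<close> is negative and beats those of order
  \<open>t powr p\<close> and \<open>t powr m2\<close>, since \<open>m1 < p < m2\<close>.\<close>

lemma ball_negative_energy:
  assumes lam: "0 < lam" and \<rho>: "0 < \<rho>"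
  shows "\<exists>u\<in>W. G u \<le> \<rho> powr p \<and> J lam u < 0"
proof -
  obtain f where f: "f \<in> W" and pos: "0 < fa f"
    unfolding fa_def
    by (rule frac_sobolev0_positive_weight[OF s p1(2) \<Omega> a(1) a(3) _ a(4), of m1])
      (use exponents in \<open>auto simp: indicator_def\<close>)
  define X where "X = CA * b1 * G f + \<bar>fb f\<bar> / m2"
  define Z where "Z = lam / m1 * fa f"
  have X: "0 \<le> X" unfolding X_def using E.C E.c gagliardo_ge_0[of s p f] m2_1 by simp
  have Z: "0 < Z" using lam pos exponents by (simp add: Z_def)
  \<comment> \<open>The three bounds give \<open>t powr m2 \<le> t powr p\<close>, membership of the
    ball, and \<open>X * t powr (p - m1) < Z\<close>.\<close>
  define t where "t = min (min 1 (\<rho> / (G f + 1) powr (1 / p))) ((Z / (2 * (X + 1))) powr (1 / (p - m1)))"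
  have G1: "0 < G f + 1" using gagliardo_ge_0[of s p f] by linarith
  have t: "0 < t" "t \<le> 1" "t \<le> \<rho> / (G f + 1) powr (1 / p)" "t \<le> (Z / (2 * (X + 1))) powr (1 / (p - m1))"
    using G1 \<rho> Z X by (auto simp: t_def)
  have "t powr (p - m1) \<le> ((Z / (2 * (X + 1))) powr (1 / (p - m1))) powr (p - m1)"
    using t m1p by (intro powr_mono2) auto
  also have "\<dots> = Z / (2 * (X + 1))" using m1p Z X by (simp add: powr_powr)
  finally have "X * t powr (p - m1) \<le> X * (Z / (2 * (X + 1)))" using X by (intro mult_left_mono)
  also have "\<dots> < Z"
  proof -
    have "X / (2 * (X + 1)) * Z < 1 * Z"
      using X Z by (intro mult_strict_right_mono) auto
    then show ?thesis by simp
  qed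
  finally have neg: "X * t powr (p - m1) < Z" .
  define u where "u = (\<lambda>x. t * f x)"
  have u: "u \<in> W" and Gu: "G u = t powr p * G f"
    using W_scale[OF f, of t] t by (auto simp: u_def)
  have "t powr p * G f \<le> (\<rho> / (G f + 1) powr (1 / p)) powr p * (G f + 1)"
    using t p1 gagliardo_ge_0[of s p f] by (intro mult_mono powr_mono2) auto
  also have "\<dots> = \<rho> powr p"
    using \<rho> G1 p1 by (simp add: powr_divide powr_powr)
  finally have GB: "G u \<le> \<rho> powr p" by (simp add: Gu)
  have "\<Phi> u \<le> CA * b1 * G f * t powr p"
    using \<Phi>_upper[OF u] by (simp add: Gu mult_ac)
  moreover have "- (1 / m2 * fb u) \<le> \<bar>fb f\<bar> / m2 * t powr p"
  proof -
    have "- (1 / m2 * fb u) \<le> 1 / m2 * (t powr m2 * \<bar>fb f\<bar>)"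
    proof -
      have "- fb u \<le> t powr m2 * \<bar>fb f\<bar>"
        using t mult_left_mono[of "- fb f" "\<bar>fb f\<bar>" "t powr m2"] by (simp add: u_def fb_scale)
      then have "1 / m2 * (- fb u) \<le> 1 / m2 * (t powr m2 * \<bar>fb f\<bar>)" using m2_1 by (intro mult_left_mono) auto
      then show ?thesis by simp
    qed
    also have "\<dots> \<le> 1 / m2 * (t powr p * \<bar>fb f\<bar>)"
      using t pm2 m2_1 by (intro mult_left_mono mult_right_mono powr_mono') auto
    finally show ?thesis by (simp add: mult_ac)
  qed
  ultimately have "J lam u \<le> X * t powr p - Z * t powr m1"
    unfolding J_eq using t by (simp add: X_def Z_def u_def fa_scale algebra_simps)
  also have "\<dots> = t powr m1 * (X * t powr (p - m1) - Z)"
    using t by (simp add: right_diff_distrib powr_diff mult_ac)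
  also have "\<dots> < 0" using neg t by (simp add: mult_pos_neg)
  finally show ?thesis using u GB by blast
qed


section \<open>From the minimiser to the ground state\<close>

text \<open>Along every line through \<open>u\<close> the energy is differentiable, and small steps
  stay in the ball because \<open>G\<close> is continuous along the line; zero is thus a local
  minimum in one real variable.\<close>

lemma interior_minimizer_critical:
  assumes u: "u \<in> W" "G u < \<rho> powr p" and \<rho>: "0 < \<rho>"
    and min: "\<And>v. v \<in> W \<Longrightarrow> G v \<le> \<rho> powr p \<Longrightarrow> J lam u \<le> J lam v" and v: "v \<in> W"
  shows "L lam u v = 0"
proof -
  have tv: "(\<lambda>x. u x + t * v x) \<in> W" for t using u v by (intro W_add W_scale)
  have "((\<lambda>t. J lam (\<lambda>x. u x + t * v x)) has_real_derivative L lam u v) (at 0)"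
  proof -
    have "((\<lambda>t. (LINT z|lebesgue. even_primitive A (pair_diff u z + t * pair_diff v z) * kk z)
        - lam / m1 * (LINT x|lebesgue. \<bar>u x + t * v x\<bar> powr m1 * a\<^sub>\<Omega> x)
        - 1 / m2 * (LINT x|lebesgue. \<bar>u x + t * v x\<bar> powr m2 * b\<^sub>\<Omega> x)) has_real_derivative
        (LINT z|lebesgue. A (pair_diff u z + 0 * pair_diff v z) * pair_diff v z * kk z)
        - lam / m1 * (LINT x|lebesgue. m1 * (\<bar>u x + 0 * v x\<bar> powr (m1 - 2) * (u x + 0 * v x)) * v x * a\<^sub>\<Omega> x)
        - 1 / m2 * (LINT x|lebesgue. m2 * (\<bar>u x + 0 * v x\<bar> powr (m2 - 2) * (u x + 0 * v x)) * v x * b\<^sub>\<Omega> x)) (at 0)"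
      by (intro DERIV_diff DERIV_cmult E.line_deriv F.line_deriv H.line_deriv W_spaces u v)
    then show ?thesis
      unfolding J_eq \<Phi>_def fa_def fb_def L_def dual\<Phi>_def dual_a_def dual_b_def pair_diff_simps by simp
  qed
  moreover have "isCont (\<lambda>t. G (\<lambda>x. u x + t * v x)) 0"
  proof -
    have "isCont (\<lambda>t. LINT z|lebesgue. \<bar>pair_diff u z + t * pair_diff v z\<bar> powr p * wt z) 0"
      by (rule DERIV_isCont[OF S.line_deriv]) (use W_spaces(1) u v in auto)
    then show ?thesis by (simp add: gagliardo_eq_modular weighted_modular_def pair_diff_simps)
  qed
  then have "\<forall>\<^sub>F t in at 0. G (\<lambda>x. u x + t * v x) < \<rho> powr p"
    using u(2) by (intro order_tendstoD(2)) (auto simp: isCont_def)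
  then obtain d where d: "0 < d" "\<And>t. t \<noteq> 0 \<Longrightarrow> \<bar>t\<bar> < d \<Longrightarrow> G (\<lambda>x. u x + t * v x) < \<rho> powr p"
    by (auto simp: eventually_at dist_real_def)
  show ?thesis
  proof (rule DERIV_local_min[OF calculation d(1)], intro allI impI)
    fix t :: real assume "\<bar>0 - t\<bar> < d"
    then have "G (\<lambda>x. u x + t * v x) \<le> \<rho> powr p"
      using d(2)[of t] u(2) by (cases "t = 0") auto
    then show "J lam (\<lambda>x. u x + 0 * v x) \<le> J lam (\<lambda>x. u x + t * v x)"
      using min[OF tv] by simp
  qed
qed

lemma critical_weak_solution:
  assumes u: "u \<in> W" and crit: "\<And>v. v \<in> W \<Longrightarrow> L lam u v = 0"
  shows "weak_solution s p \<Omega> A K a b m1 m2 lam u"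
  unfolding weak_solution_def
proof (intro conjI ballI u)
  fix v assume v: "v \<in> W"
  let ?a = "\<lambda>x. m1 * (\<bar>u x\<bar> powr (m1 - 2) * u x) * v x * a\<^sub>\<Omega> x"
  let ?b = "\<lambda>x. m2 * (\<bar>u x\<bar> powr (m2 - 2) * u x) * v x * b\<^sub>\<Omega> x"
  have ia: "integrable lebesgue ?a" and ib: "integrable lebesgue ?b"
    using F.AV_bound(1)[OF W_spaces(2)[OF u] W_spaces(2)[OF v]] H.AV_bound(1)[OF W_spaces(3)[OF u] W_spaces(3)[OF v]] by auto
  have "(\<lambda>(x, y). A (u x - u y) * (v x - v y) * K x y) = (\<lambda>z. A (pair_diff u z) * pair_diff v z * kk z)"
    by (auto simp: pair_diff_def fun_eq_iff)
  then have "(LINT (x, y)|lebesgue. A (u x - u y) * (v x - v y) * K x y) = dual\<Phi> u v"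
    by (simp add: dual\<Phi>_def)
  also have "\<dots> = lam / m1 * dual_a u v + 1 / m2 * dual_b u v"
    using crit[OF v] by (simp add: L_def)
  also have "\<dots> = (LINT x|lebesgue. lam / m1 * ?a x + 1 / m2 * ?b x)"
    unfolding dual_a_def dual_b_def integral_mult_right_zero[symmetric]
    by (rule Bochner_Integration.integral_add[symmetric]; intro integrable_mult_right; rule ia ib)
  also have "\<dots> = (LINT x:\<Omega>|lebesgue. lam * a x * \<bar>u x\<bar> powr (m1 - 2) * u x * v x
      + b x * \<bar>u x\<bar> powr (m2 - 2) * u x * v x)"
    unfolding set_lebesgue_integral_def
  proof (rule Bochner_Integration.integral_cong[OF refl])
    fix x
    show "lam / m1 * ?a x + 1 / m2 * ?b x = indicator \<Omega> x *\<^sub>R (lam * a x * \<bar>u x\<bar> powr (m1 - 2) * u x * v x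
        + b x * \<bar>u x\<bar> powr (m2 - 2) * u x * v x)"
      using exponents m2_1 by (cases "x \<in> \<Omega>") auto
  qed
  finally show "(LINT (x, y)|lebesgue. A (u x - u y) * (v x - v y) * K x y) =
    (LINT x:\<Omega>|lebesgue. lam * a x * \<bar>u x\<bar> powr (m1 - 2) * u x * v x
      + b x * \<bar>u x\<bar> powr (m2 - 2) * u x * v x)" .
qed

lemma dual_self: "dual_a u u = m1 * fa u" "dual_b u u = m2 * fb u"
proof -
  have pw: "\<bar>t\<bar> powr (q - 2) * (t * (t * c)) = \<bar>t\<bar> powr q * c" for q t c :: real
    by (cases "t = 0") (auto simp: powr_diff power2_eq_square)
  show "dual_a u u = m1 * fa u"
    unfolding dual_a_def fa_def integral_mult_right_zero[symmetric] by (simp only: mult.assoc pw)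
  show "dual_b u u = m2 * fb u"
    unfolding dual_b_def fb_def integral_mult_right_zero[symmetric] by (simp only: mult.assoc pw)
qed

text \<open>If \<open>G u\<close> were zero, \<open>J_lower\<close> would hold at every scale
  \<open>t > 0\<close>, and letting \<open>t\<close> tend to zero would give a nonnegative energy.
  This makes the minimiser nontrivial.\<close>

lemma gagliardo_pos_of_negative_energy:
  assumes u: "u \<in> W" and neg: "J lam u < 0" and lam: "0 < lam"
  shows "0 < G u"
proof (rule ccontr)
  assume "\<not> 0 < G u"
  then have G0: "G u = 0" using gagliardo_ge_0[of s p u] by linarith
  define c where "c t = - (lam / m1 * D1 * \<bar>t\<bar> powr m1) - 1 / m2 * D2 * \<bar>t\<bar> powr m2" for t :: real
  have "(c \<longlongrightarrow> - (lam / m1 * D1 * \<bar>0\<bar> powr m1) - 1 / m2 * D2 * \<bar>0\<bar> powr m2) (at 0)"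
    unfolding c_def using exponents m2_1 by (intro tendsto_intros) auto
  then have "(c \<longlongrightarrow> 0) (at 0)" by simp
  moreover have "\<forall>\<^sub>F t in at 0. c t \<le> J lam u"
    unfolding eventually_at
  proof (intro exI[of _ 1] conjI ballI impI)
    fix t :: real assume "t \<noteq> 0 \<and> dist t 0 < 1"
    then show "c t \<le> J lam u"
      using J_lower[OF u, of "\<bar>t\<bar>" lam] lam by (simp add: G0 c_def)
  qed simp
  ultimately have "0 \<le> J lam u" by (rule tendsto_upperbound) simp
  with neg show False by simp
qed

text \<open>At a critical point \<open>lam * fa u\<close> equals
  \<open>dual\<Phi> u u - fb u\<close>. After this substitution the lower bound on the second
  fibering derivative no longer contains \<open>lam\<close>, and \<open>small\<close> makes it
  positive, since \<open>fb\<close> is of higher order \<open>m2 > p\<close>.\<close>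

lemma critical_in_nehari_plus:
  assumes u: "u \<in> W" "0 < G u" "G u \<le> \<rho> powr p" and \<rho>: "0 < \<rho>" and lam: "0 < lam"
    and crit: "\<And>v. v \<in> W \<Longrightarrow> L lam u v = 0"
    and small: "(m2 - m1) * D2 * \<rho> powr (m2 - p) < (l - m1) * \<alpha>"
  shows "u \<in> nehari_plus s p \<Omega> (J lam)"
proof -
  define n where "n = gagliardo_norm s p u"
  have np: "n powr p = G u" by (simp add: n_def gagliardo_norm_powr)
  have n: "0 < n" using u by (simp add: n_def gagliardo_norm_eq)
  have n\<rho>: "n \<le> \<rho>"
  proof (rule ccontr)
    assume "\<not> n \<le> \<rho>"
    then have "\<rho> powr p < n powr p" using \<rho> p1 by (intro powr_less_mono2) auto
    with u(3) np show False by simp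
  qed
  have nz: "\<not> (AE x in lebesgue. u x = 0)"
  proof
    assume "AE x in lebesgue. u x = 0"
    then have "AE z in lebesgue. gagliardo_integrand s p u z = gagliardo_integrand s p (\<lambda>_. 0) z"
      by (rule gagliardo_cong)
    then have "AE z in lebesgue. gagliardo_integrand s p u z = 0"
      by eventually_elim (simp add: gagliardo_integrand_def case_prod_unfold)
    then have "G u = 0" unfolding gagliardo_def by (rule integral_eq_zero_AE)
    with u(2) show False by simp
  qed
  have neh: "u \<in> nehari s p \<Omega> (J lam)"
    using u(1) nz J_frechet[OF u(1), of lam] crit[OF u(1)] unfolding nehari_def by blast
  have eq: "dual\<Phi> u u = lam * fa u + fb u"
    using crit[OF u(1)] exponents m2_1 by (simp add: L_def dual_self)
  define d where "d = E2 u - lam * (m1 - 1) * fa u - (m2 - 1) * fb u"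
  have "(l - 1) * dual\<Phi> u u - (m1 - 1) * (dual\<Phi> u u - fb u) - (m2 - 1) * fb u \<le> d"
    using E2_bounds(1)[OF u(1)] by (simp add: d_def eq algebra_simps)
  moreover have "(l - m1) * (\<alpha> * G u) \<le> (l - m1) * dual\<Phi> u u"
    using dual\<Phi>_lower[OF u(1)] exponents by (intro mult_left_mono) auto
  moreover have "(m2 - m1) * fb u \<le> (m2 - m1) * (D2 * n powr m2)"
    using fa_fb_le(2)[OF u(1) n] np m1p pm2 by (intro mult_left_mono) auto
  ultimately have "(l - m1) * (\<alpha> * G u) - (m2 - m1) * (D2 * n powr m2) \<le> d"
    by (simp add: algebra_simps)
  moreover have "(m2 - m1) * (D2 * n powr m2) < (l - m1) * (\<alpha> * G u)"
  proof -
    have "(m2 - m1) * D2 * n powr (m2 - p) \<le> (m2 - m1) * D2 * \<rho> powr (m2 - p)"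
      using n n\<rho> m1p pm2 D_pos by (intro mult_left_mono powr_mono2) auto
    also note small
    finally have "(m2 - m1) * D2 * n powr (m2 - p) * n powr p < (l - m1) * \<alpha> * n powr p"
      using n by (simp add: mult_strict_right_mono)
    moreover have "n powr m2 = n powr (m2 - p) * n powr p" by (simp flip: powr_add)
    ultimately show ?thesis by (simp add: mult.assoc flip: np)
  qed
  ultimately have d: "0 < d" by linarith
  have "(fiber1 lam u has_real_derivative d) (at 1)"
    unfolding d_def by (rule fiber1_has_deriv[OF u(1)])
  then show ?thesis
    unfolding nehari_plus_def using neh d fibering_has_deriv[OF u(1), of _ lam] by blast
qed

text \<open>\<open>c1\<close> makes the second fibering derivative positive at nontrivial critical
  points in the ball, \<open>c2\<close> makes the energy positive on the sphere, and
  \<open>c3\<close> puts \<open>nehari_plus\<close> into the ball.\<close>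

lemma ground_state_exists:
  assumes lam: "0 < lam" and \<rho>: "0 < \<rho>"
    and c1: "(m2 - m1) * D2 * \<rho> powr (m2 - p) < (l - m1) * \<alpha>"
    and c2: "lam / m1 * D1 * \<rho> powr m1 + 1 / m2 * D2 * \<rho> powr m2 < \<alpha> / p * \<rho> powr p"
    and c3: "(m2 - m1) * lam * D1 \<le> (m2 - m) * \<alpha> * \<rho> powr (p - m1)"
  shows "\<exists>u. ground_state_plus s p \<Omega> A K a b m1 m2 lam u \<and> J lam u < 0"
proof -
  obtain u where u: "u \<in> W" "G u \<le> \<rho> powr p" and min: "\<And>v. v \<in> W \<Longrightarrow> G v \<le> \<rho> powr p \<Longrightarrow> J lam u \<le> J lam v"
    by (rule ball_minimizer[OF lam \<rho>]) (rule that)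
  obtain f where f: "f \<in> W" "G f \<le> \<rho> powr p" "J lam f < 0"
    using ball_negative_energy[OF lam \<rho>] by blast
  have neg: "J lam u < 0" using min[OF f(1,2)] f(3) by linarith
  have int: "G u < \<rho> powr p"
  proof (rule ccontr)
    assume "\<not> G u < \<rho> powr p"
    then have "G u = \<rho> powr p" using u(2) by simp
    then have "0 < J lam u" using J_lower[OF u(1) \<rho> u(2) lam] c2 by simp
    with neg show False by simp
  qed
  have crit: "L lam u v = 0" if "v \<in> W" for v
    by (rule interior_minimizer_critical[OF u(1) int \<rho> min that])
  have plus: "u \<in> nehari_plus s p \<Omega> (J lam)"
    using critical_in_nehari_plus[OF u(1) gagliardo_pos_of_negative_energy[OF u(1) neg lam] u(2) \<rho> lam crit c1] .
  have "ereal (J lam u) = (INF v\<in>nehari_plus s p \<Omega> (J lam). ereal (J lam v))"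
  proof (rule antisym)
    show "ereal (J lam u) \<le> (INF v\<in>nehari_plus s p \<Omega> (J lam). ereal (J lam v))"
    proof (rule INF_greatest)
      fix v assume v: "v \<in> nehari_plus s p \<Omega> (J lam)"
      have "J lam u \<le> J lam v"
        by (rule min[OF nehari_plus_fiber(1)[OF v] nehari_plus_in_ball[OF v lam \<rho> c3]])
      then show "ereal (J lam u) \<le> ereal (J lam v)" by simp
    qed
    show "(INF v\<in>nehari_plus s p \<Omega> (J lam). ereal (J lam v)) \<le> ereal (J lam u)"
      using plus by (rule INF_lower)
  qed
  then show ?thesis
    using critical_weak_solution[OF u(1) crit] plus neg unfolding ground_state_plus_def by blast
qed

text \<open>The radius is fixed by \<open>c1\<close> and by the demand that the \<open>m2\<close>
  term use at most half of \<open>\<alpha> / p * \<rho> powr p\<close>; \<open>lam\<close> occurs in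
  neither. The other half and \<open>c3\<close> then become upper bounds on
  \<open>lam\<close>.\<close>

theorem ground_state_small_lambda:
  "\<exists>lam0>0. \<forall>lam. 0 < lam \<and> lam < lam0 \<longrightarrow>
    (\<exists>u. ground_state_plus s p \<Omega> A K a b m1 m2 lam u \<and> J lam u < 0)"
proof -
  \<comment> \<open>\<kappa> is the prescribed value of \<open>\<rho> powr (m2 - p)\<close>. The
    factors two make \<open>c1\<close> strict and reserve half of the sphere estimate for the
    \<open>lam\<close> term.\<close>
  define \<kappa> where "\<kappa> = min ((l - m1) * \<alpha> / (2 * (m2 - m1) * D2)) (\<alpha> * m2 / (2 * p * D2))"
  have m2m1: "0 < m2 - m1" using m1p pm2 by simp
  have \<kappa>: "0 < \<kappa>" using exponents \<alpha>_pos D_pos m2m1 m2_1 p1 by (simp add: \<kappa>_def)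
  define \<rho> where "\<rho> = \<kappa> powr (1 / (m2 - p))"
  have \<rho>: "0 < \<rho>" using \<kappa> by (simp add: \<rho>_def)
  have \<rho>\<kappa>: "\<rho> powr (m2 - p) = \<kappa>" using \<kappa> pm2 by (simp add: \<rho>_def powr_powr)
  have c1: "(m2 - m1) * D2 * \<rho> powr (m2 - p) < (l - m1) * \<alpha>"
  proof -
    have pos: "0 < (l - m1) * \<alpha>" using exponents \<alpha>_pos by simp
    have "(m2 - m1) * D2 * \<kappa> \<le> (m2 - m1) * D2 * ((l - m1) * \<alpha> / (2 * (m2 - m1) * D2))"
      using m2m1 D_pos by (intro mult_left_mono) (auto simp: \<kappa>_def)
    also have "\<dots> = (l - m1) * \<alpha> / 2"
    proof -
      have "x * d * (y / (2 * x * d)) = y / 2" if "x \<noteq> 0" "d \<noteq> 0" for x d y :: real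
        using that by simp
      then show ?thesis using m2m1 D_pos by (metis less_irrefl)
    qed
    also have "\<dots> < (l - m1) * \<alpha>" using pos by simp
    finally show ?thesis by (simp add: \<rho>\<kappa>)
  qed
  have sph: "1 / m2 * D2 * \<rho> powr m2 \<le> \<alpha> / (2 * p) * \<rho> powr p"
  proof -
    have "1 / m2 * D2 * \<kappa> \<le> 1 / m2 * D2 * (\<alpha> * m2 / (2 * p * D2))"
      using m2_1 D_pos by (intro mult_left_mono) (auto simp: \<kappa>_def)
    also have "\<dots> = \<alpha> / (2 * p)" using m2_1 D_pos by simp
    finally have "1 / m2 * D2 * \<kappa> * \<rho> powr p \<le> \<alpha> / (2 * p) * \<rho> powr p"
      by (rule mult_right_mono) simp
    moreover have "\<rho> powr m2 = \<kappa> * \<rho> powr p" unfolding \<rho>\<kappa>[symmetric] by (simp flip: powr_add)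
    ultimately show ?thesis by (simp add: mult.assoc)
  qed
  \<comment> \<open>The two quotients come from solving the remaining half of the sphere estimate
    and \<open>c3\<close> for \<open>lam\<close>.\<close>
  define lam0 where "lam0 = min (\<alpha> / (2 * p) * \<rho> powr p / (D1 / m1 * \<rho> powr m1))
      ((m2 - m) * \<alpha> * \<rho> powr (p - m1) / ((m2 - m1) * D1))"
  have lam0: "0 < lam0"
    using \<alpha>_pos p1 \<rho> D_pos exponents m2m1 by (simp add: lam0_def)
  show ?thesis
  proof (intro exI[of _ lam0] conjI allI impI lam0)
    fix lam assume "0 < lam \<and> lam < lam0"
    then have lam: "0 < lam" "lam < \<alpha> / (2 * p) * \<rho> powr p / (D1 / m1 * \<rho> powr m1)"
      "lam < (m2 - m) * \<alpha> * \<rho> powr (p - m1) / ((m2 - m1) * D1)"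
      by (auto simp: lam0_def)
    have "0 < D1 / m1 * \<rho> powr m1" using D_pos exponents \<rho> by simp
    then have "lam * (D1 / m1 * \<rho> powr m1) < \<alpha> / (2 * p) * \<rho> powr p"
      using lam(2) by (subst (asm) pos_less_divide_eq) auto
    then have "lam / m1 * D1 * \<rho> powr m1 < \<alpha> / (2 * p) * \<rho> powr p" by simp
    moreover have "\<alpha> / (2 * p) * \<rho> powr p + \<alpha> / (2 * p) * \<rho> powr p = \<alpha> / p * \<rho> powr p"
      by (simp add: field_simps)
    ultimately have c2: "lam / m1 * D1 * \<rho> powr m1 + 1 / m2 * D2 * \<rho> powr m2 < \<alpha> / p * \<rho> powr p"
      using sph by linarith
    have "0 < (m2 - m1) * D1" using D_pos m2m1 by simp
    then have "lam * ((m2 - m1) * D1) < (m2 - m) * \<alpha> * \<rho> powr (p - m1)"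
      using lam(3) by (subst (asm) pos_less_divide_eq) auto
    then have c3: "(m2 - m1) * lam * D1 \<le> (m2 - m) * \<alpha> * \<rho> powr (p - m1)"
      by (simp add: mult_ac)
    show "\<exists>u. ground_state_plus s p \<Omega> A K a b m1 m2 lam u \<and> J lam u < 0"
      by (rule ground_state_exists[OF lam(1) \<rho> c1 c2 c3])
  qed
qed

end

section \<open>Reduction of the stated problem to the locale\<close>

theorem theorem1p2:
  fixes \<Omega> :: "(real^'n) set"
    and s l p m m1 m2 cA CA b0 b1 :: real
    and A A' A'' :: "real \<Rightarrow> real"
    and K :: "real^'n \<Rightarrow> real^'n \<Rightarrow> real"
    and a b :: "real^'n \<Rightarrow> real"
  assumes N: "CARD('n) \<ge> 2"
    and \<Omega>: "smooth_bounded_domain \<Omega>"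
    and s: "0 < s" "s < 1"
    and exponents: "1 < m1" "m1 < l" "l \<le> p" "p \<le> m" "m < m2"
      "m2 < real CARD('n) * p / (real CARD('n) - s * p)"
      "m < real CARD('n) / s"
      "(m2 - 1) * (m - l) < (m2 - l) * (m - m1)"
    and A_odd: "\<And>t. A (- t) = - A t"
    and A_C2: "\<And>t. (A has_real_derivative A' t) (at t)"
      "\<And>t. (A' has_real_derivative A'' t) (at t)"
      "continuous_on UNIV A''"
    and A_convex: "strictly_convex (even_primitive A)"
    and A_growth: "cA > 0" "CA > 0"
      "\<And>t. A t * t \<ge> cA * \<bar>t\<bar> powr p"
      "\<And>t. \<bar>A t\<bar> \<le> CA * \<bar>t\<bar> powr (p - 1)"
    and A_i: "\<And>t. l * even_primitive A t \<le> A t * t"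
      "\<And>t. A t * t \<le> p * even_primitive A t"
    and A_ii: "\<And>t. (l - 1) * (A t * t) \<le> t^2 * A' t"
      "\<And>t. t^2 * A' t \<le> (m - 1) * (A t * t)"
    and A_iii: "\<And>t. (l - 2) * A' t \<le> A'' t * t"
      "\<And>t. A'' t * t \<le> (m - 2) * A' t"
    and K_meas: "(\<lambda>(x, y). K x y) \<in> borel_measurable lebesgue"
    and K_nonneg: "\<And>x y. 0 \<le> K x y"
    and K_bounds: "0 < b0" "b0 \<le> b1"
      "\<And>x y. x \<noteq> y \<Longrightarrow> b0 \<le> K x y * norm (x - y) powr (real CARD('n) + s * p)"
      "\<And>x y. x \<noteq> y \<Longrightarrow> K x y * norm (x - y) powr (real CARD('n) + s * p) \<le> b1"
    and a: "L_infty \<Omega> a" "\<not> (AE x in lebesgue. x \<in> \<Omega> \<longrightarrow> max (a x) 0 = 0)"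
    and b: "L_infty \<Omega> b" "\<not> (AE x in lebesgue. x \<in> \<Omega> \<longrightarrow> max (b x) 0 = 0)"
  shows "\<exists>lam0>0. \<forall>lam. 0 < lam \<and> lam < lam0 \<longrightarrow>
    (\<exists>u. ground_state_plus s p \<Omega> A K a b m1 m2 lam u \<and>
         energy \<Omega> A K a b m1 m2 lam u < 0)"
proof -
  have A0: "A 0 = 0" using A_odd[of 0] by simp
  have p2: "2 \<le> p"
    using growth_exponent_ge_2[OF A0 A_C2(1) A_growth(1) A_growth(3)] .
  have A'_cont: "isCont A' t" for t using A_C2(2) DERIV_isCont by blast
  have pos: "0 \<le> A t * t" for t
    using A_growth(1) by (intro order_trans[OF _ A_growth(3)]) auto
  \<comment> \<open>The constant \<open>m * CA\<close> combines the growth bound on \<open>A\<close>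
    with the factor from the upper estimate in \<open>A_ii\<close>.\<close>
  have growth: "power_growth p 2 (m * CA) (even_primitive A) A"
    by (rule power_growth_even_primitive[OF A_odd A_C2(1) A'_cont, where l = l])
      (use exponents p2 A_growth(2,4) pos A_ii in auto)
  obtain ca where ca: "0 < ca" "(\<lambda>x. indicator \<Omega> x * a x) \<in> borel_measurable lebesgue"
    "AE x in lebesgue. \<bar>indicator \<Omega> x * a x\<bar> \<le> ca"
    by (rule L_infty_zero_extension[OF a(1)]) (rule that)
  obtain cb where cb: "0 < cb" "(\<lambda>x. indicator \<Omega> x * b x) \<in> borel_measurable lebesgue"
    "AE x in lebesgue. \<bar>indicator \<Omega> x * b x\<bar> \<le> cb"
    by (rule L_infty_zero_extension[OF b(1)]) (rule that)
  have a_pos: "\<not> (AE x in lebesgue. indicator \<Omega> x * a x \<le> 0)"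
  proof
    assume "AE x in lebesgue. indicator \<Omega> x * a x \<le> 0"
    then have "AE x in lebesgue. x \<in> \<Omega> \<longrightarrow> max (a x) 0 = 0"
      by eventually_elim (auto simp: max_def)
    with a(2) show False by blast
  qed
  have sp: "s * p < real CARD('n)"
  proof -
    \<comment> \<open>This follows from \<open>p \<le> m\<close> and the bound on \<open>m\<close>;
      it makes the denominator of the critical exponent positive.\<close>
    have "p < real CARD('n) / s" using exponents by linarith
    then show ?thesis using s by (simp add: field_simps)
  qed
  interpret nehari_problem \<Omega> s l p m m1 m2 cA "m * CA" b0 b1 ca cb A A' K a b
  proof (rule nehari_problem.intro)
    show "open \<Omega>" "bounded \<Omega>" using \<Omega> by (auto simp: smooth_bounded_domain_def)
    show "0 < m * CA" using A_growth exponents by simp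
    show "0 < b1" using K_bounds by simp
  qed (fact s exponents(1-6) sp p2 A_C2(1) A'_cont A_growth(1) A_growth(3) growth A_i(2) A_ii
      K_meas K_nonneg K_bounds(1) K_bounds(3) K_bounds(4) ca cb a_pos)+
  show ?thesis by (rule ground_state_small_lambda)
qed

end
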